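(* Every $f\in \mathcal{POR}$ is $\Sigma^b_1$-representable in $\textsf{\textbf{RS}}^1_2$.
   Context: $\mathbb S$ is the set of finite binary strings and $\mathbb O=\mathbb B^{\mathbb S}$ the set of oracles. $\mathcal{POR}$ is the smallest class of functions $f:\mathbb S^k\times\mathbb O\to\mathbb S$ containing the empty function, projections, word-successors, the conditional function, and the query function $Q(x,\eta)=\eta(x)$, closed under composition and bounded recursion on notation. $\textsf{\textbf{RS}}^1_2$ is the bounded theory over the word language $\mathcal{RL}$ (with $\epsilon,\mathtt 0,\mathtt 1$, concatenation, self-concatenation, $=$, prefix $\subseteq$, and a unary predicate $\mathtt{Flip}$) with basic string axioms and $\Sigma^b_1$-induction on notation. A function $f$ is $\Sigma^b_1$-representable in $\textsf{\textbf{RS}}^1_2$ if there is a $\Sigma^b_1$-formula $F(\vec x,y)$ with (1) $\textsf{\textbf{RS}}^1_2\vdash(\forall\vec x)(\exists y)F(\vec x,y)$, (2) $\textsf{\textbf{RS}}^1_2\vdash(\forall\vec x)(\forall y)(\forall z)(F(\vec x,y)\wedge F(\vec x,z)\to y=z)$, (3) for all strings $\sigma_1,\dots,\sigma_j,\tau$ and $\eta\in\mathbb O$: $f(\sigma_1,\dots,\sigma_j,\eta)=\tau$ iff $\eta$ belongs to the set of oracles for which $F(\overline{\sigma_1},\dots,\overline{\sigma_j},\overline{\tau})$ is true in the standard string model with $\mathtt{Flip}(t)$ interpreted as $\eta(t)=\mathbb 1$. *)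

theory Defs
  imports "HOL-Library.Sublist"
begin

text \<open>Strings are read from left to right; the word-successors append on the right, so
  \<open>x\<zero>\<close> is \<open>x @ [False]\<close> and \<open>x\<one>\<close> is \<open>x @ [True]\<close>.\<close>

type_synonym str = "bool list"
type_synonym bit_oracle = "str \<Rightarrow> bool"

definition str_times :: "str \<Rightarrow> str \<Rightarrow> str" where
  "str_times u w = concat (replicate (length w) u)"

text \<open>Variables are de Bruijn indices.\<close>

datatype tm =
    Var nat
  | Eps
  | Zero
  | One
  | Cat tm tm
  | Times tm tm

datatype fm =
    Flip tm
  | Eq tm tm
  | Prefix tm tm
  | Neg fm
  | Conj fm fm
  | Disj fm fm
  | Imp fm fm
  | Ex fm
  | All fm

definition Iff :: "fm \<Rightarrow> fm \<Rightarrow> fm" where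
  "Iff A B = Conj (Imp A B) (Imp B A)"

primrec tvars :: "tm \<Rightarrow> nat set" where
  "tvars (Var n) = {n}"
| "tvars Eps = {}"
| "tvars Zero = {}"
| "tvars One = {}"
| "tvars (Cat s t) = tvars s \<union> tvars t"
| "tvars (Times s t) = tvars s \<union> tvars t"

primrec fvars :: "fm \<Rightarrow> nat set" where
  "fvars (Flip t) = tvars t"
| "fvars (Eq s t) = tvars s \<union> tvars t"
| "fvars (Prefix s t) = tvars s \<union> tvars t"
| "fvars (Neg A) = fvars A"
| "fvars (Conj A B) = fvars A \<union> fvars B"
| "fvars (Disj A B) = fvars A \<union> fvars B"
| "fvars (Imp A B) = fvars A \<union> fvars B"
| "fvars (Ex A) = {n. Suc n \<in> fvars A}"
| "fvars (All A) = {n. Suc n \<in> fvars A}"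

primrec tsubst :: "(nat \<Rightarrow> tm) \<Rightarrow> tm \<Rightarrow> tm" where
  "tsubst \<theta> (Var n) = \<theta> n"
| "tsubst \<theta> Eps = Eps"
| "tsubst \<theta> Zero = Zero"
| "tsubst \<theta> One = One"
| "tsubst \<theta> (Cat s t) = Cat (tsubst \<theta> s) (tsubst \<theta> t)"
| "tsubst \<theta> (Times s t) = Times (tsubst \<theta> s) (tsubst \<theta> t)"

definition tlift :: "tm \<Rightarrow> tm" where
  "tlift = tsubst (\<lambda>n. Var (Suc n))"

definition under_binder :: "(nat \<Rightarrow> tm) \<Rightarrow> nat \<Rightarrow> tm" where
  "under_binder \<theta> = case_nat (Var 0) (\<lambda>n. tlift (\<theta> n))"

primrec fsubst :: "(nat \<Rightarrow> tm) \<Rightarrow> fm \<Rightarrow> fm" where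
  "fsubst \<theta> (Flip t) = Flip (tsubst \<theta> t)"
| "fsubst \<theta> (Eq s t) = Eq (tsubst \<theta> s) (tsubst \<theta> t)"
| "fsubst \<theta> (Prefix s t) = Prefix (tsubst \<theta> s) (tsubst \<theta> t)"
| "fsubst \<theta> (Neg A) = Neg (fsubst \<theta> A)"
| "fsubst \<theta> (Conj A B) = Conj (fsubst \<theta> A) (fsubst \<theta> B)"
| "fsubst \<theta> (Disj A B) = Disj (fsubst \<theta> A) (fsubst \<theta> B)"
| "fsubst \<theta> (Imp A B) = Imp (fsubst \<theta> A) (fsubst \<theta> B)"
| "fsubst \<theta> (Ex A) = Ex (fsubst (under_binder \<theta>) A)"
| "fsubst \<theta> (All A) = All (fsubst (under_binder \<theta>) A)"

definition flift :: "fm \<Rightarrow> fm" where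
  "flift = fsubst (\<lambda>n. Var (Suc n))"

definition inst :: "tm \<Rightarrow> fm \<Rightarrow> fm" where
  "inst t = fsubst (case_nat t Var)"

definition all_n :: "nat \<Rightarrow> fm \<Rightarrow> fm" where
  "all_n n A = (All ^^ n) A"

primrec bit_tm :: "bool \<Rightarrow> tm" where
  "bit_tm False = Zero"
| "bit_tm True = One"

definition numeral_tm :: "str \<Rightarrow> tm" where
  "numeral_tm \<sigma> = foldl (\<lambda>t b. Cat t (bit_tm b)) Eps \<sigma>"

primrec tval :: "(nat \<Rightarrow> str) \<Rightarrow> tm \<Rightarrow> str" where
  "tval \<xi> (Var n) = \<xi> n"
| "tval \<xi> Eps = []"
| "tval \<xi> Zero = [False]"
| "tval \<xi> One = [True]"
| "tval \<xi> (Cat s t) = tval \<xi> s @ tval \<xi> t"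
| "tval \<xi> (Times s t) = str_times (tval \<xi> s) (tval \<xi> t)"

primrec oracles_of :: "(nat \<Rightarrow> str) \<Rightarrow> fm \<Rightarrow> bit_oracle set" where
  "oracles_of \<xi> (Flip t) = {\<eta>. \<eta> (tval \<xi> t) = True}"
| "oracles_of \<xi> (Eq s t) = {\<eta>. tval \<xi> s = tval \<xi> t}"
| "oracles_of \<xi> (Prefix s t) = {\<eta>. prefix (tval \<xi> s) (tval \<xi> t)}"
| "oracles_of \<xi> (Neg A) = - oracles_of \<xi> A"
| "oracles_of \<xi> (Conj A B) = oracles_of \<xi> A \<inter> oracles_of \<xi> B"
| "oracles_of \<xi> (Disj A B) = oracles_of \<xi> A \<union> oracles_of \<xi> B"
| "oracles_of \<xi> (Imp A B) = - oracles_of \<xi> A \<union> oracles_of \<xi> B"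
| "oracles_of \<xi> (Ex A) = (\<Union>\<sigma>. oracles_of (case_nat \<sigma> \<xi>) A)"
| "oracles_of \<xi> (All A) = (\<Inter>\<sigma>. oracles_of (case_nat \<sigma> \<xi>) A)"

text \<open>\<open>s \<preceq> t\<close> (length comparison) abbreviates \<open>\<one> \<times> s \<subseteq> \<one> \<times> t\<close>, and \<open>s \<subseteq>\<^sup>* t\<close> (subword)
  abbreviates \<open>(\<exists>w \<subseteq> t) ws \<subseteq> t\<close>. In the bounded quantifiers, \<open>t\<close> lives outside the binder.\<close>

definition LenLe :: "tm \<Rightarrow> tm \<Rightarrow> fm" where
  "LenLe s t = Prefix (Times One s) (Times One t)"

definition Subword :: "tm \<Rightarrow> tm \<Rightarrow> fm" where
  "Subword s t = Ex (Conj (Prefix (Var 0) (tlift t)) (Prefix (Cat (Var 0) (tlift s)) (tlift t)))"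

definition ExLenLe :: "tm \<Rightarrow> fm \<Rightarrow> fm" where
  "ExLenLe t A = Ex (Conj (LenLe (Var 0) (tlift t)) A)"

definition ExSubword :: "tm \<Rightarrow> fm \<Rightarrow> fm" where
  "ExSubword t A = Ex (Conj (Subword (Var 0) (tlift t)) A)"

definition AllSubword :: "tm \<Rightarrow> fm \<Rightarrow> fm" where
  "AllSubword t A = All (Imp (Subword (Var 0) (tlift t)) A)"

inductive sigma_b_0 :: "fm \<Rightarrow> bool" where
  "sigma_b_0 (Flip t)"
| "sigma_b_0 (Eq s t)"
| "sigma_b_0 (Prefix s t)"
| "sigma_b_0 A \<Longrightarrow> sigma_b_0 (Neg A)"
| "sigma_b_0 A \<Longrightarrow> sigma_b_0 B \<Longrightarrow> sigma_b_0 (Conj A B)"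
| "sigma_b_0 A \<Longrightarrow> sigma_b_0 B \<Longrightarrow> sigma_b_0 (Disj A B)"
| "sigma_b_0 A \<Longrightarrow> sigma_b_0 B \<Longrightarrow> sigma_b_0 (Imp A B)"
| "sigma_b_0 A \<Longrightarrow> sigma_b_0 (ExSubword t A)"
| "sigma_b_0 A \<Longrightarrow> sigma_b_0 (AllSubword t A)"

inductive sigma_b_1 :: "fm \<Rightarrow> bool" where
  "sigma_b_0 A \<Longrightarrow> sigma_b_1 A"
| "sigma_b_1 A \<Longrightarrow> sigma_b_1 (ExLenLe t A)"

text \<open>Natural deduction. Hypotheses may have free variables, which \<open>AllI\<close> and \<open>ExE\<close> shift so
  that index \<open>0\<close> is the eigenvariable.\<close>

inductive derives :: "fm set \<Rightarrow> fm \<Rightarrow> bool" (infix "\<turnstile>" 50) where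
  Hyp: "A \<in> \<Gamma> \<Longrightarrow> \<Gamma> \<turnstile> A"
| ImpI: "insert A \<Gamma> \<turnstile> B \<Longrightarrow> \<Gamma> \<turnstile> Imp A B"
| ImpE: "\<Gamma> \<turnstile> Imp A B \<Longrightarrow> \<Gamma> \<turnstile> A \<Longrightarrow> \<Gamma> \<turnstile> B"
| ConjI: "\<Gamma> \<turnstile> A \<Longrightarrow> \<Gamma> \<turnstile> B \<Longrightarrow> \<Gamma> \<turnstile> Conj A B"
| ConjE1: "\<Gamma> \<turnstile> Conj A B \<Longrightarrow> \<Gamma> \<turnstile> A"
| ConjE2: "\<Gamma> \<turnstile> Conj A B \<Longrightarrow> \<Gamma> \<turnstile> B"
| DisjI1: "\<Gamma> \<turnstile> A \<Longrightarrow> \<Gamma> \<turnstile> Disj A B"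
| DisjI2: "\<Gamma> \<turnstile> B \<Longrightarrow> \<Gamma> \<turnstile> Disj A B"
| DisjE: "\<Gamma> \<turnstile> Disj A B \<Longrightarrow> insert A \<Gamma> \<turnstile> C \<Longrightarrow> insert B \<Gamma> \<turnstile> C \<Longrightarrow> \<Gamma> \<turnstile> C"
| NegI: "insert A \<Gamma> \<turnstile> B \<Longrightarrow> insert A \<Gamma> \<turnstile> Neg B \<Longrightarrow> \<Gamma> \<turnstile> Neg A"
| Classical: "insert (Neg A) \<Gamma> \<turnstile> B \<Longrightarrow> insert (Neg A) \<Gamma> \<turnstile> Neg B \<Longrightarrow> \<Gamma> \<turnstile> A"
| AllI: "flift ` \<Gamma> \<turnstile> A \<Longrightarrow> \<Gamma> \<turnstile> All A"
| AllE: "\<Gamma> \<turnstile> All A \<Longrightarrow> \<Gamma> \<turnstile> inst t A"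
| ExI: "\<Gamma> \<turnstile> inst t A \<Longrightarrow> \<Gamma> \<turnstile> Ex A"
| ExE: "\<Gamma> \<turnstile> Ex A \<Longrightarrow> insert A (flift ` \<Gamma>) \<turnstile> flift B \<Longrightarrow> \<Gamma> \<turnstile> B"
| EqRefl: "\<Gamma> \<turnstile> Eq t t"
| EqSubst: "\<Gamma> \<turnstile> Eq s t \<Longrightarrow> \<Gamma> \<turnstile> inst s A \<Longrightarrow> \<Gamma> \<turnstile> inst t A"

definition basic_axioms :: "fm set" where
  "basic_axioms = (let x = Var 0; y = Var 1 in
    { Eq (Cat x Eps) x,
      Eq (Cat x (Cat y Zero)) (Cat (Cat x y) Zero),
      Eq (Cat x (Cat y One)) (Cat (Cat x y) One),
      Eq (Times x Eps) Eps,
      Eq (Times x (Cat y Zero)) (Cat (Times x y) x),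
      Eq (Times x (Cat y One)) (Cat (Times x y) x),
      Iff (Prefix x Eps) (Eq x Eps),
      Iff (Prefix x (Cat y Zero)) (Disj (Prefix x y) (Eq x (Cat y Zero))),
      Iff (Prefix x (Cat y One)) (Disj (Prefix x y) (Eq x (Cat y One))),
      Imp (Eq (Cat x Zero) (Cat y Zero)) (Eq x y),
      Imp (Eq (Cat x One) (Cat y One)) (Eq x y),
      Neg (Eq (Cat x Zero) (Cat y One)),
      Neg (Eq (Cat x Zero) Eps),
      Neg (Eq (Cat x One) Eps) })"

text \<open>Induction on \<open>Var 0\<close>; the other free variables of \<open>B\<close> are parameters.\<close>

definition notation_induction :: "fm \<Rightarrow> fm" where
  "notation_induction B =
    Imp (Conj (inst Eps B)
          (All (Imp B
            (Conj (fsubst (case_nat (Cat (Var 0) Zero) (\<lambda>n. Var (Suc n))) B)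
                  (fsubst (case_nat (Cat (Var 0) One) (\<lambda>n. Var (Suc n))) B)))))
        (All B)"

text \<open>The axioms are universal closures; any number \<open>n\<close> of quantifiers that binds all free variables
  is admitted.\<close>

definition RS12 :: "fm set" where
  "RS12 = {all_n n A | n A.
     (A \<in> basic_axioms \<or> (\<exists>B. sigma_b_1 B \<and> A = notation_induction B)) \<and> fvars A \<subseteq> {..<n}}"

text \<open>\<open>POR k f\<close>: the function \<open>f\<close>, restricted to argument lists of length \<open>k\<close>, is a member of
  arity \<open>k\<close>. Values on lists of other lengths are irrelevant. In \<open>Bounded_Rec\<close>, the bound is given
  by a term, i.e. by explicit definition from \<open>\<epsilon>, \<zero>, \<one>\<close>, concatenation and self-concatenation,
  with variable \<open>i\<close> denoting the \<open>i\<close>-th argument, counted from \<open>0\<close>; the step value is truncated to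
  the length of the bound.\<close>

inductive POR :: "nat \<Rightarrow> (str list \<Rightarrow> bit_oracle \<Rightarrow> str) \<Rightarrow> bool" where
  Empty: "(\<And>xs \<eta>. length xs = k \<Longrightarrow> f xs \<eta> = []) \<Longrightarrow> POR k f"
| Proj: "i < k \<Longrightarrow> (\<And>xs \<eta>. length xs = k \<Longrightarrow> f xs \<eta> = xs ! i) \<Longrightarrow> POR k f"
| Word_Succ: "(\<And>x \<eta>. f [x] \<eta> = x @ [b]) \<Longrightarrow> POR 1 f"
| Cond: "(\<And>y z0 z1 \<eta>. f [[], y, z0, z1] \<eta> = y) \<Longrightarrow>
    (\<And>x y z0 z1 \<eta>. f [x @ [False], y, z0, z1] \<eta> = z0) \<Longrightarrow>
    (\<And>x y z0 z1 \<eta>. f [x @ [True], y, z0, z1] \<eta> = z1) \<Longrightarrow> POR 4 f"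
| Query: "(\<And>x \<eta>. f [x] \<eta> = [\<eta> x]) \<Longrightarrow> POR 1 f"
| Comp: "POR (length hs) g \<Longrightarrow> (\<forall>h \<in> set hs. POR k h) \<Longrightarrow>
    (\<And>xs \<eta>. length xs = k \<Longrightarrow> f xs \<eta> = g (map (\<lambda>h. h xs \<eta>) hs) \<eta>) \<Longrightarrow> POR k f"
| Bounded_Rec: "POR k g \<Longrightarrow> POR (k + 2) h0 \<Longrightarrow> POR (k + 2) h1 \<Longrightarrow> tvars t \<subseteq> {..k} \<Longrightarrow>
    (\<And>xs \<eta>. length xs = k \<Longrightarrow> f (xs @ [[]]) \<eta> = g xs \<eta>) \<Longrightarrow>
    (\<And>xs y \<eta>. length xs = k \<Longrightarrow> f (xs @ [y @ [False]]) \<eta> =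
       take (length (tval (\<lambda>i. (xs @ [y]) ! i) t)) (h0 (xs @ [y, f (xs @ [y]) \<eta>]) \<eta>)) \<Longrightarrow>
    (\<And>xs y \<eta>. length xs = k \<Longrightarrow> f (xs @ [y @ [True]]) \<eta> =
       take (length (tval (\<lambda>i. (xs @ [y]) ! i) t)) (h1 (xs @ [y, f (xs @ [y]) \<eta>]) \<eta>)) \<Longrightarrow>
    POR (k + 1) f"

text \<open>In \<open>F\<close>, index \<open>0\<close> is the output \<open>y\<close> and indices \<open>1, \<dots>, k\<close> are the inputs. In the
  uniqueness condition, indices \<open>1\<close> and \<open>0\<close> are \<open>y\<close> and \<open>z\<close>, and the inputs are shifted
  accordingly.\<close>

definition sigma_b_1_representable :: "nat \<Rightarrow> (str list \<Rightarrow> bit_oracle \<Rightarrow> str) \<Rightarrow> bool" where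
  "sigma_b_1_representable k f \<longleftrightarrow> (\<exists>F. sigma_b_1 F \<and> fvars F \<subseteq> {..k} \<and>
     RS12 \<turnstile> all_n k (Ex F) \<and>
     RS12 \<turnstile> all_n k (All (All (Imp
       (Conj (fsubst (case_nat (Var 1) (\<lambda>i. Var (i + 2))) F)
             (fsubst (case_nat (Var 0) (\<lambda>i. Var (i + 2))) F))
       (Eq (Var 1) (Var 0))))) \<and>
     (\<forall>\<sigma>s \<tau> \<eta> \<xi>. length \<sigma>s = k \<longrightarrow>
       (f \<sigma>s \<eta> = \<tau> \<longleftrightarrow>
        \<eta> \<in> oracles_of \<xi> (fsubst (case_nat (numeral_tm \<tau>) (\<lambda>i. numeral_tm (\<sigma>s ! i))) F))))"

end

theory Submission
  imports Defs "HOL-Library.Countable_Set"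
begin

text \<open>Provability in the theory is replaced by truth in all its models: a Henkin construction shows
  that a sentence true in all models with carrier \<open>str\<close> is derivable, the term models being countably
  infinite. In every model the string arithmetic needed is obtained by induction on notation.

  By induction on \<open>POR\<close>, each function has a \<open>\<Sigma>\<^sup>b\<^sub>0\<close> predicate \<open>D(z, w, x)\<close> and a bounding term \<open>t\<close> such
  that in all models some \<open>z, w\<close> of length at most \<open>|t(x)|\<close> satisfy \<open>D\<close>, that \<open>z\<close> is unique for any
  witnesses \<open>w\<close>, and that \<open>z\<close> is the value in the standard model. In a composition the witness
  contains the intermediate values and their witnesses as subwords. In a bounded recursion it contains
  the sequence of all intermediate values, coded in blocks of equal length; such a sequence exists
  by \<open>\<Sigma>\<^sup>b\<^sub>1\<close> induction, and two of them agree by \<open>\<Sigma>\<^sup>b\<^sub>0\<close> induction.\<close>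

text \<open>Truth in models replaces derivations because totality and uniqueness then become
  ordinary HOL statements about one structure. A definition cannot quantify over carrier types, so
  one countably infinite carrier is fixed; in an arbitrary model the list structure of
  \<open>str\<close> has no meaning, and every property of words has to be won from the axioms. What
  shapes the rest is the narrow induction: it accepts a block of length-bounded existential
  quantifiers in front of a formula whose quantifiers all range over subwords. As defined,
  \<open>sigma_b_1\<close> is not closed under implication or subword quantification, so a graph
  \<open>\<exists>w. D\<close> cannot itself be placed below "for every prefix of y". Hence the
  separation of \<open>D\<close> from its witness: \<open>D\<close> stays within
  \<open>sigma_b_0\<close> and can be reused inside further such formulas, while the witnesses of a
  long computation are gathered in one word that is quantified once, at the front. Uniqueness is
  demanded of the value for arbitrary witnesses, which makes the place of a witness inside that word
  immaterial.\<close>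

record interp =
  Cat_of :: "str \<Rightarrow> str \<Rightarrow> str"
  Times_of :: "str \<Rightarrow> str \<Rightarrow> str"
  Eps_of :: str
  Zero_of :: str
  One_of :: str
  Prefix_of :: "str \<Rightarrow> str \<Rightarrow> bool"
  Flip_of :: "str \<Rightarrow> bool"

primrec tev :: "interp \<Rightarrow> (nat \<Rightarrow> str) \<Rightarrow> tm \<Rightarrow> str" where
  "tev M e (Var n) = e n"
| "tev M e Eps = Eps_of M"
| "tev M e Zero = Zero_of M"
| "tev M e One = One_of M"
| "tev M e (Cat s t) = Cat_of M (tev M e s) (tev M e t)"
| "tev M e (Times s t) = Times_of M (tev M e s) (tev M e t)"

primrec sat :: "interp \<Rightarrow> (nat \<Rightarrow> str) \<Rightarrow> fm \<Rightarrow> bool" where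
  "sat M e (Flip t) = Flip_of M (tev M e t)"
| "sat M e (Eq s t) = (tev M e s = tev M e t)"
| "sat M e (Prefix s t) = Prefix_of M (tev M e s) (tev M e t)"
| "sat M e (Neg A) = (\<not> sat M e A)"
| "sat M e (Conj A B) = (sat M e A \<and> sat M e B)"
| "sat M e (Disj A B) = (sat M e A \<or> sat M e B)"
| "sat M e (Imp A B) = (sat M e A \<longrightarrow> sat M e B)"
| "sat M e (Ex A) = (\<exists>a. sat M (case_nat a e) A)"
| "sat M e (All A) = (\<forall>a. sat M (case_nat a e) A)"

definition models :: "interp \<Rightarrow> fm set \<Rightarrow> bool" where
  "models M \<Gamma> \<longleftrightarrow> (\<forall>A\<in>\<Gamma>. \<forall>e. sat M e A)"

subsection \<open>Substitution\<close>

lemma tsubst_Var [simp]: "tsubst Var t = t"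
  by (induction t) auto

lemma tsubst_tsubst [simp]: "tsubst \<theta> (tsubst \<sigma> t) = tsubst (\<lambda>n. tsubst \<theta> (\<sigma> n)) t"
  by (induction t) auto

lemma tsubst_cong: "(\<And>n. n \<in> tvars t \<Longrightarrow> \<theta> n = \<sigma> n) \<Longrightarrow> tsubst \<theta> t = tsubst \<sigma> t"
  by (induction t) auto

lemma under_binder_simps [simp]:
  "under_binder \<theta> 0 = Var 0" "under_binder \<theta> (Suc n) = tlift (\<theta> n)"
  by (auto simp: under_binder_def)

lemma under_binder_Var [simp]: "under_binder Var = Var"
  by (auto simp: fun_eq_iff under_binder_def tlift_def split: nat.split)

lemma fsubst_Var [simp]: "fsubst Var A = A"
  by (induction A) auto

lemma tsubst_under_binder_tlift: "tsubst (under_binder \<theta>) (tlift t) = tlift (tsubst \<theta> t)"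
  by (simp add: tlift_def)

lemma under_binder_comp:
  "(\<lambda>n. tsubst (under_binder \<theta>) (under_binder \<sigma> n)) = under_binder (\<lambda>n. tsubst \<theta> (\<sigma> n))"
proof
  fix n
  show "tsubst (under_binder \<theta>) (under_binder \<sigma> n) = under_binder (\<lambda>n. tsubst \<theta> (\<sigma> n)) n"
    by (cases n) (auto simp: tsubst_under_binder_tlift)
qed

lemma fsubst_fsubst: "fsubst \<theta> (fsubst \<sigma> A) = fsubst (\<lambda>n. tsubst \<theta> (\<sigma> n)) A"
  by (induction A arbitrary: \<theta> \<sigma>) (auto simp: under_binder_comp)

lemma fsubst_cong: "(\<And>n. n \<in> fvars A \<Longrightarrow> \<theta> n = \<sigma> n) \<Longrightarrow> fsubst \<theta> A = fsubst \<sigma> A"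
proof (induction A arbitrary: \<theta> \<sigma>)
  case (Ex A)
  have "fsubst (under_binder \<theta>) A = fsubst (under_binder \<sigma>) A"
    by (rule Ex.IH) (use Ex.prems in \<open>auto simp: under_binder_def split: nat.splits\<close>)
  then show ?case by simp
next
  case (All A)
  have "fsubst (under_binder \<theta>) A = fsubst (under_binder \<sigma>) A"
    by (rule All.IH) (use All.prems in \<open>auto simp: under_binder_def split: nat.splits\<close>)
  then show ?case by simp
next
  case (Flip t) then show ?case using tsubst_cong[of t \<theta> \<sigma>] by simp
next
  case (Eq s t) then show ?case using tsubst_cong[of t \<theta> \<sigma>] tsubst_cong[of s \<theta> \<sigma>] by simp
next
  case (Prefix s t) then show ?case using tsubst_cong[of t \<theta> \<sigma>] tsubst_cong[of s \<theta> \<sigma>] by simp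
next
  case (Conj A B)
  show ?case using Conj.IH[of \<theta> \<sigma>] Conj.prems by fastforce
next
  case (Disj A B)
  show ?case using Disj.IH[of \<theta> \<sigma>] Disj.prems by fastforce
next
  case (Imp A B)
  show ?case using Imp.IH[of \<theta> \<sigma>] Imp.prems by fastforce
next
  case (Neg A)
  show ?case using Neg.IH[of \<theta> \<sigma>] Neg.prems by fastforce
qed

lemma fsubst_closed: "fvars A = {} \<Longrightarrow> fsubst \<theta> A = A"
  using fsubst_cong[of A \<theta> Var] by simp

lemma fsubst_under_binder_flift: "fsubst (under_binder \<theta>) (flift A) = flift (fsubst \<theta> A)"
  by (simp add: flift_def fsubst_fsubst tlift_def)

lemma inst_fsubst_under_binder: "inst t (fsubst (under_binder \<theta>) A) = fsubst (case_nat t \<theta>) A"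
  unfolding inst_def fsubst_fsubst
  by (rule fsubst_cong) (auto simp: under_binder_def tlift_def split: nat.split)

lemma fsubst_inst: "fsubst \<theta> (inst t A) = inst (tsubst \<theta> t) (fsubst (under_binder \<theta>) A)"
  unfolding inst_fsubst_under_binder
  unfolding inst_def fsubst_fsubst
  by (rule fsubst_cong) (auto split: nat.split)

lemma finite_tvars: "finite (tvars t)"
  by (induction t) auto

lemma finite_fvars: "finite (fvars A)"
proof (induction A)
  case (Ex A)
  then show ?case using finite_vimageI[of "fvars A" Suc] by (simp add: vimage_def)
next
  case (All A)
  then show ?case using finite_vimageI[of "fvars A" Suc] by (simp add: vimage_def)
qed (auto simp: finite_tvars)

lemma tev_tsubst [simp]: "tev M e (tsubst \<theta> t) = tev M (\<lambda>n. tev M e (\<theta> n)) t"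
  by (induction t) auto

lemma tev_tlift [simp]: "tev M (case_nat a e) (tlift t) = tev M e t"
  by (simp add: tlift_def)

lemma tev_under_binder [simp]:
  "(\<lambda>n. tev M (case_nat a e) (under_binder \<theta> n)) = case_nat a (\<lambda>n. tev M e (\<theta> n))"
  by (auto simp: fun_eq_iff under_binder_def split: nat.split)

lemma sat_fsubst [simp]: "sat M e (fsubst \<theta> A) = sat M (\<lambda>n. tev M e (\<theta> n)) A"
  by (induction A arbitrary: e \<theta>) auto

lemma sat_inst: "sat M e (inst t A) = sat M (case_nat (tev M e t) e) A"
  proof -
  have "(\<lambda>n. tev M e (case_nat t Var n)) = case_nat (tev M e t) e"
    by (auto simp: fun_eq_iff split: nat.split)
  then show ?thesis by (simp add: inst_def)
qed

lemma tev_cong: "(\<And>n. n \<in> tvars t \<Longrightarrow> e n = e' n) \<Longrightarrow> tev M e t = tev M e' t"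
  by (induction t) auto

lemma sat_cong: "(\<And>n. n \<in> fvars A \<Longrightarrow> e n = e' n) \<Longrightarrow> sat M e A = sat M e' A"
proof (induction A arbitrary: e e')
  case (Ex A)
  have "sat M (case_nat a e) A = sat M (case_nat a e') A" for a
    by (rule Ex.IH) (use Ex.prems in \<open>auto split: nat.splits\<close>)
  then show ?case by simp
next
  case (All A)
  have "sat M (case_nat a e) A = sat M (case_nat a e') A" for a
    by (rule All.IH) (use All.prems in \<open>auto split: nat.splits\<close>)
  then show ?case by simp
next
  case (Flip t) then show ?case using tev_cong[of t e e'] by simp
next
  case (Eq s t) then show ?case using tev_cong[of t e e'] tev_cong[of s e e'] by simp
next
  case (Prefix s t) then show ?case using tev_cong[of t e e'] tev_cong[of s e e'] by simp
next
  case (Conj A B)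
  show ?case using Conj.IH[of e e'] Conj.prems by fastforce
next
  case (Disj A B)
  show ?case using Disj.IH[of e e'] Disj.prems by fastforce
next
  case (Imp A B)
  show ?case using Imp.IH[of e e'] Imp.prems by fastforce
next
  case (Neg A)
  show ?case using Neg.IH[of e e'] Neg.prems by fastforce
qed

subsection \<open>Structural properties of derivability\<close>

lemma weaken: "\<Gamma> \<turnstile> A \<Longrightarrow> \<Gamma> \<subseteq> \<Delta> \<Longrightarrow> \<Delta> \<turnstile> A"
proof (induction arbitrary: \<Delta> rule: derives.induct)
  case (Hyp A \<Gamma>)
  then show ?case by (auto intro: derives.Hyp)
next
  case (ImpI A \<Gamma> B)
  show ?case by (rule derives.ImpI[OF ImpI.IH[OF insert_mono[OF ImpI.prems]]])
next
  case (ImpE \<Gamma> A B)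
  show ?case by (rule derives.ImpE[OF ImpE.IH(1)[OF ImpE.prems] ImpE.IH(2)[OF ImpE.prems]])
next
  case (ConjI \<Gamma> A B)
  show ?case by (rule derives.ConjI[OF ConjI.IH(1)[OF ConjI.prems] ConjI.IH(2)[OF ConjI.prems]])
next
  case (ConjE1 \<Gamma> A B)
  show ?case by (rule derives.ConjE1[OF ConjE1.IH[OF ConjE1.prems]])
next
  case (ConjE2 \<Gamma> A B)
  show ?case by (rule derives.ConjE2[OF ConjE2.IH[OF ConjE2.prems]])
next
  case (DisjI1 \<Gamma> A B)
  show ?case by (rule derives.DisjI1[OF DisjI1.IH[OF DisjI1.prems]])
next
  case (DisjI2 \<Gamma> B A)
  show ?case by (rule derives.DisjI2[OF DisjI2.IH[OF DisjI2.prems]])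
next
  case (DisjE \<Gamma> A B C)
  show ?case by (rule derives.DisjE[OF DisjE.IH(1)[OF DisjE.prems] DisjE.IH(2)[OF insert_mono[OF DisjE.prems]] DisjE.IH(3)[OF insert_mono[OF DisjE.prems]]])
next
  case (NegI A \<Gamma> B)
  show ?case by (rule derives.NegI[OF NegI.IH(1)[OF insert_mono[OF NegI.prems]] NegI.IH(2)[OF insert_mono[OF NegI.prems]]])
next
  case (Classical A \<Gamma> B)
  show ?case by (rule derives.Classical[OF Classical.IH(1)[OF insert_mono[OF Classical.prems]] Classical.IH(2)[OF insert_mono[OF Classical.prems]]])
next
  case (AllI \<Gamma> A)
  show ?case by (rule derives.AllI[OF AllI.IH[OF image_mono[OF AllI.prems]]])
next
  case (AllE \<Gamma> A t)
  show ?case by (rule derives.AllE[OF AllE.IH[OF AllE.prems]])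
next
  case (ExI \<Gamma> t A)
  show ?case by (rule derives.ExI[OF ExI.IH[OF ExI.prems]])
next
  case (ExE \<Gamma> A B)
  show ?case by (rule derives.ExE[OF ExE.IH(1)[OF ExE.prems] ExE.IH(2)[OF insert_mono[OF image_mono[OF ExE.prems]]]])
next
  case (EqRefl \<Gamma> t)
  show ?case by (rule derives.EqRefl)
next
  case (EqSubst \<Gamma> s t A)
  show ?case by (rule derives.EqSubst[OF EqSubst.IH(1)[OF EqSubst.prems] EqSubst.IH(2)[OF EqSubst.prems]])
qed

text \<open>The quantifier rules shift the whole context, and shifting commutes with substitution
  once the substitution has passed under the binder; this takes the place of the usual eigenvariable
  condition.\<close>

lemma derives_fsubst: "\<Gamma> \<turnstile> A \<Longrightarrow> fsubst \<theta> ` \<Gamma> \<turnstile> fsubst \<theta> A"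
proof (induction arbitrary: \<theta> rule: derives.induct)
  case (AllI \<Gamma> A)
  have "fsubst (under_binder \<theta>) ` flift ` \<Gamma> = flift ` fsubst \<theta> ` \<Gamma>"
    by (simp add: image_image fsubst_under_binder_flift)
  then show ?case using AllI.IH[of "under_binder \<theta>"] by (simp add: derives.AllI)
next
  case (ExE \<Gamma> A B)
  have *: "fsubst (under_binder \<theta>) ` flift ` \<Gamma> = flift ` fsubst \<theta> ` \<Gamma>"
    by (simp add: image_image fsubst_under_binder_flift)
  have "insert (fsubst (under_binder \<theta>) A) (flift ` fsubst \<theta> ` \<Gamma>) \<turnstile> flift (fsubst \<theta> B)"
    using ExE.IH(2)[of "under_binder \<theta>"] by (simp add: * fsubst_under_binder_flift)
  then show ?case using ExE.IH(1)[of \<theta>] derives.ExE by simp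
next
  case (AllE \<Gamma> A t)
  then show ?case by (metis derives.AllE fsubst.simps(9) fsubst_inst)
next
  case (ExI \<Gamma> t A)
  then show ?case by (metis derives.ExI fsubst.simps(8) fsubst_inst)
next
  case (EqSubst \<Gamma> s t A)
  then show ?case by (metis derives.EqSubst fsubst.simps(2) fsubst_inst)
next
  case (Hyp A \<Gamma>) then show ?case by (auto intro: derives.Hyp)
next
  case (DisjE \<Gamma> A B C)
  have "fsubst \<theta> ` \<Gamma> \<turnstile> Disj (fsubst \<theta> A) (fsubst \<theta> B)" using DisjE.IH(1)[of \<theta>] by simp
  then show ?case
    by (rule derives.DisjE) (use DisjE.IH(2,3)[of \<theta>] in simp_all)
next
  case (NegI A \<Gamma> B)
  show ?case using NegI.IH[of \<theta>] by (simp add: derives.NegI)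
next
  case (Classical A \<Gamma> B)
  show ?case by (rule derives.Classical[where B = "fsubst \<theta> B"]) (use Classical.IH[of \<theta>] in simp_all)
next
  case (ImpE \<Gamma> A B)
  show ?case by (rule derives.ImpE[where A = "fsubst \<theta> A"]) (use ImpE.IH[of \<theta>] in simp_all)
next
  case (ConjE1 \<Gamma> A B)
  show ?case by (rule derives.ConjE1[where B = "fsubst \<theta> B"]) (use ConjE1.IH[of \<theta>] in simp_all)
next
  case (ConjE2 \<Gamma> A B)
  show ?case by (rule derives.ConjE2[where A = "fsubst \<theta> A"]) (use ConjE2.IH[of \<theta>] in simp_all)
next
  case (ImpI A \<Gamma> B)
  then show ?case using derives.ImpI by fastforce
next
  case (ConjI \<Gamma> A B)
  then show ?case by (simp add: derives.ConjI)
next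
  case (DisjI1 \<Gamma> A B)
  then show ?case by (simp add: derives.DisjI1)
next
  case (DisjI2 \<Gamma> B A)
  then show ?case by (simp add: derives.DisjI2)
next
  case (EqRefl \<Gamma> t)
  then show ?case by (simp add: derives.EqRefl)
qed

text \<open>Needed for the union of the Henkin stages to stay consistent. A discharged hypothesis is
  removed from the finite set found for the premise, and a finite set of shifted hypotheses is the
  shift of a finite set.\<close>

lemma compactness: "\<Gamma> \<turnstile> A \<Longrightarrow> \<exists>\<Delta>. finite \<Delta> \<and> \<Delta> \<subseteq> \<Gamma> \<and> \<Delta> \<turnstile> A"
proof -
  have cut: "\<exists>\<Delta>'. finite \<Delta>' \<and> \<Delta>' \<subseteq> \<Gamma> \<and> \<Delta> \<subseteq> insert A \<Delta>'"
    if "finite \<Delta>" "\<Delta> \<subseteq> insert A \<Gamma>" for \<Delta> \<Gamma> :: "fm set" and A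
    using that by (intro exI[of _ "\<Delta> - {A}"]) auto
  have img: "\<exists>\<Delta>'. finite \<Delta>' \<and> \<Delta>' \<subseteq> \<Gamma> \<and> \<Delta> = flift ` \<Delta>'"
    if "finite \<Delta>" "\<Delta> \<subseteq> flift ` \<Gamma>" for \<Delta> \<Gamma> :: "fm set"
    using that by (meson finite_subset_image)
  have one: "\<exists>\<Delta>. finite \<Delta> \<and> \<Delta> \<subseteq> \<Gamma> \<and> \<Delta> \<turnstile> B"
    if "\<exists>\<Delta>. finite \<Delta> \<and> \<Delta> \<subseteq> \<Gamma> \<and> \<Delta> \<turnstile> A" "\<And>\<Delta>. \<Delta> \<turnstile> A \<Longrightarrow> \<Delta> \<turnstile> B" for \<Gamma> A B
  proof -
    from that(1) obtain \<Delta> where "finite \<Delta>" "\<Delta> \<subseteq> \<Gamma>" "\<Delta> \<turnstile> A" by blast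
    then show ?thesis using that(2)[of \<Delta>] by (intro exI[of _ \<Delta>]) simp
  qed
  have two: "\<exists>\<Delta>. finite \<Delta> \<and> \<Delta> \<subseteq> \<Gamma> \<and> \<Delta> \<turnstile> C"
    if "\<exists>\<Delta>. finite \<Delta> \<and> \<Delta> \<subseteq> \<Gamma> \<and> \<Delta> \<turnstile> A" "\<exists>\<Delta>. finite \<Delta> \<and> \<Delta> \<subseteq> \<Gamma> \<and> \<Delta> \<turnstile> B"
      "\<And>\<Delta>. \<Delta> \<turnstile> A \<Longrightarrow> \<Delta> \<turnstile> B \<Longrightarrow> \<Delta> \<turnstile> C" for \<Gamma> A B C
  proof -
    from that(1,2) obtain \<Delta>1 \<Delta>2 where "finite \<Delta>1" "\<Delta>1 \<subseteq> \<Gamma>" "\<Delta>1 \<turnstile> A" "finite \<Delta>2" "\<Delta>2 \<subseteq> \<Gamma>" "\<Delta>2 \<turnstile> B"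
      by blast
    moreover have "\<Delta>1 \<union> \<Delta>2 \<turnstile> C"
      by (rule that(3)) (auto intro: weaken[OF \<open>\<Delta>1 \<turnstile> A\<close>] weaken[OF \<open>\<Delta>2 \<turnstile> B\<close>])
    ultimately show ?thesis by (intro exI[of _ "\<Delta>1 \<union> \<Delta>2"]) simp
  qed
  have ins: "\<exists>\<Delta>. finite \<Delta> \<and> \<Delta> \<subseteq> \<Gamma> \<and> insert A \<Delta> \<turnstile> B"
    if ex: "\<exists>\<Delta>. finite \<Delta> \<and> \<Delta> \<subseteq> insert A \<Gamma> \<and> \<Delta> \<turnstile> B" for \<Gamma> A B
  proof -
    obtain \<Delta> where 1: "finite \<Delta> \<and> \<Delta> \<subseteq> insert A \<Gamma> \<and> \<Delta> \<turnstile> B" using ex by (rule exE)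
    then obtain \<Delta>' where 2: "finite \<Delta>' \<and> \<Delta>' \<subseteq> \<Gamma> \<and> \<Delta> \<subseteq> insert A \<Delta>'"
      using cut[of \<Delta> A \<Gamma>] by auto
    show ?thesis using weaken[of \<Delta> B "insert A \<Delta>'"] 1 2 by (intro exI[of _ \<Delta>']) simp
  qed
  have ins2: "\<exists>\<Delta>. finite \<Delta> \<and> \<Delta> \<subseteq> \<Gamma> \<and> insert A \<Delta> \<turnstile> B \<and> insert A' \<Delta> \<turnstile> B'"
    if ex: "\<exists>\<Delta>. finite \<Delta> \<and> \<Delta> \<subseteq> insert A \<Gamma> \<and> \<Delta> \<turnstile> B" "\<exists>\<Delta>. finite \<Delta> \<and> \<Delta> \<subseteq> insert A' \<Gamma> \<and> \<Delta> \<turnstile> B'" for \<Gamma> A B A' B'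
  proof -
    obtain \<Delta>1 where 1: "finite \<Delta>1 \<and> \<Delta>1 \<subseteq> \<Gamma> \<and> insert A \<Delta>1 \<turnstile> B"
      using ins[OF ex(1)] by (rule exE)
    obtain \<Delta>2 where 2: "finite \<Delta>2 \<and> \<Delta>2 \<subseteq> \<Gamma> \<and> insert A' \<Delta>2 \<turnstile> B'"
      using ins[OF ex(2)] by (rule exE)
    have "insert A (\<Delta>1 \<union> \<Delta>2) \<turnstile> B" "insert A' (\<Delta>1 \<union> \<Delta>2) \<turnstile> B'"
      using 1 2 by (auto elim!: weaken)
    then show ?thesis using 1 2 by (intro exI[of _ "\<Delta>1 \<union> \<Delta>2"]) simp
  qed
  show "\<Gamma> \<turnstile> A \<Longrightarrow> \<exists>\<Delta>. finite \<Delta> \<and> \<Delta> \<subseteq> \<Gamma> \<and> \<Delta> \<turnstile> A"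
  proof (induction rule: derives.induct)
    case (Hyp A \<Gamma>)
    then show ?case by (intro exI[of _ "{A}"]) (simp add: derives.Hyp)
  next
    case (ImpI A \<Gamma> B)
    from ins[OF ImpI.IH] obtain \<Delta> where "finite \<Delta>" "\<Delta> \<subseteq> \<Gamma>" "insert A \<Delta> \<turnstile> B" by blast
    then show ?case by (intro exI[of _ \<Delta>]) (simp add: derives.ImpI)
  next
    case (NegI A \<Gamma> B)
    from ins2[OF NegI.IH] obtain \<Delta> where
      1: "finite \<Delta>" "\<Delta> \<subseteq> \<Gamma>" "insert (A) \<Delta> \<turnstile> B" "insert (A) \<Delta> \<turnstile> Neg B" by blast
    show ?case using 1(1,2) derives.NegI[OF 1(3,4)] by blast
  next
    case (Classical A \<Gamma> B)
    from ins2[OF Classical.IH] obtain \<Delta> where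
      1: "finite \<Delta>" "\<Delta> \<subseteq> \<Gamma>" "insert (Neg A) \<Delta> \<turnstile> B" "insert (Neg A) \<Delta> \<turnstile> Neg B" by blast
    show ?case using 1(1,2) derives.Classical[OF 1(3,4)] by blast
  next
    case (DisjE \<Gamma> A B C)
    obtain \<Delta>1 where 1: "finite \<Delta>1" "\<Delta>1 \<subseteq> \<Gamma>" "\<Delta>1 \<turnstile> Disj A B" using DisjE.IH(1) by blast
    obtain \<Delta>2 where 2: "finite \<Delta>2" "\<Delta>2 \<subseteq> \<Gamma>" "insert A \<Delta>2 \<turnstile> C" "insert B \<Delta>2 \<turnstile> C"
      using ins2[OF DisjE.IH(2,3)] by blast
    have "\<Delta>1 \<union> \<Delta>2 \<turnstile> C"
      by (rule derives.DisjE[where A = A and B = B]) (auto intro: weaken[OF 1(3)] weaken[OF 2(3)] weaken[OF 2(4)])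
    then show ?case using 1 2 by (intro exI[of _ "\<Delta>1 \<union> \<Delta>2"]) auto
  next
    case (AllI \<Gamma> A)
    then obtain \<Delta>1 where 1: "finite \<Delta>1" "\<Delta>1 \<subseteq> flift ` \<Gamma>" "\<Delta>1 \<turnstile> A" by blast
    obtain \<Delta>2 where 2: "finite \<Delta>2" "\<Delta>2 \<subseteq> \<Gamma>" "\<Delta>1 = flift ` \<Delta>2" using img[OF 1(1,2)] by blast
    show ?case using 2(1,2) derives.AllI[OF 1(3)[unfolded 2(3)]] by blast
  next
    case (ExE \<Gamma> A B)
    obtain \<Delta>1 where 1: "finite \<Delta>1" "\<Delta>1 \<subseteq> \<Gamma>" "\<Delta>1 \<turnstile> Ex A" using ExE.IH(1) by blast
    obtain \<Delta>2 where 2: "finite \<Delta>2" "\<Delta>2 \<subseteq> flift ` \<Gamma>" "insert A \<Delta>2 \<turnstile> flift B"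
      using ins[OF ExE.IH(2)] by blast
    obtain \<Delta>3 where 3: "finite \<Delta>3" "\<Delta>3 \<subseteq> \<Gamma>" "\<Delta>2 = flift ` \<Delta>3" using img[OF 2(1,2)] by blast
    have "\<Delta>1 \<union> \<Delta>3 \<turnstile> B"
      by (rule derives.ExE[where A = A]) (use 3(3) in \<open>auto intro: weaken[OF 1(3)] weaken[OF 2(3)]\<close>)
    then show ?case using 1 3 by (intro exI[of _ "\<Delta>1 \<union> \<Delta>3"]) auto
  next
    case (ImpE \<Gamma> A B)
    show ?case by (rule two[OF ImpE.IH]) (rule derives.ImpE)
  next
    case (ConjI \<Gamma> A B)
    show ?case by (rule two[OF ConjI.IH]) (rule derives.ConjI)
  next
    case (EqSubst \<Gamma> s t A)
    show ?case by (rule two[OF EqSubst.IH]) (rule derives.EqSubst)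
  next
    case (EqRefl \<Gamma> t)
    show ?case by (intro exI[of _ "{}"]) (simp add: derives.EqRefl)
  next
    case (ConjE1 \<Gamma> A B)
    show ?case by (rule one[OF ConjE1.IH]) (rule derives.ConjE1)
  next
    case (ConjE2 \<Gamma> A B)
    show ?case by (rule one[OF ConjE2.IH]) (rule derives.ConjE2)
  next
    case (DisjI1 \<Gamma> A B)
    show ?case by (rule one[OF DisjI1.IH]) (rule derives.DisjI1)
  next
    case (DisjI2 \<Gamma> A B)
    show ?case by (rule one[OF DisjI2.IH]) (rule derives.DisjI2)
  next
    case (AllE \<Gamma> A t)
    show ?case by (rule one[OF AllE.IH]) (rule derives.AllE)
  next
    case (ExI \<Gamma> t A)
    show ?case by (rule one[OF ExI.IH]) (rule derives.ExI)
  qed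
qed

subsection \<open>Completeness\<close>

instance tm :: countable by countable_datatype
instance fm :: countable by countable_datatype

definition consistent :: "fm set \<Rightarrow> bool" where
  "consistent \<Gamma> \<longleftrightarrow> \<not> (\<exists>B. \<Gamma> \<turnstile> B \<and> \<Gamma> \<turnstile> Neg B)"

lemma explosion: "\<Gamma> \<turnstile> B \<Longrightarrow> \<Gamma> \<turnstile> Neg B \<Longrightarrow> \<Gamma> \<turnstile> A"
  by (rule Classical[where B = B]) (erule weaken, blast)+

lemma consistent_subset: "consistent \<Delta> \<Longrightarrow> \<Gamma> \<subseteq> \<Delta> \<Longrightarrow> consistent \<Gamma>"
  unfolding consistent_def using weaken by blast

lemma consistent_insert_Neg: "\<not> \<Gamma> \<turnstile> A \<Longrightarrow> consistent (insert (Neg A) \<Gamma>)"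
  unfolding consistent_def using Classical by blast

lemma inconsistent_insert: "\<not> consistent (insert A \<Gamma>) \<Longrightarrow> \<Gamma> \<turnstile> Neg A"
  unfolding consistent_def using NegI by blast

text \<open>The usual freshness argument. The substitution \<open>?\<sigma>\<close> renames
  \<open>m\<close> to index 0 and shifts every other variable, so on formulas without
  \<open>m\<close> it acts as \<open>flift\<close>, and a contradiction from the instance becomes
  the second premise of \<open>ExE\<close>.\<close>

lemma consistent_witness:
  assumes con: "consistent (insert (Ex B) \<Gamma>)" and m: "\<forall>A\<in>insert (Ex B) \<Gamma>. m \<notin> fvars A"
  shows "consistent (insert (inst (Var m) B) (insert (Ex B) \<Gamma>))"
proof (rule ccontr)
  let ?\<Delta> = "insert (Ex B) \<Gamma>"
  let ?\<sigma> = "\<lambda>n. if n = m then Var 0 else Var (Suc n)"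
  assume "\<not> consistent (insert (inst (Var m) B) ?\<Delta>)"
  then have bot: "insert (inst (Var m) B) ?\<Delta> \<turnstile> C" for C
    unfolding consistent_def using explosion by blast
  have flift_eq: "fsubst ?\<sigma> ` ?\<Delta> = flift ` ?\<Delta>"
    by (rule image_cong[OF refl]) (use m in \<open>auto simp: flift_def intro!: fsubst_cong\<close>)
  have B_eq: "fsubst ?\<sigma> (inst (Var m) B) = B"
  proof -
    have "fsubst (case_nat (Var 0) ?\<sigma>) B = fsubst Var B"
      by (rule fsubst_cong) (use m in \<open>auto split: nat.split\<close>)
    then show ?thesis by (simp add: fsubst_inst inst_fsubst_under_binder)
  qed
  have der: "?\<Delta> \<turnstile> C" if C: "fvars C = {}" for C
  proof (rule ExE)
    show "?\<Delta> \<turnstile> Ex B" by (rule Hyp) simp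
    have "insert (fsubst ?\<sigma> (inst (Var m) B)) (fsubst ?\<sigma> ` ?\<Delta>) \<turnstile> fsubst ?\<sigma> C"
      using derives_fsubst[OF bot, of ?\<sigma> C] by simp
    moreover have "fsubst ?\<sigma> C = flift C"
      using C by (simp add: fsubst_closed flift_def)
    ultimately show "insert B (flift ` ?\<Delta>) \<turnstile> flift C"
      by (simp only: flift_eq B_eq)
  qed
  \<comment> \<open>A contradictory pair of closed formulas is enough, and on these
    \<open>?\<sigma>\<close> and \<open>flift\<close> agree.\<close>
  have "?\<Delta> \<turnstile> Eq Eps Eps" "?\<Delta> \<turnstile> Neg (Eq Eps Eps)" by (rule der, simp)+
  then show False using con unfolding consistent_def by blast
qed

text \<open>Variables that are fresh for the current stage play the part of Henkin constants, so the
  language is never extended.\<close>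

definition witness_of :: "fm set \<Rightarrow> fm \<Rightarrow> fm set" where
  "witness_of \<Gamma> A =
    (case A of Ex B \<Rightarrow> {inst (Var (SOME m. \<forall>C\<in>insert A \<Gamma>. m \<notin> fvars C)) B} | _ \<Rightarrow> {})"

text \<open>The Lindenbaum and the Henkin construction in one pass. The decisive step for
  \<open>A\<close> is number \<open>to_nat A\<close>, where \<open>from_nat\<close> returns
  \<open>A\<close>; an accepted existential formula gets its witness at once.\<close>

primrec henkin_stage :: "fm set \<Rightarrow> nat \<Rightarrow> fm set" where
  "henkin_stage \<Gamma> 0 = \<Gamma>"
| "henkin_stage \<Gamma> (Suc n) = (let \<Delta> = henkin_stage \<Gamma> n; A = from_nat n in
     if consistent (insert A \<Delta>) then witness_of \<Delta> A \<union> insert A \<Delta> else \<Delta>)"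

lemma witness_of_cases:
  "(\<exists>B. A = Ex B \<and> witness_of \<Gamma> A = {inst (Var (SOME m. \<forall>C\<in>insert A \<Gamma>. m \<notin> fvars C)) B}) \<or> witness_of \<Gamma> A = {}"
  by (auto simp: witness_of_def split: fm.split)

text \<open>Finiteness of the set of free variables is carried along because it is what guarantees a
  fresh variable at the next stage.\<close>

lemma henkin_stage_finite_consistent:
  assumes "finite (\<Union>(fvars ` \<Gamma>))" "consistent \<Gamma>"
  shows "finite (\<Union>(fvars ` henkin_stage \<Gamma> n)) \<and> consistent (henkin_stage \<Gamma> n)"
proof (induction n)
  case (Suc n)
  define \<Delta> where "\<Delta> = henkin_stage \<Gamma> n"
  define A :: fm where "A = from_nat n"
  show ?case
  proof (cases "consistent (insert A \<Delta>)")
    case con: True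
    have fin: "finite (\<Union>(fvars ` insert A \<Delta>))"
      using Suc finite_fvars by (simp add: \<Delta>_def)
    define m where "m = (SOME m. \<forall>C\<in>insert A \<Delta>. m \<notin> fvars C)"
    have "\<exists>m. m \<notin> \<Union>(fvars ` insert A \<Delta>)"
      using ex_new_if_finite[OF infinite_UNIV_nat fin] .
    then have m: "\<forall>C\<in>insert A \<Delta>. m \<notin> fvars C"
      unfolding m_def by (intro someI_ex[of "\<lambda>m. \<forall>C\<in>insert A \<Delta>. m \<notin> fvars C"]) blast
    have stage: "henkin_stage \<Gamma> (Suc n) = witness_of \<Delta> A \<union> insert A \<Delta>"
      using con by (simp add: \<Delta>_def A_def Let_def)
    consider B where "A = Ex B" "witness_of \<Delta> A = {inst (Var m) B}" | "witness_of \<Delta> A = {}"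
      unfolding m_def using witness_of_cases by blast
    then show ?thesis
    proof cases
      case 1
      have "consistent (insert (inst (Var m) B) (insert (Ex B) \<Delta>))"
        by (rule consistent_witness) (use con m 1 in auto)
      then show ?thesis unfolding stage using fin finite_fvars 1 by (simp del: henkin_stage.simps add: insert_commute)
    next
      case 2
      then show ?thesis unfolding stage using fin con by (simp del: henkin_stage.simps)
    qed
  next
    case False
    then show ?thesis using Suc by (simp add: \<Delta>_def A_def Let_def)
  qed
qed (use assms in auto)

lemma henkin_stage_mono: "m \<le> n \<Longrightarrow> henkin_stage \<Gamma> m \<subseteq> henkin_stage \<Gamma> n"
  by (rule lift_Suc_mono_le[of "henkin_stage \<Gamma>"]) (auto simp: Let_def)

locale henkin_theory =
  fixes H :: "fm set"
  assumes con: "consistent H"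
    and maximal: "A \<in> H \<or> Neg A \<in> H"
    and witness: "Ex B \<in> H \<Longrightarrow> \<exists>t. inst t B \<in> H"

lemma henkin_extension:
  assumes fin: "finite (\<Union>(fvars ` \<Gamma>))" and "consistent \<Gamma>"
  shows "\<exists>H. \<Gamma> \<subseteq> H \<and> henkin_theory H"
proof -
  define H where "H = (\<Union>n. henkin_stage \<Gamma> n)"
  have finite_sub: "\<exists>n. \<Delta> \<subseteq> henkin_stage \<Gamma> n" if "finite \<Delta>" "\<Delta> \<subseteq> H" for \<Delta>
    using that
  proof (induction rule: finite_induct)
    case (insert A \<Delta>)
    then obtain m n where mn: "\<Delta> \<subseteq> henkin_stage \<Gamma> m" "A \<in> henkin_stage \<Gamma> n" by (auto simp: H_def)
    show ?case
      by (rule exI[of _ "max m n"])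
        (use mn henkin_stage_mono[of m "max m n" \<Gamma>] henkin_stage_mono[of n "max m n" \<Gamma>] in auto)
  qed simp
  have con: "consistent H"
  proof (rule ccontr)
    assume "\<not> consistent H"
    then obtain B where B: "H \<turnstile> B" "H \<turnstile> Neg B" unfolding consistent_def by blast
    obtain \<Delta>1 where 1: "finite \<Delta>1 \<and> \<Delta>1 \<subseteq> H \<and> \<Delta>1 \<turnstile> B" using compactness[OF B(1)] by (rule exE)
    obtain \<Delta>2 where 2: "finite \<Delta>2 \<and> \<Delta>2 \<subseteq> H \<and> \<Delta>2 \<turnstile> Neg B" using compactness[OF B(2)] by (rule exE)
    obtain n where n: "\<Delta>1 \<union> \<Delta>2 \<subseteq> henkin_stage \<Gamma> n" using finite_sub[of "\<Delta>1 \<union> \<Delta>2"] 1 2 by auto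
    have "henkin_stage \<Gamma> n \<turnstile> B" "henkin_stage \<Gamma> n \<turnstile> Neg B"
      using 1 2 n weaken[of \<Delta>1 B] weaken[of \<Delta>2 "Neg B"] by auto
    then show False
      using henkin_stage_finite_consistent[OF assms, of n] unfolding consistent_def by blast
  qed
  have in_H: "A \<in> H \<and> witness_of (henkin_stage \<Gamma> (to_nat A)) A \<subseteq> H"
    if "consistent (insert A (henkin_stage \<Gamma> (to_nat A)))" for A
  proof -
    have "witness_of (henkin_stage \<Gamma> (to_nat A)) A \<union> insert A (henkin_stage \<Gamma> (to_nat A))
        = henkin_stage \<Gamma> (Suc (to_nat A))"
      using that by (simp add: Let_def)
    also have "\<dots> \<subseteq> H" unfolding H_def by blast
    finally show ?thesis by blast
  qed
  have sub: "henkin_stage \<Gamma> n \<subseteq> H" for n unfolding H_def by blast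
  \<comment> \<open>A rejected formula contradicts its own stage, so that stage already refutes
    it.\<close>
  have neg: "H \<turnstile> Neg A" if "A \<notin> H" for A
  proof -
    have "henkin_stage \<Gamma> (to_nat A) \<turnstile> Neg A"
      using in_H[of A] that inconsistent_insert by blast
    then show ?thesis by (rule weaken[OF _ sub])
  qed
  have "henkin_theory H"
  proof
    show "consistent H" by (rule con)
    show "A \<in> H \<or> Neg A \<in> H" for A
      using neg[of A] neg[of "Neg A"] con unfolding consistent_def by blast
    show "\<exists>t. inst t B \<in> H" if "Ex B \<in> H" for B
    proof -
      have "consistent (insert (Ex B) (henkin_stage \<Gamma> (to_nat (Ex B))))"
        by (rule consistent_subset[OF con]) (use that sub in auto)
      from in_H[OF this] show ?thesis by (auto simp: witness_of_def)
    qed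
  qed
  moreover have "\<Gamma> \<subseteq> H" using sub[of 0] by simp
  ultimately show ?thesis by blast
qed

context henkin_theory
begin

lemma derives_iff: "H \<turnstile> A \<longleftrightarrow> A \<in> H"
  using maximal[of A] con Hyp unfolding consistent_def by blast

lemma Neg_iff: "Neg A \<in> H \<longleftrightarrow> A \<notin> H"
  using maximal[of A] con Hyp unfolding consistent_def by blast

lemma Conj_iff: "Conj A B \<in> H \<longleftrightarrow> A \<in> H \<and> B \<in> H"
  using ConjI[of H A B] ConjE1[of H A B] ConjE2[of H A B] by (auto simp: derives_iff)

lemma Imp_iff: "Imp A B \<in> H \<longleftrightarrow> (A \<in> H \<longrightarrow> B \<in> H)"
proof
  assume "Imp A B \<in> H"
  then show "A \<in> H \<longrightarrow> B \<in> H" using ImpE[of H A B] by (simp add: derives_iff)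
next
  assume "A \<in> H \<longrightarrow> B \<in> H"
  then consider "Neg A \<in> H" | "B \<in> H" using Neg_iff by blast
  then have "H \<turnstile> Imp A B"
  proof cases
    case 1
    show ?thesis by (rule ImpI, rule explosion[where B = A]) (use 1 in \<open>auto intro: Hyp\<close>)
  next
    case 2
    show ?thesis by (rule ImpI, rule Hyp) (use 2 in simp)
  qed
  then show "Imp A B \<in> H" by (simp add: derives_iff)
qed

lemma Disj_iff: "Disj A B \<in> H \<longleftrightarrow> A \<in> H \<or> B \<in> H"
proof
  assume D: "Disj A B \<in> H"
  show "A \<in> H \<or> B \<in> H"
  proof (rule ccontr)
    assume "\<not> (A \<in> H \<or> B \<in> H)"
    then have N: "Neg A \<in> H" "Neg B \<in> H" by (simp_all add: Neg_iff)
    have "H \<turnstile> A"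
      by (rule DisjE[of H A B], rule Hyp[OF D], rule Hyp, simp, rule explosion[where B = B])
        (use N in \<open>auto intro: Hyp\<close>)
    then show False using N(1) by (simp add: derives_iff Neg_iff)
  qed
next
  assume "A \<in> H \<or> B \<in> H"
  then show "Disj A B \<in> H" using DisjI1[of H A B] DisjI2[of H B A] by (auto simp: derives_iff)
qed

lemma Ex_iff: "Ex A \<in> H \<longleftrightarrow> (\<exists>t. inst t A \<in> H)"
  using witness[of A] ExI[of H _ A] by (auto simp: derives_iff)

text \<open>Witnesses are available for \<open>Ex\<close> only, so a universal formula that fails
  has to be turned into an existential one before a counterexample can be named.\<close>

lemma not_All: "{Neg (All A)} \<turnstile> Ex (Neg A)"
proof (rule Classical[where B = "All A"])
  let ?\<Gamma> = "{Neg (Ex (Neg A)), Neg (All A)}"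
  show "?\<Gamma> \<turnstile> Neg (All A)" by (rule Hyp) simp
  show "?\<Gamma> \<turnstile> All A"
  proof (rule AllI, rule Classical[where B = "flift (Ex (Neg A))"])
    let ?\<Delta> = "insert (Neg A) (flift ` ?\<Gamma>)"
    have id: "inst (Var 0) (fsubst (under_binder (\<lambda>n. Var (Suc n))) A) = A"
      unfolding inst_fsubst_under_binder
      using fsubst_cong[of A "case_nat (Var 0) (\<lambda>n. Var (Suc n))" Var] by (auto split: nat.split)
    show "?\<Delta> \<turnstile> flift (Ex (Neg A))"
      unfolding flift_def fsubst.simps
      by (rule ExI[where t = "Var 0"], rule Hyp) (use id in \<open>simp add: inst_def\<close>)
    show "?\<Delta> \<turnstile> Neg (flift (Ex (Neg A)))"
      by (rule Hyp) (simp add: flift_def)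
  qed
qed

lemma All_iff: "All A \<in> H \<longleftrightarrow> (\<forall>t. inst t A \<in> H)"
proof
  assume "All A \<in> H"
  then show "\<forall>t. inst t A \<in> H" using AllE[of H A] by (simp add: derives_iff)
next
  assume *: "\<forall>t. inst t A \<in> H"
  show "All A \<in> H"
  proof (rule ccontr)
    assume "All A \<notin> H"
    then have "Neg (All A) \<in> H" by (simp add: Neg_iff)
    then have "H \<turnstile> Ex (Neg A)" using weaken[OF not_All, where \<Delta> = H] by blast
    then obtain t where "inst t (Neg A) \<in> H" using witness by (auto simp: derives_iff)
    then show False using * by (simp add: inst_def Neg_iff)
  qed
qed

definition eqv :: "tm \<Rightarrow> tm \<Rightarrow> bool" where "eqv s t \<longleftrightarrow> Eq s t \<in> H"

lemma eqv_inst: "eqv s t \<Longrightarrow> inst s A \<in> H \<Longrightarrow> inst t A \<in> H"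
  using EqSubst[of H s t A] by (simp add: derives_iff eqv_def)

lemma eqv_refl: "eqv t t"
  using EqRefl[of H t] by (simp add: derives_iff eqv_def)

lemma tsubst_tlift [simp]: "tsubst (case_nat s Var) (tlift t) = t"
  by (simp add: tlift_def)

text \<open>Besides reflexivity, \<open>EqSubst\<close> is the only rule for equality. Symmetry,
  transitivity and the congruences below each come from a formula with \<open>Var 0\<close> at the
  place to be rewritten and all other terms lifted past it.\<close>

lemma eqv_sym: "eqv s t \<Longrightarrow> eqv t s"
  using eqv_inst[of s t "Eq (Var 0) (tlift s)"] eqv_refl[of s] by (simp add: inst_def eqv_def)

lemma eqv_trans: "eqv s t \<Longrightarrow> eqv t u \<Longrightarrow> eqv s u"
  using eqv_inst[of t u "Eq (tlift s) (Var 0)"] by (simp add: inst_def eqv_def)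

lemma eqv_Cat: "eqv s s' \<Longrightarrow> eqv t t' \<Longrightarrow> eqv (Cat s t) (Cat s' t')"
  using eqv_inst[of s s' "Eq (Cat (tlift s) (tlift t)) (Cat (Var 0) (tlift t))"] eqv_refl[of "Cat s t"]
    eqv_inst[of t t' "Eq (Cat (tlift s) (tlift t)) (Cat (tlift s') (Var 0))"]
  by (simp add: inst_def eqv_def)

lemma eqv_Times: "eqv s s' \<Longrightarrow> eqv t t' \<Longrightarrow> eqv (Times s t) (Times s' t')"
  using eqv_inst[of s s' "Eq (Times (tlift s) (tlift t)) (Times (Var 0) (tlift t))"] eqv_refl[of "Times s t"]
    eqv_inst[of t t' "Eq (Times (tlift s) (tlift t)) (Times (tlift s') (Var 0))"]
  by (simp add: inst_def eqv_def)

lemma eqv_Prefix: "eqv s s' \<Longrightarrow> eqv t t' \<Longrightarrow> Prefix s t \<in> H \<Longrightarrow> Prefix s' t' \<in> H"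
  using eqv_inst[of s s' "Prefix (Var 0) (tlift t)"] eqv_inst[of t t' "Prefix (tlift s') (Var 0)"]
  by (simp add: inst_def)

lemma eqv_Flip: "eqv s s' \<Longrightarrow> Flip s \<in> H \<Longrightarrow> Flip s' \<in> H"
  using eqv_inst[of s s' "Flip (Var 0)"] by (simp add: inst_def)

text \<open>The term model: classes of terms that \<open>H\<close> equates, moved to
  \<open>str\<close> along a bijection. The hypothesis on \<open>q\<close> makes the number of
  classes infinite, without which there is no such bijection.\<close>

lemma model_exists:
  fixes q :: "nat \<Rightarrow> tm"
  assumes inf: "\<And>i j. i \<noteq> j \<Longrightarrow> \<not> eqv (q i) (q j)"
  shows "\<exists>M c. surj c \<and> (\<forall>A \<theta>. sat M (\<lambda>n. c (\<theta> n)) A \<longleftrightarrow> fsubst \<theta> A \<in> H)"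
proof -
  define K where "K = range (\<lambda>t. Collect (eqv t))"
  have eqv_cls: "Collect (eqv s) = Collect (eqv t) \<longleftrightarrow> eqv s t" for s t
    using eqv_refl eqv_sym eqv_trans by blast
  have "inj (\<lambda>i. Collect (eqv (q i)))"
    by (rule injI) (use inf eqv_cls in blast)
  moreover have "range (\<lambda>i. Collect (eqv (q i))) \<subseteq> K" unfolding K_def by blast
  ultimately have "infinite K"
    using finite_subset range_inj_infinite by blast
  moreover have "countable K" unfolding K_def by simp
  ultimately have 1: "bij_betw (to_nat_on K) K UNIV" by (rule to_nat_on_infinite[rotated])
  have 2: "bij_betw (from_nat_into (UNIV :: str set)) UNIV UNIV"
    by (rule bij_betw_from_nat_into) (auto simp: infinite_UNIV_listI)
  define g where "g = from_nat_into (UNIV :: str set) \<circ> to_nat_on K"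
  have g: "bij_betw g K UNIV" unfolding g_def by (rule bij_betw_trans[OF 1 2])
  define c where "c t = g (Collect (eqv t))" for t
  have c_eq: "c s = c t \<longleftrightarrow> eqv s t" for s t
    using inj_on_eq_iff[OF bij_betw_imp_inj_on[OF g], of "Collect (eqv s)" "Collect (eqv t)"] eqv_cls
    unfolding c_def K_def by blast
  have "surj c"
    using bij_betw_imp_surj_on[OF g] unfolding c_def K_def by (simp add: image_image)
  \<comment> \<open>\<open>r\<close> picks a representative term, on which the operations are
    computed; \<open>eqv\<close> being a congruence makes the choice harmless.\<close>
  define r where "r = inv c"
  have c_r: "c (r a) = a" for a unfolding r_def by (rule surj_f_inv_f[OF \<open>surj c\<close>])
  have r_c: "eqv (r (c t)) t" for t using c_r[of "c t"] c_eq by blast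
  define M where "M = \<lparr>Cat_of = (\<lambda>a b. c (Cat (r a) (r b))), Times_of = (\<lambda>a b. c (Times (r a) (r b))),
    Eps_of = c Eps, Zero_of = c Zero, One_of = c One,
    Prefix_of = (\<lambda>a b. Prefix (r a) (r b) \<in> H), Flip_of = (\<lambda>a. Flip (r a) \<in> H)\<rparr>"
  have tev: "tev M (\<lambda>n. c (\<theta> n)) t = c (tsubst \<theta> t)" for \<theta> t
    by (induction t) (auto simp: M_def c_eq intro: eqv_Cat eqv_Times r_c)
  have "sat M (\<lambda>n. c (\<theta> n)) A \<longleftrightarrow> fsubst \<theta> A \<in> H" for A \<theta>
  proof (induction A arbitrary: \<theta>)
    case (Flip t)
    have "Flip (r (c (tsubst \<theta> t))) \<in> H \<longleftrightarrow> Flip (tsubst \<theta> t) \<in> H"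
      using eqv_Flip r_c eqv_sym by blast
    then show ?case by (simp add: tev) (simp add: M_def)
  next
    case (Eq s t)
    show ?case by (simp add: tev c_eq) (simp add: eqv_def)
  next
    case (Prefix s t)
    have "Prefix (r (c (tsubst \<theta> s))) (r (c (tsubst \<theta> t))) \<in> H \<longleftrightarrow> Prefix (tsubst \<theta> s) (tsubst \<theta> t) \<in> H"
      using eqv_Prefix r_c eqv_sym by blast
    then show ?case by (simp add: tev) (simp add: M_def)
  next
    case (Ex A)
    \<comment> \<open>Every carrier element is named by a term, so quantifying over the carrier is
      quantifying over terms.\<close>
    have "(\<exists>a. sat M (case_nat a (\<lambda>n. c (\<theta> n))) A) \<longleftrightarrow> (\<exists>t. sat M (\<lambda>n. c (case_nat t \<theta> n)) A)"
    proof -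
      have "case_nat (c t) (\<lambda>n. c (\<theta> n)) = (\<lambda>n. c (case_nat t \<theta> n))" for t
        by (auto split: nat.split)
      then show ?thesis by (metis c_r)
    qed
    then show ?case by (simp add: Ex Ex_iff inst_fsubst_under_binder)
  next
    case (All A)
    have "(\<forall>a. sat M (case_nat a (\<lambda>n. c (\<theta> n))) A) \<longleftrightarrow> (\<forall>t. sat M (\<lambda>n. c (case_nat t \<theta> n)) A)"
    proof -
      have "case_nat (c t) (\<lambda>n. c (\<theta> n)) = (\<lambda>n. c (case_nat t \<theta> n))" for t
        by (auto split: nat.split)
      then show ?thesis by (metis c_r)
    qed
    then show ?case by (simp add: All All_iff inst_fsubst_under_binder)
  qed (auto simp: Neg_iff Conj_iff Disj_iff Imp_iff)
  with \<open>surj c\<close> show ?thesis by blast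
qed

end

text \<open>Only infinite models can have the carrier \<open>str\<close>; the provably distinct
  terms \<open>q i\<close> ensure that the term model is one of them. Closedness leaves all
  variables available as witnesses and makes truth independent of the environment.\<close>

theorem completeness:
  fixes q :: "nat \<Rightarrow> tm"
  assumes closed: "\<And>B. B \<in> \<Gamma> \<Longrightarrow> fvars B = {}" "fvars A = {}"
    and inf: "\<And>i j. i \<noteq> j \<Longrightarrow> \<Gamma> \<turnstile> Neg (Eq (q i) (q j))"
    and valid: "\<And>M e. models M \<Gamma> \<Longrightarrow> sat M e A"
  shows "\<Gamma> \<turnstile> A"
proof (rule ccontr)
  assume "\<not> \<Gamma> \<turnstile> A"
  then have "consistent (insert (Neg A) \<Gamma>)" by (rule consistent_insert_Neg)
  then obtain H where H: "insert (Neg A) \<Gamma> \<subseteq> H" "henkin_theory H"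
    using henkin_extension[of "insert (Neg A) \<Gamma>"] closed by auto
  interpret henkin_theory H by fact
  have "\<not> eqv (q i) (q j)" if "i \<noteq> j" for i j
    using weaken[OF inf[OF that], of H] H(1) by (simp add: derives_iff Neg_iff eqv_def)
  then obtain M c where "surj c" and M: "\<And>A \<theta>. sat M (\<lambda>n. c (\<theta> n)) A \<longleftrightarrow> fsubst \<theta> A \<in> H"
    using model_exists[of q] by blast
  have all: "sat M e B" if "B \<in> H" "fvars B = {}" for B e
  proof -
    \<comment> \<open>Since \<open>c\<close> is onto, every environment arises from a substitution
      of terms.\<close>
    have "sat M (\<lambda>n. c (inv c (e n))) B" unfolding M using that by (simp add: fsubst_closed)
    then show ?thesis using \<open>surj c\<close> by (simp add: surj_f_inv_f)
  qed
  then have "models M \<Gamma>" using H(1) closed by (auto simp: models_def)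
  moreover have "sat M e (Neg A)" for e using H(1) closed by (intro all) auto
  ultimately show False using valid by auto
qed

subsection \<open>Models of the bounded theory\<close>

lemma sat_all_n: "sat M e (all_n n A) \<longleftrightarrow> (\<forall>e'. (\<forall>i. e' (i + n) = e i) \<longrightarrow> sat M e' A)"
proof (induction n arbitrary: e)
  case 0
  have "e' = e" if "\<forall>i. e' i = e i" for e' using that by auto
  then show ?case by (auto simp: all_n_def)
next
  case (Suc n)
  have "sat M e (all_n (Suc n) A) \<longleftrightarrow> (\<forall>a. sat M (case_nat a e) (all_n n A))"
    by (simp add: all_n_def)
  also have "\<dots> \<longleftrightarrow> (\<forall>a e'. (\<forall>i. e' (i + n) = case_nat a e i) \<longrightarrow> sat M e' A)"
    by (simp add: Suc)
  also have "\<dots> \<longleftrightarrow> (\<forall>e'. (\<forall>i. e' (i + Suc n) = e i) \<longrightarrow> sat M e' A)"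
  proof -
    have "(\<forall>i. e' (i + n) = case_nat a e i) \<longleftrightarrow> e' n = a \<and> (\<forall>i. e' (i + Suc n) = e i)" for a e'
    proof -
      have "(\<forall>i. P i) \<longleftrightarrow> P 0 \<and> (\<forall>i. P (Suc i))" for P :: "nat \<Rightarrow> bool"
        by (metis nat.exhaust)
      from this[of "\<lambda>i. e' (i + n) = case_nat a e i"] show ?thesis by simp
    qed
    then show ?thesis by auto
  qed
  finally show ?case .
qed

lemma sat_all_n_closed:
  assumes "fvars A \<subseteq> {..<n}"
  shows "sat M e (all_n n A) \<longleftrightarrow> (\<forall>e. sat M e A)"
proof -
  have "sat M e' A" if *: "sat M e (all_n n A)" for e'
  proof -
    have "sat M (\<lambda>i. if i < n then e' i else e (i - n)) A" using * by (simp add: sat_all_n)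
    moreover have "sat M e' A = sat M (\<lambda>i. if i < n then e' i else e (i - n)) A"
      by (rule sat_cong) (use assms in auto)
    ultimately show ?thesis by simp
  qed
  then show ?thesis by (auto simp: sat_all_n)
qed

lemma fvars_all_n: "fvars (all_n n A) = {m. m + n \<in> fvars A}"
proof (induction n)
  case (Suc n)
  then show ?case by (simp add: all_n_def)
qed (simp add: all_n_def)

lemma closed_all_n: "fvars A \<subseteq> {..<n} \<Longrightarrow> fvars (all_n n A) = {}"
  by (auto simp: fvars_all_n)

lemma closed_RS12: "A \<in> RS12 \<Longrightarrow> fvars A = {}"
  by (auto simp: RS12_def closed_all_n)

lemma ex_bound_fvars: "\<exists>n. fvars A \<subseteq> {..<n}"
  using finite_nat_set_iff_bounded[of "fvars A"] finite_fvars by blast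

lemma models_RS12_iff:
  "models M RS12 \<longleftrightarrow> (\<forall>A e. (A \<in> basic_axioms \<or> (\<exists>B. sigma_b_1 B \<and> A = notation_induction B)) \<longrightarrow> sat M e A)"
proof -
  have "sat M e A" if "models M RS12"
    and A: "A \<in> basic_axioms \<or> (\<exists>B. sigma_b_1 B \<and> A = notation_induction B)" for A e
  proof -
    obtain n where n: "fvars A \<subseteq> {..<n}" using ex_bound_fvars by blast
    then have "all_n n A \<in> RS12" using A unfolding RS12_def by blast
    then have "\<forall>e. sat M e (all_n n A)" using \<open>models M RS12\<close> unfolding models_def by blast
    then show ?thesis using sat_all_n_closed[OF n, of M e] by simp
  qed
  moreover have "models M RS12"
    if "\<forall>A e. (A \<in> basic_axioms \<or> (\<exists>B. sigma_b_1 B \<and> A = notation_induction B)) \<longrightarrow> sat M e A"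
    unfolding models_def RS12_def
  proof safe
    fix e n A
    assume A: "A \<in> basic_axioms"
    show "sat M e (all_n n A)" unfolding sat_all_n using that A by blast
  next
    fix e n B
    assume B: "sigma_b_1 B"
    show "sat M e (all_n n (notation_induction B))" unfolding sat_all_n using that B by blast
  qed
  ultimately show ?thesis by blast
qed

section \<open>Provably distinct terms, and completeness for the bounded theory\<close>

definition zeros_tm :: "nat \<Rightarrow> tm" where "zeros_tm n = ((\<lambda>t. Cat t Zero) ^^ n) Eps"

lemma derives_all2:
  assumes "\<Gamma> \<turnstile> all_n 2 A"
  shows "\<Gamma> \<turnstile> fsubst (case_nat s (case_nat t Var)) A"
proof -
  have "\<Gamma> \<turnstile> inst t (All A)" using assms AllE[of \<Gamma> "All A" t] by (simp add: all_n_def numeral_2_eq_2)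
  then have "\<Gamma> \<turnstile> inst s (fsubst (under_binder (case_nat t Var)) A)"
    unfolding inst_def fsubst.simps using AllE[unfolded inst_def] by blast
  then show ?thesis by (simp add: inst_fsubst_under_binder)
qed

text \<open>This has to be derived in the calculus itself, being a premise of
  \<open>completeness\<close>. It rests on two axioms: appending \<open>Zero\<close> is injective
  and never yields the empty word.\<close>

lemma RS12_zeros_distinct: "i \<noteq> j \<Longrightarrow> RS12 \<turnstile> Neg (Eq (zeros_tm i) (zeros_tm j))"
proof -
  have A0: "RS12 \<turnstile> Neg (Eq (Cat s Zero) Eps)" for s
  proof -
    \<comment> \<open>\<open>RS12\<close> admits any sufficient number of quantifiers; two are taken
      to suit \<open>derives_all2\<close>.\<close>
    have "all_n 2 (Neg (Eq (Cat (Var 0) Zero) Eps)) \<in> RS12"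
      unfolding RS12_def basic_axioms_def Let_def by (rule CollectI, rule exI[of _ 2], rule exI) auto
    from derives_all2[OF Hyp[OF this], of s Eps] show ?thesis by simp
  qed
  have A1: "RS12 \<turnstile> Imp (Eq (Cat s Zero) (Cat t Zero)) (Eq s t)" for s t
  proof -
    have "all_n 2 (Imp (Eq (Cat (Var 0) Zero) (Cat (Var 1) Zero)) (Eq (Var 0) (Var 1))) \<in> RS12"
      unfolding RS12_def basic_axioms_def Let_def by (rule CollectI, rule exI[of _ 2], rule exI) auto
    from derives_all2[OF Hyp[OF this], of s t] show ?thesis by simp
  qed
  have sym: "\<Delta> \<turnstile> Eq t s" if "\<Delta> \<turnstile> Eq s t" for \<Delta> s t
    using EqSubst[OF that, of "Eq (Var 0) (tlift s)"] EqRefl[of \<Delta> s] by (simp add: inst_def tlift_def)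
  show "i \<noteq> j \<Longrightarrow> RS12 \<turnstile> Neg (Eq (zeros_tm i) (zeros_tm j))"
  proof (induction i arbitrary: j)
    case 0
    then obtain j' where j: "j = Suc j'" by (cases j) auto
    show ?case
    proof (rule NegI)
      let ?\<Delta> = "insert (Eq (zeros_tm 0) (zeros_tm j)) RS12"
      have "?\<Delta> \<turnstile> Eq (zeros_tm 0) (zeros_tm j)" by (rule Hyp) simp
      from sym[OF this] show "?\<Delta> \<turnstile> Eq (Cat (zeros_tm j') Zero) Eps" by (simp add: j zeros_tm_def)
      show "?\<Delta> \<turnstile> Neg (Eq (Cat (zeros_tm j') Zero) Eps)" by (rule weaken[OF A0]) blast
    qed
  next
    case (Suc i)
    show ?case
    proof (cases j)
      case 0
      then show ?thesis using A0[of "zeros_tm i"] by (simp add: zeros_tm_def)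
    next
      case (Suc j')
      let ?\<Delta> = "insert (Eq (zeros_tm (Suc i)) (zeros_tm j)) RS12"
      have "?\<Delta> \<turnstile> Eq (Cat (zeros_tm i) Zero) (Cat (zeros_tm j') Zero)"
        by (rule Hyp) (simp add: Suc zeros_tm_def)
      then have "?\<Delta> \<turnstile> Eq (zeros_tm i) (zeros_tm j')"
        using ImpE weaken[OF A1 subset_insertI] by blast
      moreover have "?\<Delta> \<turnstile> Neg (Eq (zeros_tm i) (zeros_tm j'))"
        by (rule weaken[OF Suc.IH subset_insertI]) (use Suc Suc.prems in simp)
      ultimately show ?thesis by (rule NegI)
    qed
  qed
qed

theorem RS12_completeness:
  assumes "fvars A \<subseteq> {..<n}" "\<And>M e. models M RS12 \<Longrightarrow> sat M e A"
  shows "RS12 \<turnstile> all_n n A"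
  by (rule completeness[where q = zeros_tm])
    (use assms in \<open>auto simp: closed_RS12 closed_all_n sat_all_n intro: RS12_zeros_distinct\<close>)

section \<open>String arithmetic in an arbitrary model\<close>

locale rs_model =
  fixes M :: interp
  assumes M: "models M RS12"
begin

abbreviation cat (infixl "\<cdot>" 70) where "x \<cdot> y \<equiv> Cat_of M x y"
abbreviation times (infixl "\<otimes>" 75) where "x \<otimes> y \<equiv> Times_of M x y"
abbreviation pref (infix "\<sqsubseteq>" 50) where "x \<sqsubseteq> y \<equiv> Prefix_of M x y"
abbreviation eps ("\<epsilon>") where "\<epsilon> \<equiv> Eps_of M"
abbreviation zero ("\<zero>") where "\<zero> \<equiv> Zero_of M"
abbreviation one ("\<one>") where "\<one> \<equiv> One_of M"

text \<open>The length as a word of ones: a model has no numbers of its own, so all counting is done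
  with such words.\<close>

definition len :: "str \<Rightarrow> str" where "len x = \<one> \<otimes> x"

definition le (infix "\<preceq>" 50) where "x \<preceq> y \<longleftrightarrow> len x \<sqsubseteq> len y"

definition sub (infix "\<unlhd>" 50) where "x \<unlhd> y \<longleftrightarrow> (\<exists>w. w \<sqsubseteq> y \<and> w \<cdot> x \<sqsubseteq> y)"

lemma sat_LenLe [simp]: "sat M e (LenLe s t) \<longleftrightarrow> tev M e s \<preceq> tev M e t"
  by (simp add: LenLe_def le_def len_def)

lemma sat_Subword [simp]: "sat M e (Subword s t) \<longleftrightarrow> tev M e s \<unlhd> tev M e t"
  by (simp add: Subword_def sub_def)

lemma sat_ExLenLe [simp]: "sat M e (ExLenLe t A) \<longleftrightarrow> (\<exists>a. a \<preceq> tev M e t \<and> sat M (case_nat a e) A)"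
  by (simp add: ExLenLe_def)

lemma sat_ExSubword [simp]: "sat M e (ExSubword t A) \<longleftrightarrow> (\<exists>a. a \<unlhd> tev M e t \<and> sat M (case_nat a e) A)"
  by (simp add: ExSubword_def)

lemma sat_AllSubword [simp]: "sat M e (AllSubword t A) \<longleftrightarrow> (\<forall>a. a \<unlhd> tev M e t \<longrightarrow> sat M (case_nat a e) A)"
  by (simp add: AllSubword_def)

lemma sat_basic: "A \<in> basic_axioms \<Longrightarrow> sat M e A"
  using M unfolding models_RS12_iff by blast

lemma basic:
  "x \<cdot> \<epsilon> = x" "x \<cdot> (y \<cdot> \<zero>) = (x \<cdot> y) \<cdot> \<zero>" "x \<cdot> (y \<cdot> \<one>) = (x \<cdot> y) \<cdot> \<one>"
  "x \<otimes> \<epsilon> = \<epsilon>" "x \<otimes> (y \<cdot> \<zero>) = (x \<otimes> y) \<cdot> x" "x \<otimes> (y \<cdot> \<one>) = (x \<otimes> y) \<cdot> x"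
  "x \<sqsubseteq> \<epsilon> \<longleftrightarrow> x = \<epsilon>" "x \<sqsubseteq> y \<cdot> \<zero> \<longleftrightarrow> x \<sqsubseteq> y \<or> x = y \<cdot> \<zero>" "x \<sqsubseteq> y \<cdot> \<one> \<longleftrightarrow> x \<sqsubseteq> y \<or> x = y \<cdot> \<one>"
  "x \<cdot> \<zero> = y \<cdot> \<zero> \<longleftrightarrow> x = y" "x \<cdot> \<one> = y \<cdot> \<one> \<longleftrightarrow> x = y"
  "x \<cdot> \<zero> \<noteq> y \<cdot> \<one>" "x \<cdot> \<zero> \<noteq> \<epsilon>" "x \<cdot> \<one> \<noteq> \<epsilon>"
proof -
  have all: "\<forall>A\<in>basic_axioms. sat M (case_nat x (\<lambda>_. y)) A"
    using sat_basic by blast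
  show "x \<cdot> \<epsilon> = x" "x \<cdot> (y \<cdot> \<zero>) = (x \<cdot> y) \<cdot> \<zero>" "x \<cdot> (y \<cdot> \<one>) = (x \<cdot> y) \<cdot> \<one>"
    "x \<otimes> \<epsilon> = \<epsilon>" "x \<otimes> (y \<cdot> \<zero>) = (x \<otimes> y) \<cdot> x" "x \<otimes> (y \<cdot> \<one>) = (x \<otimes> y) \<cdot> x"
    "x \<sqsubseteq> \<epsilon> \<longleftrightarrow> x = \<epsilon>" "x \<sqsubseteq> y \<cdot> \<zero> \<longleftrightarrow> x \<sqsubseteq> y \<or> x = y \<cdot> \<zero>" "x \<sqsubseteq> y \<cdot> \<one> \<longleftrightarrow> x \<sqsubseteq> y \<or> x = y \<cdot> \<one>"
    "x \<cdot> \<zero> = y \<cdot> \<zero> \<longleftrightarrow> x = y" "x \<cdot> \<one> = y \<cdot> \<one> \<longleftrightarrow> x = y"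
    "x \<cdot> \<zero> \<noteq> y \<cdot> \<one>" "x \<cdot> \<zero> \<noteq> \<epsilon>" "x \<cdot> \<one> \<noteq> \<epsilon>"
    using all unfolding basic_axioms_def Let_def Iff_def by - (simp; blast)+
qed

declare basic(1,4-14) [simp]

lemma basic_neq' [simp]: "y \<cdot> \<one> \<noteq> x \<cdot> \<zero>" "\<epsilon> \<noteq> x \<cdot> \<zero>" "\<epsilon> \<noteq> x \<cdot> \<one>"
  using basic(12)[of x y] basic(13)[of x] basic(14)[of x] by (metis)+

text \<open>Separates the HOL predicate \<open>P\<close> from the formula \<open>B\<close> that
  defines it with parameters \<open>e\<close>; each use has to exhibit such a formula. In the
  \<open>goal_cases\<close> proofs below, cases 1 and 2 say that \<open>B\<close> lies in the class
  and defines \<open>P\<close>, case 3 is the base, and cases 4 and 5 append a bit.\<close>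

lemma sigma_b_1_induction:
  assumes B: "sigma_b_1 B" and P: "\<And>x. P x \<longleftrightarrow> sat M (case_nat x e) B"
    and base: "P \<epsilon>" and step: "\<And>x. P x \<Longrightarrow> P (x \<cdot> \<zero>)" "\<And>x. P x \<Longrightarrow> P (x \<cdot> \<one>)"
  shows "P x"
proof -
  have ind: "sat M e (notation_induction B)" using M B unfolding models_RS12_iff by blast
  have env: "(\<lambda>n. tev M (case_nat a e) (case_nat (Cat (Var 0) b) (\<lambda>n. Var (Suc n)) n)) =
    case_nat (a \<cdot> tev M (case_nat a e) b) e" for a b
    by (auto simp: fun_eq_iff split: nat.split)
  show ?thesis
    using ind base step unfolding P notation_induction_def by (simp add: sat_inst env)
qed

lemmas sigma_b_0_induction = sigma_b_1_induction[OF sigma_b_1.intros(1)]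

lemma assoc: "x \<cdot> (y \<cdot> z) = x \<cdot> y \<cdot> z"
  by (rule sigma_b_0_induction[where P = "\<lambda>z. x \<cdot> (y \<cdot> z) = x \<cdot> y \<cdot> z"
        and B = "Eq (Cat (Var 1) (Cat (Var 2) (Var 0))) (Cat (Cat (Var 1) (Var 2)) (Var 0))"
        and e = "case_nat x (\<lambda>_. y)"])
    (auto intro: sigma_b_0.intros simp: basic(2,3))

lemma eps_cat [simp]: "\<epsilon> \<cdot> x = x"
  by (rule sigma_b_0_induction[where P = "\<lambda>x. \<epsilon> \<cdot> x = x" and B = "Eq (Cat Eps (Var 0)) (Var 0)"])
    (auto intro: sigma_b_0.intros simp: basic(2,3))

lemma unit_neq [simp]: "\<one> \<noteq> \<epsilon>" "\<zero> \<noteq> \<epsilon>" "\<epsilon> \<noteq> \<one>" "\<epsilon> \<noteq> \<zero>" "\<zero> \<noteq> \<one>" "\<one> \<noteq> \<zero>"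
  using basic(12)[of \<epsilon> \<epsilon>] basic(13)[of \<epsilon>] basic(14)[of \<epsilon>] by auto

lemma pref_refl [simp]: "x \<sqsubseteq> x"
  by (rule sigma_b_0_induction[where P = "\<lambda>x. x \<sqsubseteq> x" and B = "Prefix (Var 0) (Var 0)"])
    (auto intro: sigma_b_0.intros)

lemma pref_cat [simp]: "x \<sqsubseteq> x \<cdot> z"
  by (rule sigma_b_0_induction[where P = "\<lambda>z. x \<sqsubseteq> x \<cdot> z" and B = "Prefix (Var 1) (Cat (Var 1) (Var 0))"
        and e = "\<lambda>_. x"])
    (auto intro: sigma_b_0.intros simp: assoc)

lemma sub_cat [simp]: "z \<unlhd> x \<cdot> z"
  unfolding sub_def by (rule exI[of _ x]) simp

lemma pref_iff: "x \<sqsubseteq> y \<longleftrightarrow> (\<exists>z. y = x \<cdot> z)"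
proof -
  \<comment> \<open>The cofactor is sought among the subwords of \<open>y\<close>, since the
    induction admits no unbounded quantifier.\<close>
  have "x \<sqsubseteq> y \<longrightarrow> (\<exists>z. z \<unlhd> y \<and> y = x \<cdot> z)"
  proof (rule sigma_b_0_induction[where P = "\<lambda>y. x \<sqsubseteq> y \<longrightarrow> (\<exists>z. z \<unlhd> y \<and> y = x \<cdot> z)"
        and B = "Imp (Prefix (Var 1) (Var 0)) (ExSubword (Var 0) (Eq (Var 1) (Cat (Var 2) (Var 0))))"
        and e = "\<lambda>_. x"], goal_cases)
    case (4 y)
    show ?case
    proof
      assume "x \<sqsubseteq> y \<cdot> \<zero>"
      then consider z where "y = x \<cdot> z" | "x = y \<cdot> \<zero>" using 4 by auto
      then show "\<exists>z. z \<unlhd> y \<cdot> \<zero> \<and> y \<cdot> \<zero> = x \<cdot> z"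
        by cases (metis sub_cat assoc basic(1))+
    qed
  next
    case (5 y)
    show ?case
    proof
      assume "x \<sqsubseteq> y \<cdot> \<one>"
      then consider z where "y = x \<cdot> z" | "x = y \<cdot> \<one>" using 5 by auto
      then show "\<exists>z. z \<unlhd> y \<cdot> \<one> \<and> y \<cdot> \<one> = x \<cdot> z"
        by cases (metis sub_cat assoc basic(1))+
    qed
  qed (auto intro: sigma_b_0.intros simp: sub_def)
  then show ?thesis by auto
qed

lemma sub_iff: "x \<unlhd> y \<longleftrightarrow> (\<exists>p q. y = p \<cdot> x \<cdot> q)"
  unfolding sub_def by (metis assoc pref_cat pref_iff)

lemma pref_trans: "x \<sqsubseteq> y \<Longrightarrow> y \<sqsubseteq> z \<Longrightarrow> x \<sqsubseteq> z"
  by (metis assoc pref_iff)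

lemma sub_trans: "x \<unlhd> y \<Longrightarrow> y \<unlhd> z \<Longrightarrow> x \<unlhd> z"
  unfolding sub_iff by (metis assoc)

lemma pref_sub: "x \<sqsubseteq> y \<Longrightarrow> x \<unlhd> y"
  unfolding sub_iff pref_iff by (metis eps_cat)

lemma sub_refl [simp]: "x \<unlhd> x"
  by (simp add: pref_sub)

lemma eps_pref [simp]: "\<epsilon> \<sqsubseteq> x"
  by (metis eps_cat pref_iff)

text \<open>Elements of the carrier are lists only by accident, so even the distinction by the last
  bit needs induction in the model. The predecessor is bounded as a subword of
  \<open>x\<close>.\<close>

lemma str_cases [case_names eps zero one]:
  obtains "x = \<epsilon>" | y where "x = y \<cdot> \<zero>" | y where "x = y \<cdot> \<one>"
proof -
  have sub: "y \<unlhd> y \<cdot> b" for y b by (simp add: pref_sub)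
  have "x = \<epsilon> \<or> (\<exists>y. y \<unlhd> x \<and> (x = y \<cdot> \<zero> \<or> x = y \<cdot> \<one>))"
    by (rule sigma_b_0_induction[where P = "\<lambda>x. x = \<epsilon> \<or> (\<exists>y. y \<unlhd> x \<and> (x = y \<cdot> \<zero> \<or> x = y \<cdot> \<one>))"
          and B = "Disj (Eq (Var 0) Eps) (ExSubword (Var 0)
            (Disj (Eq (Var 1) (Cat (Var 0) Zero)) (Eq (Var 1) (Cat (Var 0) One))))"])
      (auto intro!: sigma_b_0.intros sub)
  then show ?thesis using that by blast
qed

lemma right_cancel: "x \<cdot> z = y \<cdot> z \<longleftrightarrow> x = y"
proof -
  have "x \<cdot> z = y \<cdot> z \<longrightarrow> x = y"
    by (rule sigma_b_0_induction[where P = "\<lambda>z. x \<cdot> z = y \<cdot> z \<longrightarrow> x = y"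
          and B = "Imp (Eq (Cat (Var 1) (Var 0)) (Cat (Var 2) (Var 0))) (Eq (Var 1) (Var 2))"
          and e = "case_nat x (\<lambda>_. y)"])
      (auto intro: sigma_b_0.intros simp: assoc)
  then show ?thesis by auto
qed

lemma times_cat: "x \<otimes> (y \<cdot> z) = (x \<otimes> y) \<cdot> (x \<otimes> z)"
  by (rule sigma_b_0_induction[where P = "\<lambda>z. x \<otimes> (y \<cdot> z) = (x \<otimes> y) \<cdot> (x \<otimes> z)"
        and B = "Eq (Times (Var 1) (Cat (Var 2) (Var 0))) (Cat (Times (Var 1) (Var 2)) (Times (Var 1) (Var 0)))"
        and e = "case_nat x (\<lambda>_. y)"])
    (auto intro: sigma_b_0.intros simp: assoc)

lemma times_unit [simp]: "x \<otimes> \<zero> = x" "x \<otimes> \<one> = x"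
  using basic(5)[of x \<epsilon>] basic(6)[of x \<epsilon>] by simp_all

section \<open>Lengths as words of ones, and cancellation\<close>

lemma len_simps [simp]:
  "len \<epsilon> = \<epsilon>" "len (x \<cdot> \<zero>) = len x \<cdot> \<one>" "len (x \<cdot> \<one>) = len x \<cdot> \<one>" "len \<zero> = \<one>" "len \<one> = \<one>"
  by (simp_all add: len_def)

lemma len_cat: "len (x \<cdot> y) = len x \<cdot> len y"
  by (simp add: len_def times_cat)

lemma cat_eq_eps [simp]: "x \<cdot> y = \<epsilon> \<longleftrightarrow> x = \<epsilon> \<and> y = \<epsilon>"
  by (cases y rule: str_cases) (auto simp: assoc)

lemma len_eq_eps [simp]: "len x = \<epsilon> \<longleftrightarrow> x = \<epsilon>"
  by (cases x rule: str_cases) auto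

lemma len_one_comm: "\<one> \<cdot> len x = len x \<cdot> \<one>"
  by (rule sigma_b_0_induction[where P = "\<lambda>x. \<one> \<cdot> len x = len x \<cdot> \<one>"
        and B = "Eq (Cat One (Times One (Var 0))) (Cat (Times One (Var 0)) One)"])
    (auto intro: sigma_b_0.intros simp: assoc len_def)

lemma len_comm: "len x \<cdot> len y = len y \<cdot> len x"
proof (rule sigma_b_0_induction[where P = "\<lambda>y. len x \<cdot> len y = len y \<cdot> len x"
        and B = "Eq (Cat (Times One (Var 1)) (Times One (Var 0))) (Cat (Times One (Var 0)) (Times One (Var 1)))"
        and e = "\<lambda>_. x"])
  fix y assume *: "len x \<cdot> len y = len y \<cdot> len x"
  have "len x \<cdot> (len y \<cdot> \<one>) = len y \<cdot> (len x \<cdot> \<one>)" by (simp add: assoc *)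
  also have "\<dots> = len y \<cdot> (\<one> \<cdot> len x)" by (simp add: len_one_comm)
  finally show "len x \<cdot> len (y \<cdot> \<zero>) = len (y \<cdot> \<zero>) \<cdot> len x" "len x \<cdot> len (y \<cdot> \<one>) = len (y \<cdot> \<one>) \<cdot> len x"
    by (simp_all add: assoc)
qed (auto intro: sigma_b_0.intros simp: len_def)

text \<open>Bits cannot be counted in a nonstandard model. Instead, words of ones commute, which
  moves the last one of \<open>len x\<close> to the end of the left side; cancelling it reduces the
  claim to a shorter \<open>x\<close>.\<close>

lemma no_cycle_len: "len x \<cdot> (len w \<cdot> \<one>) \<noteq> len x"
proof -
  have eq: "len x \<cdot> \<one> \<cdot> (len w \<cdot> \<one>) = len x \<cdot> (len w \<cdot> \<one>) \<cdot> \<one>" for x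
  proof -
    have "len x \<cdot> \<one> \<cdot> (len w \<cdot> \<one>) = len x \<cdot> (\<one> \<cdot> len w) \<cdot> \<one>" by (simp add: assoc)
    then show ?thesis by (simp add: len_one_comm)
  qed
  show ?thesis
    by (rule sigma_b_0_induction[where P = "\<lambda>x. len x \<cdot> (len w \<cdot> \<one>) \<noteq> len x"
        and B = "Neg (Eq (Cat (Times One (Var 0)) (Cat (Times One (Var 1)) One)) (Times One (Var 0)))"
        and e = "\<lambda>_. w"])
      (auto intro!: sigma_b_0.intros simp: eq, auto simp: len_def assoc)
qed

lemma cat_eq_self [simp]: "x \<cdot> y = x \<longleftrightarrow> y = \<epsilon>"
proof (cases y rule: str_cases)
  case (zero w)
  then show ?thesis using no_cycle_len[of x w] len_cat[of x y] by auto
next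
  case (one w)
  then show ?thesis using no_cycle_len[of x w] len_cat[of x y] by auto
qed auto

lemma self_eq_cat [simp]: "x = x \<cdot> y \<longleftrightarrow> y = \<epsilon>"
  using cat_eq_self[of x y] by metis

text \<open>Induction on \<open>y\<close> strips last bits from both sides, so the claim has to be
  made for all \<open>z\<close> at once. To stay within \<open>sigma_b_0\<close>, these range over
  the subwords of a fixed \<open>c\<close>, which removing a bit does not leave.\<close>

lemma left_cancel: "x \<cdot> y = x \<cdot> z \<longleftrightarrow> y = z"
proof -
  have sub: "z' \<unlhd> c" if "z' \<cdot> b \<unlhd> c" for z' b c
    using that sub_trans pref_sub pref_cat by blast
  define c where "c = z"
  have "\<forall>z. z \<unlhd> c \<longrightarrow> x \<cdot> y = x \<cdot> z \<longrightarrow> y = z"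
  proof (rule sigma_b_0_induction[where P = "\<lambda>y. \<forall>z. z \<unlhd> c \<longrightarrow> x \<cdot> y = x \<cdot> z \<longrightarrow> y = z"
        and B = "AllSubword (Var 1) (Imp (Eq (Cat (Var 3) (Var 1)) (Cat (Var 3) (Var 0))) (Eq (Var 1) (Var 0)))"
        and e = "case_nat c (\<lambda>_. x)"], goal_cases)
    case (3)
    then show ?case by (metis basic(1) cat_eq_self)
  next
    case (4 y)
    show ?case
    proof (intro allI impI)
      fix z assume z: "z \<unlhd> c" "x \<cdot> (y \<cdot> \<zero>) = x \<cdot> z"
      show "y \<cdot> \<zero> = z"
      proof (cases z rule: str_cases)
        case (zero z')
        then show ?thesis using z 4 sub by (auto simp: assoc)
      qed (use z cat_eq_self[of x "y \<cdot> \<zero>"] in \<open>auto simp: assoc\<close>)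
    qed
  next
    case (5 y)
    show ?case
    proof (intro allI impI)
      fix z assume z: "z \<unlhd> c" "x \<cdot> (y \<cdot> \<one>) = x \<cdot> z"
      show "y \<cdot> \<one> = z"
      proof (cases z rule: str_cases)
        case (one z')
        then show ?thesis using z 5 sub by (auto simp: assoc)
      qed (use z cat_eq_self[of x "y \<cdot> \<one>"] in \<open>auto simp: assoc\<close>)
    qed
  qed (auto intro: sigma_b_0.intros)
  then show ?thesis using c_def by auto
qed

lemma pref_linear: "x \<sqsubseteq> z \<Longrightarrow> y \<sqsubseteq> z \<Longrightarrow> x \<sqsubseteq> y \<or> y \<sqsubseteq> x"
proof -
  have "x \<sqsubseteq> z \<longrightarrow> y \<sqsubseteq> z \<longrightarrow> x \<sqsubseteq> y \<or> y \<sqsubseteq> x"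
    by (rule sigma_b_0_induction[where P = "\<lambda>z. x \<sqsubseteq> z \<longrightarrow> y \<sqsubseteq> z \<longrightarrow> x \<sqsubseteq> y \<or> y \<sqsubseteq> x"
          and B = "Imp (Prefix (Var 1) (Var 0)) (Imp (Prefix (Var 2) (Var 0)) (Disj (Prefix (Var 1) (Var 2)) (Prefix (Var 2) (Var 1))))"
          and e = "case_nat x (\<lambda>_. y)"])
      (auto intro: sigma_b_0.intros)
  then show "x \<sqsubseteq> z \<Longrightarrow> y \<sqsubseteq> z \<Longrightarrow> x \<sqsubseteq> y \<or> y \<sqsubseteq> x" by blast
qed

text \<open>The second factor only counts repetitions; this is why positions computed by products
  are insensitive to the bits of a prefix.\<close>

lemma times_len [simp]: "x \<otimes> len y = x \<otimes> y"
  by (rule sigma_b_0_induction[where P = "\<lambda>y. x \<otimes> len y = x \<otimes> y"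
        and B = "Eq (Times (Var 1) (Times One (Var 0))) (Times (Var 1) (Var 0))" and e = "\<lambda>_. x"])
    (auto intro: sigma_b_0.intros simp: len_def)

lemma len_len [simp]: "len (len x) = len x"
  unfolding len_def using times_len[of \<one> x] by (simp add: len_def)

lemma len_times: "len (x \<otimes> y) = len x \<otimes> y"
  by (rule sigma_b_0_induction[where P = "\<lambda>y. len (x \<otimes> y) = len x \<otimes> y"
        and B = "Eq (Times One (Times (Var 1) (Var 0))) (Times (Times One (Var 1)) (Var 0))" and e = "\<lambda>_. x"])
    (auto intro: sigma_b_0.intros simp: len_cat, auto simp: len_def)

lemma len_zeros [simp]: "len (\<zero> \<otimes> x) = len x"
  by (simp add: len_times) (simp add: len_def)

section \<open>Comparison of lengths, monotonicity of terms, truncation\<close>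

lemma le_iff: "x \<preceq> y \<longleftrightarrow> (\<exists>z. len y = len x \<cdot> len z)"
proof
  assume "x \<preceq> y"
  then obtain z where z: "len y = len x \<cdot> z" unfolding le_def pref_iff by blast
  then have "len (len y) = len (len x \<cdot> z)" by simp
  then have "len y = len x \<cdot> len z" by (simp add: len_cat)
  then show "\<exists>z. len y = len x \<cdot> len z" by blast
qed (auto simp: le_def)

lemma le_refl [simp]: "x \<preceq> x"
  by (simp add: le_def)

lemma le_trans: "x \<preceq> y \<Longrightarrow> y \<preceq> z \<Longrightarrow> x \<preceq> z"
  unfolding le_def using pref_trans by blast

lemma le_total: "x \<preceq> y \<or> y \<preceq> x"
  unfolding le_def by (metis pref_linear pref_cat len_comm)

lemma eps_le [simp]: "\<epsilon> \<preceq> x"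
  by (simp add: le_def)

lemma le_antisym: "x \<preceq> y \<Longrightarrow> y \<preceq> x \<Longrightarrow> len x = len y"
  unfolding le_def pref_iff by (metis assoc basic(1) cat_eq_eps cat_eq_self)

lemma le_cat: "x \<preceq> x' \<Longrightarrow> y \<preceq> y' \<Longrightarrow> x \<cdot> y \<preceq> x' \<cdot> y'"
proof -
  assume "x \<preceq> x'" "y \<preceq> y'"
  then obtain r s where rs: "len x' = len x \<cdot> len r" "len y' = len y \<cdot> len s" unfolding le_iff by blast
  have "len (x' \<cdot> y') = len x \<cdot> (len r \<cdot> len y) \<cdot> len s"
    by (simp add: len_cat rs assoc)
  also have "\<dots> = len (x \<cdot> y) \<cdot> len (r \<cdot> s)"
    by (simp add: len_comm[of r y]) (simp add: len_cat assoc)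
  finally show "x \<cdot> y \<preceq> x' \<cdot> y'" unfolding le_iff by blast
qed

lemma le_cat_left [simp]: "x \<preceq> x \<cdot> y"
  using le_cat[OF le_refl eps_le, of x y] by simp

lemma le_cat_right [simp]: "y \<preceq> x \<cdot> y"
  using le_cat[OF eps_le le_refl, of y x] by simp

lemma pref_le: "x \<sqsubseteq> y \<Longrightarrow> x \<preceq> y"
  by (auto simp: pref_iff)

lemma sub_le: "x \<unlhd> y \<Longrightarrow> x \<preceq> y"
  unfolding sub_iff using le_trans le_cat_left le_cat_right by blast

lemma times_pref: "x \<preceq> y \<Longrightarrow> z \<otimes> x \<sqsubseteq> z \<otimes> y"
proof -
  assume "x \<preceq> y"
  then obtain r where "len y = len x \<cdot> len r" unfolding le_iff by blast
  then have "z \<otimes> len y = (z \<otimes> len x) \<cdot> (z \<otimes> len r)" by (simp add: times_cat del: times_len)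
  then show ?thesis by simp
qed

lemma le_times_left: "x \<preceq> x' \<Longrightarrow> x \<otimes> y \<preceq> x' \<otimes> y"
proof (rule sigma_b_0_induction[where P = "\<lambda>y. x \<otimes> y \<preceq> x' \<otimes> y"
        and B = "LenLe (Times (Var 1) (Var 0)) (Times (Var 2) (Var 0))" and e = "case_nat x (\<lambda>_. x')"],
      goal_cases)
  case 1
  show ?case unfolding LenLe_def by (rule sigma_b_0.intros)
qed (auto intro: le_cat)

lemma le_times: "x \<preceq> x' \<Longrightarrow> y \<preceq> y' \<Longrightarrow> x \<otimes> y \<preceq> x' \<otimes> y'"
  using le_times_left times_pref pref_le le_trans by meson

text \<open>Bounding terms are composed by putting the bound of an intermediate value in its place,
  which is sound because terms are monotone in the lengths of their variables.\<close>

lemma tev_mono: "(\<And>i. e i \<preceq> e' i) \<Longrightarrow> tev M e t \<preceq> tev M e' t"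
  by (induction t) (auto intro: le_cat le_times)

lemma len_eq_le: "len x = len y \<Longrightarrow> x \<preceq> y"
  by (simp add: le_def)

lemma pref_of_le: "x \<sqsubseteq> z \<Longrightarrow> y \<sqsubseteq> z \<Longrightarrow> x \<preceq> y \<Longrightarrow> x \<sqsubseteq> y"
proof -
  assume "x \<sqsubseteq> z" "y \<sqsubseteq> z" "x \<preceq> y"
  then consider "x \<sqsubseteq> y" | "y \<sqsubseteq> x" using pref_linear by blast
  then show ?thesis
  proof cases
    case 2
    then obtain r where r: "x = y \<cdot> r" by (auto simp: pref_iff)
    then have "len x = len y" using \<open>x \<preceq> y\<close> le_antisym[of x y] by simp
    then show ?thesis using r by (simp add: len_cat)
  qed
qed

lemma pref_len_eq: "x \<sqsubseteq> z \<Longrightarrow> y \<sqsubseteq> z \<Longrightarrow> len x = len y \<Longrightarrow> x = y"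
  using pref_of_le[of x z y] len_cat by (auto simp: len_eq_le pref_iff)

text \<open>Truncation to the length of \<open>t\<close> as a quantifier-free relation; in the
  standard model it is \<open>take\<close>.\<close>

definition trunc :: "str \<Rightarrow> str \<Rightarrow> str \<Rightarrow> bool" where
  "trunc r t v \<longleftrightarrow> (r \<preceq> t \<and> v = r) \<or> (t \<preceq> r \<and> v \<sqsubseteq> r \<and> len v = len t)"

lemma trunc_unique: "trunc r t v \<Longrightarrow> trunc r t v' \<Longrightarrow> v = v'"
  unfolding trunc_def using pref_len_eq[of v r v'] pref_len_eq[of _ r r] le_antisym[of r t] by auto

lemma trunc_le: "trunc r t v \<Longrightarrow> v \<preceq> t"
  unfolding trunc_def by (auto simp: len_eq_le)

text \<open>Induction on \<open>r\<close>: while \<open>r\<close> is no longer than \<open>t\<close>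
  there is nothing to find; when the next bit would exceed \<open>t\<close>, the word reached so far
  has exactly the length of \<open>t\<close>; afterwards the same prefix serves.\<close>

lemma trunc_exists: "\<exists>v. trunc r t v"
proof (cases "r \<preceq> t")
  case True
  then show ?thesis unfolding trunc_def by blast
next
  case False
  have step: "len r \<cdot> \<one> \<sqsubseteq> len t" if le: "r \<preceq> t" and ne: "len r \<noteq> len t" for r
  proof -
    obtain z where z: "len t = len r \<cdot> len z" using le unfolding le_iff by blast
    have "len r \<cdot> (len y \<cdot> \<one>) = len r \<cdot> \<one> \<cdot> len y" for y
      using assoc len_one_comm by metis
    then show ?thesis using ne z by (cases z rule: str_cases) auto
  qed
  have "r \<preceq> t \<or> (\<exists>v. v \<unlhd> r \<and> v \<sqsubseteq> r \<and> len v = len t)"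
  proof (rule sigma_b_0_induction[where P = "\<lambda>r. r \<preceq> t \<or> (\<exists>v. v \<unlhd> r \<and> v \<sqsubseteq> r \<and> len v = len t)"
        and B = "Disj (LenLe (Var 0) (Var 1)) (ExSubword (Var 0) (Conj (Prefix (Var 0) (Var 1))
          (Eq (Times One (Var 0)) (Times One (Var 2)))))" and e = "\<lambda>_. t"], goal_cases)
    case (4 r)
    then show ?case using step[of r] pref_sub pref_refl le_def len_simps basic(8) by metis
  next
    case (5 r)
    then show ?case using step[of r] pref_sub pref_refl le_def len_simps basic(9) by metis
  qed (auto intro!: sigma_b_0.intros simp: LenLe_def, auto simp: le_def len_def)
  then show ?thesis using False le_total unfolding trunc_def by blast
qed

text \<open>The last \<open>\<one>\<close> marks the end of \<open>v\<close>, so the padding can be stripped.\<close>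

lemma padded_eq:
  assumes "v \<cdot> \<one> \<cdot> (\<zero> \<otimes> q) = v' \<cdot> \<one> \<cdot> (\<zero> \<otimes> q')"
  shows "v = v'"
proof -
  have *: "v = v'" if le: "q \<preceq> q'" and eq: "v \<cdot> \<one> \<cdot> (\<zero> \<otimes> q) = v' \<cdot> \<one> \<cdot> (\<zero> \<otimes> q')" for v v' q q'
  proof -
    obtain s where "len q' = len q \<cdot> len s" using le unfolding le_iff by blast
    then have "\<zero> \<otimes> len q' = (\<zero> \<otimes> len s) \<cdot> (\<zero> \<otimes> len q)"
      by (simp add: len_comm[of q s] times_cat del: times_len)
    then have "v \<cdot> \<one> = v' \<cdot> \<one> \<cdot> (\<zero> \<otimes> s)"
      using eq by (simp add: assoc right_cancel)
    \<comment> \<open>For nonempty \<open>s\<close> the right side would end in zero, whereas the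
      left side ends in one.\<close>
    then show ?thesis by (cases s rule: str_cases) (auto simp: assoc)
  qed
  show ?thesis using *[of q q' v v'] *[of q' q v' v] assms le_total by metis
qed

end

subsection \<open>The standard model\<close>

definition std :: "bit_oracle \<Rightarrow> interp" where
  "std \<eta> = \<lparr>Cat_of = (@), Times_of = str_times, Eps_of = [], Zero_of = [False], One_of = [True],
    Prefix_of = prefix, Flip_of = \<eta>\<rparr>"

lemma std_simps [simp]:
  "Cat_of (std \<eta>) = (@)" "Times_of (std \<eta>) = str_times" "Eps_of (std \<eta>) = []"
  "Zero_of (std \<eta>) = [False]" "One_of (std \<eta>) = [True]" "Prefix_of (std \<eta>) = prefix" "Flip_of (std \<eta>) = \<eta>"
  by (simp_all add: std_def)

lemma tev_std [simp]: "tev (std \<eta>) e t = tval e t"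
  by (induction t) auto

lemma sat_std: "sat (std \<eta>) e A \<longleftrightarrow> \<eta> \<in> oracles_of e A"
  by (induction A arbitrary: e) auto

lemma str_times_snoc [simp]: "str_times x (y @ [b]) = str_times x y @ x"
  by (simp add: str_times_def flip: replicate_append_same)

lemma str_times_Nil [simp]: "str_times x [] = []"
  by (simp add: str_times_def)

text \<open>Here the list structure of the carrier is the intended one, so induction on notation
  holds for every formula, bounded or not.\<close>

lemma models_std: "models (std \<eta>) RS12"
  unfolding models_RS12_iff
proof (intro allI impI)
  fix A e
  assume "A \<in> basic_axioms \<or> (\<exists>B. sigma_b_1 B \<and> A = notation_induction B)"
  then consider "A \<in> basic_axioms" | B where "A = notation_induction B" by blast
  then show "sat (std \<eta>) e A"
  proof cases
    case 1
    then show ?thesis unfolding basic_axioms_def Let_def Iff_def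
      by (elim insertE emptyE) auto
  next
    case 2
    have env: "(\<lambda>n. tval (case_nat a e) (case_nat (Cat (Var 0) b) (\<lambda>n. Var (Suc n)) n)) =
      case_nat (a @ tval (case_nat a e) b) e" for a b
      by (auto simp: fun_eq_iff split: nat.split)
    show ?thesis unfolding 2 notation_induction_def sat.simps
    proof (intro impI allI, elim conjE)
      fix x
      assume base: "sat (std \<eta>) e (inst Eps B)"
        and step: "\<forall>a. sat (std \<eta>) (case_nat a e) B \<longrightarrow>
          sat (std \<eta>) (case_nat a e) (fsubst (case_nat (Cat (Var 0) Zero) (\<lambda>n. Var (Suc n))) B) \<and>
          sat (std \<eta>) (case_nat a e) (fsubst (case_nat (Cat (Var 0) One) (\<lambda>n. Var (Suc n))) B)"
      show "sat (std \<eta>) (case_nat x e) B"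
      proof (induction x rule: rev_induct)
        case Nil
        then show ?case using base by (simp add: sat_inst)
      next
        case (snoc b x)
        have "sat (std \<eta>) (case_nat (x @ [True]) e) B \<and> sat (std \<eta>) (case_nat (x @ [False]) e) B"
          using step[rule_format, OF snoc.IH] by (simp add: env)
        then show ?case
          by (cases b) (simp_all only:)
      qed
    qed
  qed
qed

interpretation std: rs_model "std \<eta>" for \<eta>
  by unfold_locales (rule models_std)

lemma std_len: "std.len \<eta> x = replicate (length x) True"
  by (induction x rule: rev_induct) (auto simp: std.len_def replicate_append_same)

lemma std_le [simp]: "std.le \<eta> x y \<longleftrightarrow> length x \<le> length y"
proof
  assume "std.le \<eta> x y"
  then have "prefix (replicate (length x) True) (replicate (length y) True)"
    by (simp add: std.le_def std_len)
  from prefix_length_le[OF this] show "length x \<le> length y" by simp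
next
  assume "length x \<le> length y"
  then have "replicate (length y) True = replicate (length x) True @ replicate (length y - length x) True"
    by (simp flip: replicate_add)
  then show "std.le \<eta> x y" by (simp add: std.le_def std_len)
qed

lemma std_trunc: "std.trunc \<eta> r t v \<Longrightarrow> v = take (length t) r"
  unfolding std.trunc_def std_le std_len std_simps by (elim disjE conjE) (auto elim!: prefixE)

subsection \<open>Substitution and bounded formulas\<close>

lemma fsubst_Subword: "fsubst \<theta> (Subword s t) = Subword (tsubst \<theta> s) (tsubst \<theta> t)"
  by (simp add: Subword_def tsubst_under_binder_tlift)

lemma sigma_b_0_fsubst: "sigma_b_0 A \<Longrightarrow> sigma_b_0 (fsubst \<theta> A)"
proof (induction arbitrary: \<theta> rule: sigma_b_0.induct)
  case (8 A t)
  have "fsubst \<theta> (ExSubword t A) = ExSubword (tsubst \<theta> t) (fsubst (under_binder \<theta>) A)"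
    by (simp add: ExSubword_def fsubst_Subword tsubst_under_binder_tlift)
  then show ?case using 8 by (simp add: sigma_b_0.intros)
next
  case (9 A t)
  have "fsubst \<theta> (AllSubword t A) = AllSubword (tsubst \<theta> t) (fsubst (under_binder \<theta>) A)"
    by (simp add: AllSubword_def fsubst_Subword tsubst_under_binder_tlift)
  then show ?case using 9 by (simp add: sigma_b_0.intros)
qed (simp_all add: sigma_b_0.intros)

lemma tev_case_nat [simp]:
  "(\<lambda>n. tev M e (case_nat t \<theta> n)) = case_nat (tev M e t) (\<lambda>n. tev M e (\<theta> n))"
  by (auto simp: fun_eq_iff split: nat.split)

lemma tval_case_nat [simp]:
  "(\<lambda>n. tval e (case_nat t \<theta> n)) = case_nat (tval e t) (\<lambda>n. tval e (\<theta> n))"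
  by (auto simp: fun_eq_iff split: nat.split)

subsection \<open>Provably total graphs\<close>

text \<open>The graph of \<open>F\<close> is \<open>\<exists>w. D\<close>, where \<open>D\<close> has the value at index \<open>0\<close>, the witness \<open>w\<close> at
  index \<open>1\<close> and the arguments from index \<open>2\<close> on. The arguments form an environment, which makes
  composition a substitution.\<close>

definition graph :: "((nat \<Rightarrow> str) \<Rightarrow> bit_oracle \<Rightarrow> str) \<Rightarrow> fm \<Rightarrow> tm \<Rightarrow> bool" where
  "graph F D t \<longleftrightarrow> sigma_b_0 D \<and>
    (\<forall>M e. models M RS12 \<longrightarrow> (\<exists>z w. rs_model.le M z (tev M e t) \<and> rs_model.le M w (tev M e t) \<and>
      sat M (case_nat z (case_nat w e)) D)) \<and>
    (\<forall>M e z z' w w'. models M RS12 \<longrightarrow> sat M (case_nat z (case_nat w e)) D \<longrightarrow>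
      sat M (case_nat z' (case_nat w' e)) D \<longrightarrow> z = z') \<and>
    (\<forall>\<eta> e z w. sat (std \<eta>) (case_nat z (case_nat w e)) D \<longrightarrow> z = F e \<eta>)"

definition total :: "((nat \<Rightarrow> str) \<Rightarrow> bit_oracle \<Rightarrow> str) \<Rightarrow> bool" where
  "total F \<longleftrightarrow> (\<exists>D t. graph F D t)"

lemma graphI:
  assumes "sigma_b_0 D"
    and "\<And>M e. rs_model M \<Longrightarrow> \<exists>z w. rs_model.le M z (tev M e t) \<and> rs_model.le M w (tev M e t) \<and>
      sat M (case_nat z (case_nat w e)) D"
    and "\<And>M e z z' w w'. rs_model M \<Longrightarrow> sat M (case_nat z (case_nat w e)) D \<Longrightarrow>
      sat M (case_nat z' (case_nat w' e)) D \<Longrightarrow> z = z'"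
    and "\<And>\<eta> e z w. sat (std \<eta>) (case_nat z (case_nat w e)) D \<Longrightarrow> z = F e \<eta>"
  shows "graph F D t"
  unfolding graph_def
proof (intro conjI allI impI)
  show "sigma_b_0 D" by (rule assms(1))
next
  fix M e assume "models M RS12"
  then have "rs_model M" by (rule rs_model.intro)
  then show "\<exists>z w. rs_model.le M z (tev M e t) \<and> rs_model.le M w (tev M e t) \<and>
      sat M (case_nat z (case_nat w e)) D" by (rule assms(2))
next
  fix M e z z' w w'
  assume "models M RS12" and *: "sat M (case_nat z (case_nat w e)) D" "sat M (case_nat z' (case_nat w' e)) D"
  then have "rs_model M" by (intro rs_model.intro)
  from assms(3)[OF this *] show "z = z'" .
next
  fix \<eta> e z w assume "sat (std \<eta>) (case_nat z (case_nat w e)) D"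
  then show "z = F e \<eta>" by (rule assms(4))
qed

lemma graph_sigma: "graph F D t \<Longrightarrow> sigma_b_0 D"
  unfolding graph_def by (elim conjE)

lemma graph_std:
  assumes "graph F D t" "sat (std \<eta>) (case_nat z (case_nat w e)) D"
  shows "z = F e \<eta>"
proof -
  have "\<forall>\<eta> e z w. sat (std \<eta>) (case_nat z (case_nat w e)) D \<longrightarrow> z = F e \<eta>"
    using assms(1) unfolding graph_def by (elim conjE)
  from this[rule_format, OF assms(2)] show ?thesis .
qed

context rs_model
begin

lemma graph_exists:
  assumes "graph F D t"
  obtains z w where "z \<preceq> tev M e t" "w \<preceq> tev M e t" "sat M (case_nat z (case_nat w e)) D"
proof -
  have "\<forall>M e. models M RS12 \<longrightarrow> (\<exists>z w. rs_model.le M z (tev M e t) \<and> rs_model.le M w (tev M e t) \<and>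
      sat M (case_nat z (case_nat w e)) D)"
    using assms unfolding graph_def by (elim conjE)
  from this[rule_format, OF M, of e] show ?thesis using that by (elim exE conjE)
qed

lemma graph_unique:
  assumes "graph F D t" "sat M (case_nat z (case_nat w e)) D" "sat M (case_nat z' (case_nat w' e)) D"
  shows "z = z'"
proof -
  have "\<forall>M e z z' w w'. models M RS12 \<longrightarrow> sat M (case_nat z (case_nat w e)) D \<longrightarrow>
      sat M (case_nat z' (case_nat w' e)) D \<longrightarrow> z = z'"
    using assms(1) unfolding graph_def by (elim conjE)
  from this[rule_format, OF M assms(2,3)] show ?thesis .
qed

end

text \<open>Covers the empty function, the projections and the word-successors at once.\<close>

lemma total_term: "total (\<lambda>e \<eta>. tval e s)"
proof -
  have "graph (\<lambda>e \<eta>. tval e s) (Eq (Var 0) (tsubst (\<lambda>n. Var (n + 2)) s)) s"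
  proof (rule graphI)
    fix M and e :: "nat \<Rightarrow> str" assume "rs_model M"
    then interpret rs_model M .
    show "\<exists>z w. le z (tev M e s) \<and> le w (tev M e s) \<and>
      sat M (case_nat z (case_nat w e)) (Eq (Var 0) (tsubst (\<lambda>n. Var (n + 2)) s))"
      by (rule exI[of _ "tev M e s"], rule exI[of _ "tev M e s"]) simp
  qed (auto intro: sigma_b_0.intros)
  then show ?thesis unfolding total_def by blast
qed

lemma total_query: "total (\<lambda>e \<eta>. [\<eta> (e 0)])"
proof -
  let ?D = "Disj (Conj (Flip (Var 2)) (Eq (Var 0) One)) (Conj (Neg (Flip (Var 2))) (Eq (Var 0) Zero))"
  have "graph (\<lambda>e \<eta>. [\<eta> (e 0)]) ?D One"
  proof (rule graphI)
    fix M and e :: "nat \<Rightarrow> str" assume "rs_model M"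
    then interpret rs_model M .
    show "\<exists>z w. le z (tev M e One) \<and> le w (tev M e One) \<and> sat M (case_nat z (case_nat w e)) ?D"
      by (rule exI[of _ "if Flip_of M (e 0) then One_of M else Zero_of M"], rule exI[of _ "Eps_of M"]) (simp add: le_def)
  qed (auto intro!: sigma_b_0.intros)
  then show ?thesis unfolding total_def by blast
qed

lemma total_cond:
  "total (\<lambda>e \<eta>. if e 0 = [] then e 1 else if last (e 0) then e 3 else e 2)"
proof -
  \<comment> \<open>Under the binder, index 0 is the tested word without its last bit, 1 the value,
    3 the tested word, and 5 and 6 are the branches for zero and one.\<close>
  let ?D = "Disj (Conj (Eq (Var 2) Eps) (Eq (Var 0) (Var 3))) (ExSubword (Var 2)
    (Disj (Conj (Eq (Var 3) (Cat (Var 0) Zero)) (Eq (Var 1) (Var 5)))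
      (Conj (Eq (Var 3) (Cat (Var 0) One)) (Eq (Var 1) (Var 6)))))"
  let ?t = "Cat (Var 1) (Cat (Var 2) (Var 3))"
  have "graph (\<lambda>e \<eta>. if e 0 = [] then e 1 else if last (e 0) then e 3 else e 2) ?D ?t"
  proof (rule graphI)
    fix M and e :: "nat \<Rightarrow> str" assume "rs_model M"
    then interpret rs_model M .
    have b: "le (e 1) ((cat (e 1) (cat (e 2) (e 3))))" "le (e 2) ((cat (e 1) (cat (e 2) (e 3))))" "le (e 3) ((cat (e 1) (cat (e 2) (e 3))))"
      using le_cat_left le_cat_right le_trans by meson+
    have sub: "sub x (cat x b)" for x b by (simp add: pref_sub)
    show "\<exists>z w. le z (tev M e ?t) \<and> le w (tev M e ?t) \<and> sat M (case_nat z (case_nat w e)) ?D"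
    proof (cases "e 0" rule: str_cases)
      case eps
      then show ?thesis using b by - (rule exI[of _ "e 1"], rule exI[of _ "Eps_of M"], simp)
    next
      case (zero x)
      then show ?thesis using b sub by - (rule exI[of _ "e 2"], rule exI[of _ "Eps_of M"], auto)
    next
      case (one x)
      then show ?thesis using b sub by - (rule exI[of _ "e 3"], rule exI[of _ "Eps_of M"], auto)
    qed
  next
    fix M z z' w w' and e :: "nat \<Rightarrow> str" assume "rs_model M"
    then interpret rs_model M .
    assume "sat M (case_nat z (case_nat w e)) ?D" "sat M (case_nat z' (case_nat w' e)) ?D"
    then show "z = z'" by (cases "e 0" rule: str_cases) auto
  next
    fix \<eta> e z w assume "sat (std \<eta>) (case_nat z (case_nat w e)) ?D"
    then show "z = (if e 0 = [] then e 1 else if last (e 0) then e 3 else e 2)" by auto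
  qed (auto intro!: sigma_b_0.intros)
  then show ?thesis unfolding total_def by blast
qed

lemma total_subst:
  assumes "total F"
  shows "total (\<lambda>e \<eta>. F (\<lambda>i. tval e (\<theta> i)) \<eta>)"
proof -
  obtain D t where D: "graph F D t" using assms unfolding total_def by blast
  let ?D = "fsubst (case_nat (Var 0) (case_nat (Var 1) (\<lambda>i. tsubst (\<lambda>n. Var (n + 2)) (\<theta> i)))) D"
  have eq: "sat M (case_nat z (case_nat w e)) ?D \<longleftrightarrow> sat M (case_nat z (case_nat w (\<lambda>i. tev M e (\<theta> i)))) D"
    for M z w e by simp
  have "graph (\<lambda>e \<eta>. F (\<lambda>i. tval e (\<theta> i)) \<eta>) ?D (tsubst \<theta> t)"
  proof (rule graphI)
    show "sigma_b_0 ?D" by (rule sigma_b_0_fsubst[OF graph_sigma[OF D]])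
  next
    fix M and e :: "nat \<Rightarrow> str" assume "rs_model M"
    then interpret rs_model M .
    show "\<exists>z w. le z (tev M e (tsubst \<theta> t)) \<and> le w (tev M e (tsubst \<theta> t)) \<and> sat M (case_nat z (case_nat w e)) ?D"
      unfolding eq tev_tsubst by (rule graph_exists[OF D, of "\<lambda>i. tev M e (\<theta> i)"]) blast
  next
    fix M z z' w w' and e :: "nat \<Rightarrow> str" assume "rs_model M"
    then interpret rs_model M .
    assume "sat M (case_nat z (case_nat w e)) ?D" "sat M (case_nat z' (case_nat w' e)) ?D"
    then show "z = z'" unfolding eq by (rule graph_unique[OF D])
  next
    fix \<eta> e z w assume "sat (std \<eta>) (case_nat z (case_nat w e)) ?D"
    then show "z = F (\<lambda>i. tval e (\<theta> i)) \<eta>" unfolding eq using graph_std[OF D] by simp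
  qed
  then show ?thesis unfolding total_def by blast
qed

lemma total_rename: "total F \<Longrightarrow> total (\<lambda>e \<eta>. F (\<lambda>i. e (r i)) \<eta>)"
  using total_subst[of F "\<lambda>i. Var (r i)"] by simp

text \<open>The witness contains the intermediate value \<open>y\<close>, its witness
  \<open>v\<close> and the outer witness \<open>u\<close> somewhere as subwords. As
  \<open>DH\<close> determines \<open>y\<close> whatever \<open>v\<close> is, other choices of
  subwords cannot spoil uniqueness.\<close>

lemma total_comp:
  assumes "total G" "total H"
  shows "total (\<lambda>e \<eta>. G (case_nat (H e \<eta>) e) \<eta>)"
proof -
  obtain DG tG where G: "graph G DG tG" using assms unfolding total_def by blast
  obtain DH tH where H: "graph H DH tH" using assms unfolding total_def by blast
  \<comment> \<open>Inside the three binders, indices 0 to 4 are \<open>u, v, y, z, w\<close>; the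
    arguments start at 5.\<close>
  let ?D = "ExSubword (Var 1) (ExSubword (Var 2) (ExSubword (Var 3) (Conj
    (fsubst (case_nat (Var 2) (case_nat (Var 1) (\<lambda>i. Var (Suc (Suc (Suc (Suc (Suc i)))))))) DH)
    (fsubst (case_nat (Var 3) (case_nat (Var 0) (case_nat (Var 2) (\<lambda>i. Var (Suc (Suc (Suc (Suc (Suc i))))))))) DG))))"
  let ?tG = "tsubst (case_nat tH Var) tG"
  let ?t = "Cat (Cat tH tH) ?tG"
  have "graph (\<lambda>e \<eta>. G (case_nat (H e \<eta>) e) \<eta>) ?D ?t"
  proof (rule graphI)
    show "sigma_b_0 ?D"
      by (intro sigma_b_0.intros sigma_b_0_fsubst graph_sigma[OF G] graph_sigma[OF H])
  next
    fix M and e :: "nat \<Rightarrow> str" assume "rs_model M"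
    then interpret rs_model M .
    obtain y v where y: "le (y) (tev M e tH)" "le (v) (tev M e tH)" "sat M (case_nat y (case_nat v e)) DH"
      by (rule graph_exists[OF H])
    obtain z u where z: "le (z) (tev M (case_nat y e) tG)" "le (u) (tev M (case_nat y e) tG)"
      "sat M (case_nat z (case_nat u (case_nat y e))) DG"
      by (rule graph_exists[OF G])
    \<comment> \<open>The outer bound mentions \<open>y\<close>, which is replaced by its own bound
      \<open>tH\<close>.\<close>
    have mono: "le (tev M (case_nat y e) tG) (tev M e ?tG)"
      unfolding tev_tsubst tev_case_nat by (rule tev_mono) (use y in \<open>simp split: nat.split\<close>)
    have w: "le ((cat (cat y v) u)) (tev M e ?t)"
      unfolding tev.simps by (intro le_cat y le_trans[OF z(2) mono])
    have sub: "sub y ((cat (cat y v) u))" "sub v ((cat (cat y v) u))" "sub u ((cat (cat y v) u))"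
      unfolding sub_iff by (metis assoc eps_cat basic(1))+
    have "le (z) (tev M e ?t)"
      unfolding tev.simps by (rule le_trans[OF z(1) le_trans[OF mono le_cat_right]])
    moreover have "sat M (case_nat z (case_nat (cat (cat y v) u) e)) ?D"
      unfolding sat_ExSubword
      by (rule exI[of _ y], rule conjI, simp add: sub, rule exI[of _ v], rule conjI, simp add: sub,
          rule exI[of _ u], simp add: y(3) z(3))
    ultimately show "\<exists>z w. le z (tev M e ?t) \<and> le w (tev M e ?t) \<and> sat M (case_nat z (case_nat w e)) ?D"
      using w by blast
  next
    fix M z z' w w' and e :: "nat \<Rightarrow> str" assume "rs_model M"
    then interpret rs_model M .
    assume "sat M (case_nat z (case_nat w e)) ?D" "sat M (case_nat z' (case_nat w' e)) ?D"
    then obtain y v u y' v' u' where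
      "sat M (case_nat y (case_nat v e)) DH" "sat M (case_nat z (case_nat u (case_nat y e))) DG"
      "sat M (case_nat y' (case_nat v' e)) DH" "sat M (case_nat z' (case_nat u' (case_nat y' e))) DG"
      by auto
    then show "z = z'" using graph_unique[OF H] graph_unique[OF G] by metis
  next
    fix \<eta> e z w assume "sat (std \<eta>) (case_nat z (case_nat w e)) ?D"
    then obtain y v u where
      "sat (std \<eta>) (case_nat y (case_nat v e)) DH" "sat (std \<eta>) (case_nat z (case_nat u (case_nat y e))) DG"
      by auto
    then show "z = G (case_nat (H e \<eta>) e) \<eta>" using graph_std[OF G] graph_std[OF H] by metis
  qed
  then show ?thesis unfolding total_def by blast
qed

section \<open>Composition with a list of functions\<close>

definition prepend :: "str list \<Rightarrow> (nat \<Rightarrow> str) \<Rightarrow> nat \<Rightarrow> str" where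
  "prepend ys e = foldr case_nat ys e"

lemma prepend_nth: "i < length ys \<Longrightarrow> prepend ys e i = ys ! i"
  by (induction ys arbitrary: i) (auto simp: prepend_def nth_Cons split: nat.split)

lemma prepend_add: "prepend ys e (i + length ys) = e i"
  by (induction ys) (auto simp: prepend_def)

lemma map_prepend: "map (prepend ys e) [0..<length ys] = ys"
  by (rule nth_equalityI) (simp_all add: prepend_nth)

text \<open>One substitution at a time. Computed values are put in front of the arguments rather
  than in their place, so each inner function still finds its arguments, shifted by the number of
  values already there.\<close>

lemma total_comp_list:
  assumes "total G" "\<And>H. H \<in> set Hs \<Longrightarrow> total H"
  shows "total (\<lambda>e \<eta>. G (prepend (map (\<lambda>H. H e \<eta>) Hs) e) \<eta>)"
  using assms
proof (induction Hs arbitrary: G)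
  case Nil
  then show ?case by (simp add: prepend_def)
next
  case (Cons H Hs)
  let ?H = "\<lambda>e. H (\<lambda>i. e (i + length Hs))"
  have "total (\<lambda>e \<eta>. G (case_nat (?H e \<eta>) e) \<eta>)"
    by (rule total_comp[OF Cons.prems(1) total_rename[OF Cons.prems(2)]]) simp
  from Cons.IH[OF this Cons.prems(2)]
  have "total (\<lambda>e \<eta>. (\<lambda>e \<eta>. G (case_nat (?H e \<eta>) e) \<eta>) (prepend (map (\<lambda>H. H e \<eta>) Hs) e) \<eta>)"
    by simp
  moreover have "?H (prepend (map (\<lambda>H. H e \<eta>) Hs) e) \<eta> = H e \<eta>" for e \<eta>
    using prepend_add[of "map (\<lambda>H. H e \<eta>) Hs" e] by simp
  ultimately show ?case by (simp add: prepend_def)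
qed

subsection \<open>Coded sequences\<close>

text \<open>\<open>V\<close> codes a sequence indexed by prefixes: the block of length \<open>|T|\<close> at position
  \<open>|T||u|\<close> is \<open>v\<one>\<zero>\<dots>\<zero>\<close>, where \<open>v\<close> is the entry for \<open>u\<close>.\<close>

definition Entry :: "tm \<Rightarrow> tm \<Rightarrow> tm \<Rightarrow> tm \<Rightarrow> fm" where
  "Entry T V u v = ExSubword V (ExSubword (tlift V) (Conj (Eq (Var 0) (Times Zero (Var 0)))
    (Conj (Prefix (Cat (Cat (Cat (Var 1) (tlift (tlift v))) One) (Var 0)) (tlift (tlift V)))
    (Conj (Eq (Times One (Var 1)) (Times One (Times (tlift (tlift T)) (tlift (tlift u)))))
      (Eq (Times One (Cat (Cat (tlift (tlift v)) One) (Var 0))) (Times One (tlift (tlift T))))))))"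

definition Trunc :: "tm \<Rightarrow> tm \<Rightarrow> tm \<Rightarrow> fm" where
  "Trunc r t v = Disj (Conj (LenLe r t) (Eq v r))
    (Conj (LenLe t r) (Conj (Prefix v r) (Eq (Times One v) (Times One t))))"

lemma sigma_Entry: "sigma_b_0 (Entry T V u v)"
  unfolding Entry_def by (intro sigma_b_0.intros)

lemma sigma_LenLe: "sigma_b_0 (LenLe s t)"
  unfolding LenLe_def by (intro sigma_b_0.intros)

lemma sigma_Trunc: "sigma_b_0 (Trunc r t v)"
  unfolding Trunc_def by (intro sigma_b_0.intros sigma_LenLe)

lemmas sigma_b_0_intros = sigma_b_0.intros sigma_b_0_fsubst sigma_Entry sigma_LenLe sigma_Trunc

context rs_model
begin

text \<open>The equation \<open>r = \<zero> \<otimes> r\<close> says, without a further quantifier,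
  that the padding consists of zeros. The quantifiers are unbounded here; \<open>sat_Entry\<close>
  shows that subwords of \<open>V\<close> suffice.\<close>

definition entry :: "str \<Rightarrow> str \<Rightarrow> str \<Rightarrow> str \<Rightarrow> bool" where
  "entry T V u v \<longleftrightarrow> (\<exists>p r. r = \<zero> \<otimes> r \<and> p \<cdot> v \<cdot> \<one> \<cdot> r \<sqsubseteq> V \<and> len p = len (T \<otimes> u) \<and> len (v \<cdot> \<one> \<cdot> r) = len T)"

lemma sat_Entry [simp]: "sat M e (Entry T V u v) \<longleftrightarrow> entry (tev M e T) (tev M e V) (tev M e u) (tev M e v)"
proof -
  have eq: "(\<exists>p. p \<unlhd> V \<and> (\<exists>r. r \<unlhd> V \<and> r = \<zero> \<otimes> r \<and> p \<cdot> v \<cdot> \<one> \<cdot> r \<sqsubseteq> V \<and>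
      len p = len (T \<otimes> u) \<and> len (v \<cdot> \<one> \<cdot> r) = len T)) \<longleftrightarrow> entry T V u v" for T V u v
  proof
    assume "entry T V u v"
    then obtain p r where pr: "r = \<zero> \<otimes> r" "p \<cdot> v \<cdot> \<one> \<cdot> r \<sqsubseteq> V" "len p = len (T \<otimes> u)"
      "len (v \<cdot> \<one> \<cdot> r) = len T" unfolding entry_def by (elim exE conjE)
    then obtain s where s: "V = p \<cdot> v \<cdot> \<one> \<cdot> r \<cdot> s" unfolding pref_iff by (elim exE)
    have "r \<unlhd> V" unfolding sub_iff s by (intro exI) (rule refl)
    moreover have "p \<unlhd> V"
      unfolding sub_iff s by (rule exI[of _ \<epsilon>], rule exI[of _ "v \<cdot> \<one> \<cdot> r \<cdot> s"]) (simp add: assoc)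
    ultimately show "\<exists>p. p \<unlhd> V \<and> (\<exists>r. r \<unlhd> V \<and> r = \<zero> \<otimes> r \<and> p \<cdot> v \<cdot> \<one> \<cdot> r \<sqsubseteq> V \<and>
      len p = len (T \<otimes> u) \<and> len (v \<cdot> \<one> \<cdot> r) = len T)"
      using pr by (intro exI[of _ p] conjI exI[of _ r])
  qed (unfold entry_def, elim exE conjE, intro exI conjI)
  show ?thesis unfolding Entry_def eq[symmetric] by (simp add: len_def)
qed

lemma sat_Trunc [simp]: "sat M e (Trunc r t v) \<longleftrightarrow> trunc (tev M e r) (tev M e t) (tev M e v)"
  by (auto simp: Trunc_def trunc_def len_def)

lemma entry_sub: "entry T V u v \<Longrightarrow> v \<unlhd> V"
  unfolding entry_def sub_iff pref_iff by (metis assoc)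

lemma entry_le: "entry T V u v \<Longrightarrow> v \<preceq> T"
proof -
  assume "entry T V u v"
  then obtain r where "len (v \<cdot> \<one> \<cdot> r) = len T" unfolding entry_def by blast
  then have "v \<cdot> (\<one> \<cdot> r) \<preceq> T" by (simp add: len_eq_le assoc)
  then show ?thesis using le_trans le_cat_left by blast
qed

lemma entry_mono: "entry T V u v \<Longrightarrow> V \<sqsubseteq> V' \<Longrightarrow> entry T V' u v"
  unfolding entry_def using pref_trans by blast

text \<open>A code filled exactly up to position \<open>|T||u|\<close> can take the block for
  \<open>u\<close>: the length of \<open>p\<close> fixes the place of a block,
  \<open>padded_eq\<close> recovers its entry, and blocks for shorter \<open>u'\<close> end before
  the new one begins. The margin in \<open>v \<cdot> \<one> \<preceq> T\<close> is room for the end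
  marker.\<close>

lemma entry_append:
  assumes V: "len V = len (T \<otimes> u)" and v: "v \<cdot> \<one> \<preceq> T"
  obtains B where "len (V \<cdot> B) = len (T \<otimes> (u \<cdot> \<one>))" "entry T (V \<cdot> B) u v"
    "\<And>v'. entry T (V \<cdot> B) u v' \<Longrightarrow> v' = v"
    "\<And>u' v'. u' \<cdot> \<one> \<preceq> u \<Longrightarrow> entry T (V \<cdot> B) u' v' \<Longrightarrow> entry T V u' v'"
proof -
  obtain s where s: "len T = len (v \<cdot> \<one>) \<cdot> len s" using v unfolding le_iff by blast
  define r where "r = \<zero> \<otimes> s"
  define B where "B = v \<cdot> \<one> \<cdot> r"
  \<comment> \<open>The product depends only on the length of its second factor, which
    \<open>\<zero> \<otimes> s\<close> shares with \<open>s\<close>.\<close>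
  have r: "r = \<zero> \<otimes> r"
    using times_len[of \<zero> "\<zero> \<otimes> s"] times_len[of \<zero> s] by (simp add: r_def del: times_len)
  have len_B: "len B = len T" unfolding B_def s len_cat[of "v \<cdot> \<one>"] by (simp add: r_def)
  have 1: "len (V \<cdot> B) = len (T \<otimes> (u \<cdot> \<one>))" by (simp add: len_cat len_B V)
  have "V \<cdot> v \<cdot> \<one> \<cdot> r \<sqsubseteq> V \<cdot> B" by (simp add: B_def assoc)
  then have 2: "entry T (V \<cdot> B) u v"
    unfolding entry_def by (intro exI[of _ V] exI[of _ r] conjI) (rule r V len_B[unfolded B_def] | assumption)+
  have 3: "v' = v" if new: "entry T (V \<cdot> B) u v'" for v'
  proof -
    obtain p' r' where p': "r' = \<zero> \<otimes> r'" "p' \<cdot> v' \<cdot> \<one> \<cdot> r' \<sqsubseteq> V \<cdot> B"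
      "len p' = len (T \<otimes> u)" "len (v' \<cdot> \<one> \<cdot> r') = len T"
      using new unfolding entry_def by (elim exE conjE)
    have "p' \<sqsubseteq> p' \<cdot> (v' \<cdot> \<one> \<cdot> r')" by (rule pref_cat)
    then have "p' \<sqsubseteq> V \<cdot> B" using p'(2) pref_trans by (simp add: assoc)
    then have "p' = V" using pref_len_eq[of p' "V \<cdot> B" V] p'(3) V by simp
    then have "V \<cdot> (v' \<cdot> \<one> \<cdot> r') \<sqsubseteq> V \<cdot> B" using p'(2) by (simp add: assoc)
    moreover have "len (V \<cdot> (v' \<cdot> \<one> \<cdot> r')) = len (V \<cdot> B)"
      unfolding len_cat[of V] p'(4) len_B ..
    ultimately have "V \<cdot> (v' \<cdot> \<one> \<cdot> r') = V \<cdot> B" by (rule pref_len_eq[OF _ pref_refl])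
    then have "v' \<cdot> \<one> \<cdot> r' = v \<cdot> \<one> \<cdot> r" by (simp add: left_cancel B_def)
    then have "v' \<cdot> \<one> \<cdot> (\<zero> \<otimes> r') = v \<cdot> \<one> \<cdot> (\<zero> \<otimes> r)"
      unfolding p'(1)[symmetric] r[symmetric] .
    then show ?thesis by (rule padded_eq)
  qed
  have 4: "entry T V u' v'" if le: "u' \<cdot> \<one> \<preceq> u" and en: "entry T (V \<cdot> B) u' v'" for u' v'
  proof -
    obtain p' r' where p': "r' = \<zero> \<otimes> r'" "p' \<cdot> v' \<cdot> \<one> \<cdot> r' \<sqsubseteq> V \<cdot> B"
      "len p' = len (T \<otimes> u')" "len (v' \<cdot> \<one> \<cdot> r') = len T"
      using en unfolding entry_def by (elim exE conjE)
    \<comment> \<open>The block for \<open>u'\<close> ends at \<open>|T|(|u'| + 1)\<close>, which is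
      at most \<open>|T||u|\<close>, the length of \<open>V\<close>.\<close>
    have "len (p' \<cdot> (v' \<cdot> \<one> \<cdot> r')) = len (T \<otimes> (u' \<cdot> \<one>))"
      unfolding len_cat[of p'] p'(3,4) by (simp add: len_cat)
    then have "p' \<cdot> (v' \<cdot> \<one> \<cdot> r') \<preceq> T \<otimes> (u' \<cdot> \<one>)" by (rule len_eq_le)
    moreover have "T \<otimes> (u' \<cdot> \<one>) \<preceq> T \<otimes> u" by (rule le_times[OF le_refl le])
    moreover have "T \<otimes> u \<preceq> V" by (rule len_eq_le) (simp add: V)
    ultimately have "p' \<cdot> (v' \<cdot> \<one> \<cdot> r') \<preceq> V" by (blast intro: le_trans)
    then have "p' \<cdot> v' \<cdot> \<one> \<cdot> r' \<preceq> V" by (simp only: assoc)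
    then have "p' \<cdot> v' \<cdot> \<one> \<cdot> r' \<sqsubseteq> V" by (rule pref_of_le[OF p'(2) pref_cat])
    then show ?thesis
      unfolding entry_def by (intro exI[of _ p'] exI[of _ r'] conjI) (rule p' | assumption)+
  qed
  show thesis by (rule that[OF 1 2 3 4])
qed

end

subsection \<open>Bounded recursion\<close>

locale recursion =
  fixes G H0 H1 :: "(nat \<Rightarrow> str) \<Rightarrow> bit_oracle \<Rightarrow> str"
    and DG D0 D1 :: fm and tG t0 t1 t :: tm
  assumes G: "graph G DG tG" and H0: "graph H0 D0 t0" and H1: "graph H1 D1 t1"
begin

text \<open>The block length, with \<open>y\<close> at index 0 and the parameters after it. An entry
  is a base value, bounded by \<open>tG\<close>, or a truncated step value, bounded by
  \<open>t\<close>; the sum covers both, and \<open>One\<close> leaves room for the end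
  marker.\<close>

definition block_tm :: tm where
  "block_tm = Cat (Cat (tsubst (\<lambda>i. Var (Suc i)) tG) t) One"

text \<open>A step function takes the previous value, the prefix and the parameters. Replacing the
  previous value by the block length and the prefix by \<open>y\<close> gives a bound in
  \<open>y\<close> and the parameters alone.\<close>

definition step_tm :: "tm \<Rightarrow> tm" where
  "step_tm s = tsubst (case_nat block_tm (case_nat (Var 0) (\<lambda>i. Var (Suc i)))) s"

text \<open>What a single prefix can add to \<open>W\<close>: the witness of the base function, or,
  for either bit, the value before truncation together with its witness; hence the doubled
  terms.\<close>

definition record_tm :: tm where
  "record_tm = Cat (tsubst (\<lambda>i. Var (Suc i)) tG) (Cat (Cat (step_tm t0) (step_tm t0)) (Cat (step_tm t1) (step_tm t1)))"

definition block_at :: "nat \<Rightarrow> tm" where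
  "block_at n = tsubst (\<lambda>i. Var (i + n)) block_tm"

text \<open>Index layout: in \<open>Step\<close> and \<open>Justified\<close> the indices from \<open>0\<close> on are \<open>v, u, V, W, y\<close> and the
  parameters; in \<open>Good\<close> they are \<open>x, V, W, y\<close> and in \<open>Trace\<close> they are \<open>z, w, y\<close>, again followed by the
  parameters. Every entry of \<open>V\<close> has to be justified by an earlier one, rather than each entry
  determining the next: then uniqueness and soundness do not depend on unique decoding of \<open>V\<close>. The
  witnesses for the step functions occur as subwords of \<open>W\<close>, at unspecified positions.\<close>

definition Step :: "tm \<Rightarrow> fm \<Rightarrow> fm" where
  "Step b D = ExSubword (Var 1) (Conj (Eq (Var 2) (Cat (Var 0) b))
    (ExSubword (Var 3) (Conj (Entry (block_at 6) (Var 4) (Var 1) (Var 0))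
      (ExSubword (Var 5) (ExSubword (Var 6) (Conj
        (fsubst (case_nat (Var 1) (case_nat (Var 0) (case_nat (Var 2) (case_nat (Var 3) (\<lambda>i. Var (i + 9)))))) D)
        (Trunc (Var 1) (tsubst (case_nat (Var 3) (\<lambda>i. Var (i + 9))) t) (Var 4))))))))"

definition Justified :: fm where
  "Justified = Disj
    (Conj (Eq (Var 1) Eps) (ExSubword (Var 3) (fsubst (case_nat (Var 1) (case_nat (Var 0) (\<lambda>i. Var (i + 6)))) DG)))
    (Disj (Step Zero D0) (Step One D1))"

definition Good :: fm where
  "Good = AllSubword (Var 0) (Imp (Prefix (Var 0) (Var 1))
    (AllSubword (Var 2) (Imp (Entry (block_at 5) (Var 3) (Var 1) (Var 0))
      (fsubst (case_nat (Var 0) (case_nat (Var 1) (\<lambda>i. Var (i + 3)))) Justified))))"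

definition Trace :: fm where
  "Trace = ExSubword (Var 1) (ExSubword (Var 2) (Conj (Entry (block_at 4) (Var 0) (Var 4) (Var 2))
    (fsubst (case_nat (Var 4) (case_nat (Var 0) (case_nat (Var 1) (\<lambda>i. Var (i + 4))))) Good)))"

text \<open>There are \<open>|y| + 1\<close> prefixes of \<open>y\<close>, the empty one included,
  hence the factor \<open>Cat (Var 0) One\<close>: it counts blocks of \<open>V\<close> in one
  product and additions to \<open>W\<close> in the other.\<close>

definition trace_tm :: tm where
  "trace_tm = Cat (Times block_tm (Cat (Var 0) One)) (Times record_tm (Cat (Var 0) One))"

lemma sigma_Step: "sigma_b_0 D \<Longrightarrow> sigma_b_0 (Step b D)"
  unfolding Step_def by (intro sigma_b_0_intros)

lemma sigma_Justified: "sigma_b_0 Justified"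
  unfolding Justified_def
  by (intro sigma_b_0_intros sigma_Step graph_sigma[OF G] graph_sigma[OF H0] graph_sigma[OF H1])

lemma sigma_Good: "sigma_b_0 Good"
  unfolding Good_def by (intro sigma_b_0_intros sigma_Justified)

lemma sigma_Trace: "sigma_b_0 Trace"
  unfolding Trace_def by (intro sigma_b_0_intros sigma_Good)

end

section \<open>Meaning of the trace formulas in a model\<close>

locale recursion_model = rs_model + recursion +
  fixes e :: "nat \<Rightarrow> str" and y :: str
begin

text \<open>Evaluated at the full argument \<open>y\<close> for every prefix, so that all blocks
  have equal length.\<close>

definition T where "T = tev M (case_nat y e) block_tm"

definition S where "S = tev M (case_nat y e) record_tm"

definition step where
  "step c D V W u v \<longleftrightarrow> (\<exists>u0. u0 \<unlhd> u \<and> u = u0 \<cdot> c \<and> (\<exists>v0. v0 \<unlhd> V \<and> entry T V u0 v0 \<and>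
    (\<exists>r. r \<unlhd> W \<and> (\<exists>w. w \<unlhd> W \<and> sat M (case_nat r (case_nat w (case_nat v0 (case_nat u0 e)))) D \<and>
      trunc r (tev M (case_nat u0 e) t) v))))"

definition justified where
  "justified V W u v \<longleftrightarrow> (u = \<epsilon> \<and> (\<exists>w. w \<unlhd> W \<and> sat M (case_nat v (case_nat w e)) DG)) \<or>
    step \<zero> D0 V W u v \<or> step \<one> D1 V W u v"

definition good where
  "good x V W \<longleftrightarrow> (\<forall>u. u \<sqsubseteq> x \<longrightarrow> (\<forall>v. entry T V u v \<longrightarrow> justified V W u v))"

lemma tev_block_at:
  "(\<And>i. e' (i + n) = case_nat y e i) \<Longrightarrow> tev M e' (block_at n) = T"
  by (simp add: block_at_def T_def)

lemma sat_Step: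
  assumes e': "e' = case_nat v (case_nat u (case_nat V (case_nat W (case_nat y e))))"
    and b: "\<And>e'. tev M e' b = c"
  shows "sat M e' (Step b D) \<longleftrightarrow> step c D V W u v"
proof -
  have blk: "tev M (case_nat v0 (case_nat u0 e')) (block_at 6) = T" for v0 u0
    by (rule tev_block_at) (simp add: e' numeral_eq_Suc)
  show ?thesis
    unfolding Step_def step_def
    by (simp add: b blk) (simp add: e' numeral_eq_Suc)
qed

lemma sat_Justified:
  "sat M (case_nat v (case_nat u (case_nat V (case_nat W (case_nat y e))))) Justified \<longleftrightarrow> justified V W u v"
  unfolding Justified_def justified_def
  by (simp add: sat_Step[OF refl, of Zero \<zero>] sat_Step[OF refl, of One \<one>]) (simp add: numeral_eq_Suc)

lemma sat_Good:
  "sat M (case_nat x (case_nat V (case_nat W (case_nat y e)))) Good \<longleftrightarrow> good x V W"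
proof -
  let ?e = "case_nat x (case_nat V (case_nat W (case_nat y e)))"
  have blk: "tev M (case_nat v (case_nat u ?e)) (block_at 5) = T" for u v
    by (rule tev_block_at) (simp add: numeral_eq_Suc)
  have shift: "(\<lambda>i. case_nat v (case_nat u ?e) (i + 3)) = case_nat V (case_nat W (case_nat y e))" for u v
    by (rule ext) (simp add: numeral_eq_Suc)
  have "sat M ?e Good \<longleftrightarrow> (\<forall>u. u \<unlhd> x \<longrightarrow> u \<sqsubseteq> x \<longrightarrow> (\<forall>v. v \<unlhd> V \<longrightarrow> entry T V u v \<longrightarrow> justified V W u v))"
    unfolding Good_def by (simp add: blk shift sat_Justified)
  \<comment> \<open>Entries of \<open>V\<close> are subwords of \<open>V\<close> and prefixes of
    \<open>x\<close> are subwords of \<open>x\<close>, so the bounds may be dropped.\<close>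
  then show ?thesis unfolding good_def using entry_sub pref_sub by blast
qed

lemma sat_Trace:
  "sat M (case_nat z (case_nat w (case_nat y e))) Trace \<longleftrightarrow>
    (\<exists>W. W \<unlhd> w \<and> (\<exists>V. V \<unlhd> w \<and> entry T V y z \<and> good y V W))"
proof -
  let ?e = "case_nat z (case_nat w (case_nat y e))"
  have blk: "tev M (case_nat V (case_nat W ?e)) (block_at 4) = T" for W V
    by (rule tev_block_at) (simp add: numeral_eq_Suc)
  have shift: "(\<lambda>i. case_nat V (case_nat W ?e) (i + 4)) = case_nat y e" for V W
    by (rule ext) (simp add: numeral_eq_Suc)
  show ?thesis unfolding Trace_def by (simp add: blk shift) (simp add: numeral_eq_Suc sat_Good)
qed

end

section \<open>Uniqueness and existence of traces\<close>

context recursion_model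
begin

lemma justified_eps: "justified V W \<epsilon> v \<Longrightarrow> \<exists>w. w \<unlhd> W \<and> sat M (case_nat v (case_nat w e)) DG"
  unfolding justified_def step_def by auto

lemma justified_zero: "justified V W (u \<cdot> \<zero>) v \<Longrightarrow>
  \<exists>v0 r w. entry T V u v0 \<and> sat M (case_nat r (case_nat w (case_nat v0 (case_nat u e)))) D0 \<and>
    trunc r (tev M (case_nat u e) t) v"
  unfolding justified_def step_def by auto

lemma justified_one: "justified V W (u \<cdot> \<one>) v \<Longrightarrow>
  \<exists>v0 r w. entry T V u v0 \<and> sat M (case_nat r (case_nat w (case_nat v0 (case_nat u e)))) D1 \<and>
    trunc r (tev M (case_nat u e) t) v"
  unfolding justified_def step_def by auto

text \<open>The last bit of a prefix selects the clause that justifies its entry; the earlier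
  entries agree by induction, and step function and truncation are single-valued. The words
  \<open>W\<close> and \<open>W'\<close> may differ.\<close>

lemma trace_unique:
  assumes good: "good y V W" "good y V' W'"
    and u: "u \<sqsubseteq> y" and v: "entry T V u v" "entry T V' u v'"
  shows "v = v'"
proof -
  \<comment> \<open>Entries are subwords of their codes, which keeps both universal quantifiers
    within \<open>sigma_b_0\<close>.\<close>
  have "u \<sqsubseteq> y \<longrightarrow> (\<forall>v. v \<unlhd> V \<longrightarrow> (\<forall>v'. v' \<unlhd> V' \<longrightarrow> entry T V u v \<longrightarrow> entry T V' u v' \<longrightarrow> v = v'))"
  proof (rule sigma_b_0_induction[where P = "\<lambda>u. u \<sqsubseteq> y \<longrightarrow>
        (\<forall>v. v \<unlhd> V \<longrightarrow> (\<forall>v'. v' \<unlhd> V' \<longrightarrow> entry T V u v \<longrightarrow> entry T V' u v' \<longrightarrow> v = v'))"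
      and B = "Imp (Prefix (Var 0) (Var 3)) (AllSubword (Var 1) (AllSubword (Var 3)
        (Imp (Entry (block_at 5) (Var 3) (Var 2) (Var 1))
          (Imp (Entry (block_at 5) (Var 4) (Var 2) (Var 0)) (Eq (Var 1) (Var 0))))))"
      and e = "case_nat V (case_nat V' (case_nat y e))"], goal_cases)
    case 1
    show ?case by (intro sigma_b_0_intros)
  next
    case (2 u)
    have "tev M (case_nat v' (case_nat v (case_nat u (case_nat V (case_nat V' (case_nat y e)))))) (block_at 5) = T"
      for v v' by (rule tev_block_at) (simp add: numeral_eq_Suc)
    then show ?case by simp
  next
    case 3
    show ?case
    proof (intro impI allI)
      fix v v' assume "entry T V \<epsilon> v" "entry T V' \<epsilon> v'"
      then have "justified V W \<epsilon> v" "justified V' W' \<epsilon> v'" using good unfolding good_def by simp_all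
      from justified_eps[OF this(1)] justified_eps[OF this(2)] show "v = v'"
        using graph_unique[OF G] by (elim exE conjE)
    qed
  next
    case (4 u)
    show ?case
    proof (intro impI allI)
      fix v v' assume u: "u \<cdot> \<zero> \<sqsubseteq> y" and en: "entry T V (u \<cdot> \<zero>) v" "entry T V' (u \<cdot> \<zero>) v'"
      have "justified V W (u \<cdot> \<zero>) v" "justified V' W' (u \<cdot> \<zero>) v'"
        using good u en unfolding good_def by simp_all
      from justified_zero[OF this(1)] justified_zero[OF this(2)]
      obtain v0 r w v0' r' w' where 1: "entry T V u v0" "entry T V' u v0'"
        "sat M (case_nat r (case_nat w (case_nat v0 (case_nat u e)))) D0"
        "sat M (case_nat r' (case_nat w' (case_nat v0' (case_nat u e)))) D0"
        "trunc r (tev M (case_nat u e) t) v" "trunc r' (tev M (case_nat u e) t) v'"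
        by (elim exE conjE) (rule that)
      have "u \<sqsubseteq> y" using u pref_cat pref_trans by blast
      then have "v0 = v0'" using 4 1(1,2) entry_sub by blast
      then have "r = r'" using graph_unique[OF H0] 1(3,4) by blast
      then show "v = v'" using 1(5,6) trunc_unique by blast
    qed
  next
    case (5 u)
    show ?case
    proof (intro impI allI)
      fix v v' assume u: "u \<cdot> \<one> \<sqsubseteq> y" and en: "entry T V (u \<cdot> \<one>) v" "entry T V' (u \<cdot> \<one>) v'"
      have "justified V W (u \<cdot> \<one>) v" "justified V' W' (u \<cdot> \<one>) v'"
        using good u en unfolding good_def by simp_all
      from justified_one[OF this(1)] justified_one[OF this(2)]
      obtain v0 r w v0' r' w' where 1: "entry T V u v0" "entry T V' u v0'"
        "sat M (case_nat r (case_nat w (case_nat v0 (case_nat u e)))) D1"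
        "sat M (case_nat r' (case_nat w' (case_nat v0' (case_nat u e)))) D1"
        "trunc r (tev M (case_nat u e) t) v" "trunc r' (tev M (case_nat u e) t) v'"
        by (elim exE conjE) (rule that)
      have "u \<sqsubseteq> y" using u pref_cat pref_trans by blast
      then have "v0 = v0'" using 5 1(1,2) entry_sub by blast
      then have "r = r'" using graph_unique[OF H1] 1(3,4) by blast
      then show "v = v'" using 1(5,6) trunc_unique by blast
    qed
  qed
  then show ?thesis using u v entry_sub by blast
qed

text \<open>The claim carried through the existence proof. A code without entries would be
  \<open>good\<close> as well, so an entry for \<open>x\<close> is demanded; the exact length tells
  where the next block goes.\<close>

definition traced where
  "traced x V W \<longleftrightarrow> len V = len (T \<otimes> (x \<cdot> \<one>)) \<and> W \<preceq> S \<otimes> (x \<cdot> \<one>) \<and> good x V W \<and> (\<exists>v. entry T V x v)"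

lemma step_mono: "step c D V W u v \<Longrightarrow> V \<sqsubseteq> V' \<Longrightarrow> W \<unlhd> W' \<Longrightarrow> step c D V' W' u v"
proof -
  assume *: "V \<sqsubseteq> V'" "W \<unlhd> W'"
  assume "step c D V W u v"
  then obtain u0 v0 r w where "u0 \<unlhd> u" "u = u0 \<cdot> c" "v0 \<unlhd> V" "entry T V u0 v0" "r \<unlhd> W" "w \<unlhd> W"
    "sat M (case_nat r (case_nat w (case_nat v0 (case_nat u0 e)))) D" "trunc r (tev M (case_nat u0 e) t) v"
    unfolding step_def by (elim exE conjE)
  moreover from this have "v0 \<unlhd> V'" "entry T V' u0 v0" "r \<unlhd> W'" "w \<unlhd> W'"
    using * entry_mono entry_sub sub_trans by blast+
  ultimately show ?thesis
    unfolding step_def by (intro exI[of _ u0] conjI exI[of _ v0] exI[of _ r] exI[of _ w])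
qed

lemma justified_mono: "justified V W u v \<Longrightarrow> V \<sqsubseteq> V' \<Longrightarrow> W \<unlhd> W' \<Longrightarrow> justified V' W' u v"
  unfolding justified_def using step_mono sub_trans by meson

lemma tev_prefix_mono: "u \<preceq> y \<Longrightarrow> tev M (case_nat u e) s \<preceq> tev M (case_nat y e) s"
  by (rule tev_mono) (simp split: nat.split)

lemma T_eq: "T = tev M e tG \<cdot> tev M (case_nat y e) t \<cdot> \<one>"
  by (simp add: T_def block_tm_def)

lemma traced_eps: "\<exists>V W. traced \<epsilon> V W"
proof -
  obtain z w where z: "z \<preceq> tev M e tG" "w \<preceq> tev M e tG" "sat M (case_nat z (case_nat w e)) DG"
    by (rule graph_exists[OF G])
  have "z \<cdot> \<one> \<preceq> T"
    unfolding T_eq by (rule le_cat[OF le_trans[OF z(1) le_cat_left] le_refl])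
  moreover have "len \<epsilon> = len (T \<otimes> \<epsilon>)" by simp
  ultimately obtain B where B: "len (\<epsilon> \<cdot> B) = len (T \<otimes> (\<epsilon> \<cdot> \<one>))" "entry T (\<epsilon> \<cdot> B) \<epsilon> z"
    "\<And>v'. entry T (\<epsilon> \<cdot> B) \<epsilon> v' \<Longrightarrow> v' = z"
    using entry_append[of \<epsilon> T \<epsilon> z] by metis
  have "w \<preceq> S"
    unfolding S_def record_tm_def by (simp add: le_trans[OF z(2) le_cat_left])
  moreover have "good \<epsilon> B w"
    unfolding good_def justified_def using B(3) z(3) by auto
  ultimately have "traced \<epsilon> B w" unfolding traced_def using B(1,2) by auto
  then show ?thesis by blast
qed

text \<open>Stated for a bit \<open>c\<close>, so that zero and one share a proof; the second
  assumption on \<open>c\<close> is the prefix axiom for that bit. The new block holds the truncated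
  step value, and \<open>r\<close> and \<open>w\<close> are appended to \<open>W\<close>.\<close>

lemma traced_step:
  assumes tr: "traced x V W" and xc: "x \<cdot> c \<sqsubseteq> y"
    and c: "len c = \<one>" "\<And>u. u \<sqsubseteq> x \<cdot> c \<longleftrightarrow> u \<sqsubseteq> x \<or> u = x \<cdot> c"
    and H: "graph H D tH"
    and just: "\<And>V W u v. step c D V W u v \<Longrightarrow> justified V W u v"
    and bound: "tev M (case_nat y e) (step_tm tH) \<cdot> tev M (case_nat y e) (step_tm tH) \<preceq> S"
  shows "\<exists>V W. traced (x \<cdot> c) V W"
proof -
  obtain v where V: "len V = len (T \<otimes> (x \<cdot> \<one>))" and W: "W \<preceq> S \<otimes> (x \<cdot> \<one>)" and good: "good x V W"
    and v: "entry T V x v"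
    using tr unfolding traced_def by (elim exE conjE)
  have times_c: "s \<otimes> (x \<cdot> c) = s \<otimes> (x \<cdot> \<one>)" for s
  proof -
    have "s \<otimes> len (x \<cdot> c) = s \<otimes> len (x \<cdot> \<one>)" by (simp only: len_cat c(1) len_simps)
    then show ?thesis by (simp only: times_len)
  qed
  obtain r w where r: "r \<preceq> tev M (case_nat v (case_nat x e)) tH" "w \<preceq> tev M (case_nat v (case_nat x e)) tH"
    "sat M (case_nat r (case_nat w (case_nat v (case_nat x e)))) D"
    by (rule graph_exists[OF H])
  have x: "x \<preceq> y" using xc pref_trans[OF pref_cat] pref_le by blast
  \<comment> \<open>As an entry, \<open>v\<close> is no longer than \<open>T\<close>, which
    \<open>step_tm\<close> puts in its place.\<close>
  have tH: "tev M (case_nat v (case_nat x e)) tH \<preceq> tev M (case_nat y e) (step_tm tH)"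
    unfolding step_tm_def tev_tsubst tev_case_nat
    by (rule tev_mono) (use x entry_le[OF v] in \<open>simp add: T_def split: nat.split\<close>)
  obtain v' where v': "trunc r (tev M (case_nat x e) t) v'" using trunc_exists by blast
  have "v' \<preceq> tev M (case_nat y e) t"
    by (rule le_trans[OF trunc_le[OF v'] tev_prefix_mono[OF x]])
  then have "v' \<preceq> tev M e tG \<cdot> tev M (case_nat y e) t" using le_trans le_cat_right by blast
  then have v'_T: "v' \<cdot> \<one> \<preceq> T" unfolding T_eq by (rule le_cat[OF _ le_refl])
  have V_c: "len V = len (T \<otimes> (x \<cdot> c))" unfolding times_c by (rule V)
  obtain B where B: "len (V \<cdot> B) = len (T \<otimes> (x \<cdot> c \<cdot> \<one>))" "entry T (V \<cdot> B) (x \<cdot> c) v'"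
    "\<And>v''. entry T (V \<cdot> B) (x \<cdot> c) v'' \<Longrightarrow> v'' = v'"
    "\<And>u' v''. u' \<cdot> \<one> \<preceq> x \<cdot> c \<Longrightarrow> entry T (V \<cdot> B) u' v'' \<Longrightarrow> entry T V u' v''"
    using entry_append[OF V_c v'_T] by metis
  define W' where "W' = W \<cdot> (r \<cdot> w)"
  have sub: "W \<unlhd> W'" "r \<unlhd> W'" "w \<unlhd> W'"
    unfolding W'_def using pref_sub[OF pref_cat] sub_cat sub_trans by meson+
  have "r \<cdot> w \<preceq> S" by (rule le_trans[OF le_cat[OF le_trans[OF r(1) tH] le_trans[OF r(2) tH]] bound])
  then have W': "W' \<preceq> S \<otimes> (x \<cdot> c \<cdot> \<one>)"
    unfolding W'_def using le_cat[OF W] by (simp add: times_c)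
  have "good (x \<cdot> c) (V \<cdot> B) W'"
    unfolding good_def
  proof (intro allI impI)
    fix u v'' assume u: "u \<sqsubseteq> x \<cdot> c" and en: "entry T (V \<cdot> B) u v''"
    from u c(2) consider "u = x \<cdot> c" | "u \<sqsubseteq> x" by blast
    then show "justified (V \<cdot> B) W' u v''"
    proof cases
      case 1
      \<comment> \<open>The new block has a single entry, so the step that produced
        \<open>v'\<close> justifies whatever is read there.\<close>
      then have [simp]: "v'' = v'" using en B(3) by blast
      have en': "entry T (V \<cdot> B) x v" by (rule entry_mono[OF v pref_cat])
      show ?thesis
        by (rule just, unfold step_def, rule exI[of _ x])
          (use 1 en' entry_sub[OF en'] sub r(3) v' pref_sub[OF pref_cat, of x c] in \<open>simp, blast\<close>)
    next
      case 2
      \<comment> \<open>\<open>u\<close> is strictly shorter than \<open>x \<cdot> c\<close>, so its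
        block lies in the old code.\<close>
      have "u \<cdot> \<one> \<preceq> x \<cdot> c" by (rule le_cat[OF pref_le[OF 2] len_eq_le]) (simp add: c(1))
      then have "entry T V u v''" using B(4) en by blast
      then have "justified V W u v''" using good 2 unfolding good_def by blast
      then show ?thesis by (rule justified_mono[OF _ pref_cat sub(1)])
    qed
  qed
  then have "traced (x \<cdot> c) (V \<cdot> B) W'" unfolding traced_def using B(1,2) W' by blast
  then show ?thesis by blast
qed

lemma step_tm_bounds:
  "tev M (case_nat y e) (step_tm t0) \<cdot> tev M (case_nat y e) (step_tm t0) \<preceq> S"
  "tev M (case_nat y e) (step_tm t1) \<cdot> tev M (case_nat y e) (step_tm t1) \<preceq> S"
proof -
  have *: "S = tev M e tG \<cdot> ((tev M (case_nat y e) (step_tm t0) \<cdot> tev M (case_nat y e) (step_tm t0)) \<cdot>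
    (tev M (case_nat y e) (step_tm t1) \<cdot> tev M (case_nat y e) (step_tm t1)))"
    unfolding S_def record_tm_def by simp
  show "tev M (case_nat y e) (step_tm t0) \<cdot> tev M (case_nat y e) (step_tm t0) \<preceq> S"
    unfolding * by (rule le_trans[OF le_cat_left le_cat_right])
  show "tev M (case_nat y e) (step_tm t1) \<cdot> tev M (case_nat y e) (step_tm t1) \<preceq> S"
    unfolding * by (rule le_trans[OF le_cat_right le_cat_right])
qed

text \<open>The one induction beyond \<open>sigma_b_0\<close>: \<open>V\<close> and \<open>W\<close>
  are not subwords of anything given and can only be bounded in length.\<close>

lemma traced_exists: "\<exists>V W. traced y V W"
proof -
  have times_mono: "s \<otimes> (x \<cdot> \<one>) \<preceq> s \<otimes> (y \<cdot> \<one>)" if "x \<sqsubseteq> y" for s x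
    by (rule le_times[OF le_refl le_cat[OF pref_le[OF that] le_refl]])
  \<comment> \<open>The class wants the length-bounded quantifiers in front, so the premise
    \<open>x \<sqsubseteq> y\<close> is moved inside. If it fails, empty words will do; if it holds,
    a trace respects the bounds taken at \<open>y\<close>.\<close>
  have conv: "(\<exists>V. V \<preceq> T \<otimes> (y \<cdot> \<one>) \<and> (\<exists>W. W \<preceq> S \<otimes> (y \<cdot> \<one>) \<and> (x \<sqsubseteq> y \<longrightarrow> traced x V W))) \<longleftrightarrow>
    (x \<sqsubseteq> y \<longrightarrow> (\<exists>V W. traced x V W))" for x
  proof (cases "x \<sqsubseteq> y")
    case True
    have "V \<preceq> T \<otimes> (y \<cdot> \<one>) \<and> W \<preceq> S \<otimes> (y \<cdot> \<one>)" if tr: "traced x V W" for V W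
      using tr le_trans[OF len_eq_le times_mono[OF True]] le_trans[OF _ times_mono[OF True]]
      unfolding traced_def by blast
    then show ?thesis using True by blast
  next
    case False
    then show ?thesis using eps_le by blast
  qed
  have "y \<sqsubseteq> y \<longrightarrow> (\<exists>V W. traced y V W)"
  proof (rule sigma_b_1_induction[where P = "\<lambda>x. x \<sqsubseteq> y \<longrightarrow> (\<exists>V W. traced x V W)"
      and B = "ExLenLe (Times (block_at 1) (Cat (Var 1) One)) (ExLenLe (Times (tsubst (\<lambda>i. Var (i + 2)) record_tm) (Cat (Var 2) One))
        (Imp (Prefix (Var 2) (Var 3))
          (Conj (Eq (Times One (Var 1)) (Times One (Times (block_at 3) (Cat (Var 2) One))))
          (Conj (LenLe (Var 0) (Times (tsubst (\<lambda>i. Var (i + 3)) record_tm) (Cat (Var 2) One)))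
          (Conj (fsubst (case_nat (Var 2) (case_nat (Var 1) (case_nat (Var 0) (\<lambda>i. Var (i + 3))))) Good)
            (ExSubword (Var 1) (Entry (block_at 4) (Var 2) (Var 3) (Var 0))))))))"
      and e = "case_nat y e"], goal_cases)
    case 1
    show ?case by (intro sigma_b_1.intros sigma_b_0_intros sigma_Good)
  next
    case (2 x)
    have blk: "tev M (case_nat x (case_nat y e)) (block_at 1) = T"
      "\<And>V W. tev M (case_nat W (case_nat V (case_nat x (case_nat y e)))) (block_at 3) = T"
      "\<And>V W v. tev M (case_nat v (case_nat W (case_nat V (case_nat x (case_nat y e))))) (block_at 4) = T"
      by (rule tev_block_at, simp add: numeral_eq_Suc)+
    have shift: "(\<lambda>i. case_nat V (case_nat x (case_nat y e)) (i + 2)) = case_nat y e"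
      "(\<lambda>i. case_nat W (case_nat V (case_nat x (case_nat y e))) (i + 3)) = case_nat y e" for V W
      by (rule ext, simp add: numeral_eq_Suc)+
    have sub: "(\<exists>v. v \<unlhd> V \<and> entry T V x v) \<longleftrightarrow> (\<exists>v. entry T V x v)" for V
      using entry_sub by blast
    show ?case
      by (rule trans[OF conv[symmetric]])
        (simp add: traced_def blk blk(1)[simplified] shift sat_Good sub len_def[symmetric] S_def[symmetric])
  next
    case 3
    show ?case using traced_eps by blast
  next
    case (4 x)
    show ?case
    proof
      assume x: "x \<cdot> \<zero> \<sqsubseteq> y"
      then have "x \<sqsubseteq> y" using pref_trans[OF pref_cat] by blast
      then obtain V W where "traced x V W" using 4 by blast
      then show "\<exists>V W. traced (x \<cdot> \<zero>) V W"
        by (rule traced_step[OF _ x _ _ H0 _ step_tm_bounds(1)]) (auto simp: justified_def)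
    qed
  next
    case (5 x)
    show ?case
    proof
      assume x: "x \<cdot> \<one> \<sqsubseteq> y"
      then have "x \<sqsubseteq> y" using pref_trans[OF pref_cat] by blast
      then obtain V W where "traced x V W" using 5 by blast
      then show "\<exists>V W. traced (x \<cdot> \<one>) V W"
        by (rule traced_step[OF _ x _ _ H1 _ step_tm_bounds(2)]) (auto simp: justified_def)
    qed
  qed
  then show ?thesis by simp
qed

lemma Trace_exists:
  "\<exists>z w. z \<preceq> tev M (case_nat y e) trace_tm \<and> w \<preceq> tev M (case_nat y e) trace_tm \<and>
    sat M (case_nat z (case_nat w (case_nat y e))) Trace"
proof -
  obtain V W z where V: "len V = len (T \<otimes> (y \<cdot> \<one>))" and W: "W \<preceq> S \<otimes> (y \<cdot> \<one>)" and good: "good y V W"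
    and z: "entry T V y z"
    using traced_exists unfolding traced_def by (elim exE conjE)
  have tm: "tev M (case_nat y e) trace_tm = (T \<otimes> (y \<cdot> \<one>)) \<cdot> (S \<otimes> (y \<cdot> \<one>))"
    unfolding trace_tm_def by (simp add: T_def S_def)
  have w: "V \<cdot> W \<preceq> tev M (case_nat y e) trace_tm"
    unfolding tm by (rule le_cat[OF len_eq_le[OF V] W])
  have "z \<preceq> V" by (rule sub_le[OF entry_sub[OF z]])
  then have "z \<preceq> tev M (case_nat y e) trace_tm" using le_trans[OF le_trans[OF _ le_cat_left] w] by blast
  moreover have "sat M (case_nat z (case_nat (V \<cdot> W) (case_nat y e))) Trace"
    unfolding sat_Trace using good z sub_cat pref_sub[OF pref_cat] by blast
  ultimately show ?thesis using w by blast
qed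

lemma Trace_unique:
  assumes "sat M (case_nat z (case_nat w (case_nat y e))) Trace"
    "sat M (case_nat z' (case_nat w' (case_nat y e))) Trace"
  shows "z = z'"
proof -
  obtain W V where 1: "entry T V y z" "good y V W"
    using assms(1) unfolding sat_Trace by (elim exE conjE)
  obtain W' V' where 2: "entry T V' y z'" "good y V' W'"
    using assms(2) unfolding sat_Trace by (elim exE conjE)
  show ?thesis by (rule trace_unique[OF 1(2) 2(2) pref_refl 1(1) 2(1)])
qed

end

text \<open>In the standard model the uniqueness argument is run against the function itself, now
  with genuine induction on \<open>u\<close>: an entry rests on an entry for the next shorter
  prefix, which is already known to be the value there.\<close>

lemma (in recursion) Trace_sound:
  assumes R: "\<And>e \<eta>. R [] e \<eta> = G e \<eta>"
    "\<And>u e \<eta>. R (u @ [False]) e \<eta> = take (length (tval (case_nat u e) t)) (H0 (case_nat (R u e \<eta>) (case_nat u e)) \<eta>)"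
    "\<And>u e \<eta>. R (u @ [True]) e \<eta> = take (length (tval (case_nat u e) t)) (H1 (case_nat (R u e \<eta>) (case_nat u e)) \<eta>)"
    and sat: "sat (std \<eta>) (case_nat z (case_nat w (case_nat y e))) Trace"
  shows "z = R y e \<eta>"
proof -
  interpret rm: recursion_model "std \<eta>" G H0 H1 DG D0 D1 tG t0 t1 t e y
    by unfold_locales
  obtain W V where V: "std.entry \<eta> rm.T V y z" and good: "rm.good y V W"
    using sat unfolding rm.sat_Trace by (elim exE conjE)
  have just: "rm.justified V W u v" if "prefix u y" "std.entry \<eta> rm.T V u v" for u v
    using good that unfolding rm.good_def by simp
  have "prefix u y \<Longrightarrow> std.entry \<eta> rm.T V u v \<Longrightarrow> v = R u e \<eta>" for u v
  proof (induction u arbitrary: v rule: rev_induct)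
    case Nil
    from just[OF this] have "rm.justified V W (Eps_of (std \<eta>)) v" by simp
    from rm.justified_eps[OF this] show ?case using graph_std[OF G] by (auto simp: R(1))
  next
    case (snoc b u)
    have u: "prefix u y" using snoc.prems(1) by (auto simp: prefix_def)
    show ?case
    proof (cases b)
      case True
      then have "rm.justified V W (Cat_of (std \<eta>) u (One_of (std \<eta>))) v"
        using just[OF snoc.prems] by simp
      from rm.justified_one[OF this] obtain v0 r w where 1: "std.entry \<eta> rm.T V u v0"
        "sat (std \<eta>) (case_nat r (case_nat w (case_nat v0 (case_nat u e)))) D1"
        "std.trunc \<eta> r (tev (std \<eta>) (case_nat u e) t) v" by (elim exE conjE)
      have "v0 = R u e \<eta>" by (rule snoc.IH[OF u 1(1)])
      then have "r = H1 (case_nat (R u e \<eta>) (case_nat u e)) \<eta>" using graph_std[OF H1 1(2)] by simp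
      then show ?thesis using std_trunc[OF 1(3)] True by (simp add: R(3))
    next
      case False
      then have "rm.justified V W (Cat_of (std \<eta>) u (Zero_of (std \<eta>))) v"
        using just[OF snoc.prems] by simp
      from rm.justified_zero[OF this] obtain v0 r w where 1: "std.entry \<eta> rm.T V u v0"
        "sat (std \<eta>) (case_nat r (case_nat w (case_nat v0 (case_nat u e)))) D0"
        "std.trunc \<eta> r (tev (std \<eta>) (case_nat u e) t) v" by (elim exE conjE)
      have "v0 = R u e \<eta>" by (rule snoc.IH[OF u 1(1)])
      then have "r = H0 (case_nat (R u e \<eta>) (case_nat u e)) \<eta>" using graph_std[OF H0 1(2)] by simp
      then show ?thesis using std_trunc[OF 1(3)] False by (simp add: R(2))
    qed
  qed
  then show ?thesis using V by simp
qed

lemma case_nat_eta: "case_nat (e 0) (\<lambda>i. e (Suc i)) = e"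
  by (auto simp: fun_eq_iff split: nat.split)

text \<open>The recursion argument is index 0 and the parameters follow; the step functions see the
  previous value at index 0 and the recursion argument at index 1.\<close>

lemma total_rec:
  assumes tot: "total G" "total H0" "total H1"
    and R: "\<And>e \<eta>. R [] e \<eta> = G e \<eta>"
    "\<And>u e \<eta>. R (u @ [False]) e \<eta> = take (length (tval (case_nat u e) t)) (H0 (case_nat (R u e \<eta>) (case_nat u e)) \<eta>)"
    "\<And>u e \<eta>. R (u @ [True]) e \<eta> = take (length (tval (case_nat u e) t)) (H1 (case_nat (R u e \<eta>) (case_nat u e)) \<eta>)"
  shows "total (\<lambda>e \<eta>. R (e 0) (\<lambda>i. e (Suc i)) \<eta>)"
proof -
  obtain DG tG where G: "graph G DG tG" using tot(1) unfolding total_def by (elim exE)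
  obtain D0 t0 where H0: "graph H0 D0 t0" using tot(2) unfolding total_def by (elim exE)
  obtain D1 t1 where H1: "graph H1 D1 t1" using tot(3) unfolding total_def by (elim exE)
  interpret rec: recursion G H0 H1 DG D0 D1 tG t0 t1 t
    by unfold_locales (rule G H0 H1)+
  have "graph (\<lambda>e \<eta>. R (e 0) (\<lambda>i. e (Suc i)) \<eta>) rec.Trace rec.trace_tm"
  proof (rule graphI)
    show "sigma_b_0 rec.Trace" by (rule rec.sigma_Trace)
  next
    fix M and e :: "nat \<Rightarrow> str" assume "rs_model M"
    then interpret rs_model M .
    interpret rm: recursion_model M G H0 H1 DG D0 D1 tG t0 t1 t "\<lambda>i. e (Suc i)" "e 0"
      by unfold_locales
    show "\<exists>z w. le z (tev M e rec.trace_tm) \<and> le w (tev M e rec.trace_tm) \<and>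
        sat M (case_nat z (case_nat w e)) rec.Trace"
      using rm.Trace_exists unfolding case_nat_eta .
  next
    fix M z z' w w' and e :: "nat \<Rightarrow> str" assume "rs_model M"
    then interpret rs_model M .
    interpret rm: recursion_model M G H0 H1 DG D0 D1 tG t0 t1 t "\<lambda>i. e (Suc i)" "e 0"
      by unfold_locales
    assume "sat M (case_nat z (case_nat w e)) rec.Trace" "sat M (case_nat z' (case_nat w' e)) rec.Trace"
    then show "z = z'" by (rule rm.Trace_unique[unfolded case_nat_eta])
  next
    fix \<eta> z w and e :: "nat \<Rightarrow> str"
    assume "sat (std \<eta>) (case_nat z (case_nat w e)) rec.Trace"
    then have "sat (std \<eta>) (case_nat z (case_nat w (case_nat (e 0) (\<lambda>i. e (Suc i))))) rec.Trace"
      unfolding case_nat_eta .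
    then show "z = R (e 0) (\<lambda>i. e (Suc i)) \<eta>" by (rule rec.Trace_sound[OF R])
  qed
  then show ?thesis unfolding total_def by (intro exI)
qed

subsection \<open>Representability\<close>

lemma tval_cong: "(\<And>n. n \<in> tvars t \<Longrightarrow> e n = e' n) \<Longrightarrow> tval e t = tval e' t"
  using tev_cong[of t e e' "std undefined"] by simp

lemma total_eqI:
  assumes "total F" "\<And>e \<eta>. F' e \<eta> = F e \<eta>"
  shows "total F'"
proof -
  have "F' = F" by (intro ext assms(2))
  with assms(1) show ?thesis by simp
qed

lemma total_of_POR: "POR k f \<Longrightarrow> total (\<lambda>e \<eta>. f (map e [0..<k]) \<eta>)"
proof (induction rule: POR.induct)
  case (Empty k f)
  show ?case by (rule total_eqI[OF total_term[of Eps]]) (simp add: Empty)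
next
  case (Proj i k f)
  show ?case by (rule total_eqI[OF total_term[of "Var i"]]) (simp add: Proj)
next
  case (Word_Succ f b)
  show ?case by (rule total_eqI[OF total_term[of "Cat (Var 0) (bit_tm b)"]]) (cases b; simp add: Word_Succ)
next
  case (Cond f)
  show ?case
  proof (rule total_eqI[OF total_cond])
    fix e :: "nat \<Rightarrow> str" and \<eta>
    have "map e [0..<4] = [e 0, e 1, e 2, e 3]" by (simp add: upt_rec numeral_eq_Suc)
    then show "f (map e [0..<4]) \<eta> = (if e 0 = [] then e 1 else if last (e 0) then e 3 else e 2)"
      by (cases "e 0" rule: rev_cases) (auto simp: Cond)
  qed
next
  case (Query f)
  show ?case by (rule total_eqI[OF total_query]) (simp add: Query)
next
  case (Comp hs g k f)
  let ?Hs = "map (\<lambda>h e \<eta>. h (map e [0..<k]) \<eta>) hs"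
  show ?case
  proof (rule total_eqI[OF total_comp_list[of _ ?Hs]])
    show "total (\<lambda>e \<eta>. g (map e [0..<length hs]) \<eta>)" by (rule Comp.IH(1))
    show "total H" if "H \<in> set ?Hs" for H using that Comp.IH(2) by auto
    fix e :: "nat \<Rightarrow> str" and \<eta>
    let ?ys = "map (\<lambda>h. h (map e [0..<k]) \<eta>) hs"
    have "map (prepend ?ys e) [0..<length hs] = ?ys" using map_prepend[of ?ys e] by simp
    then show "f (map e [0..<k]) \<eta> =
        g (map (prepend (map (\<lambda>H. H e \<eta>) ?Hs) e) [0..<length hs]) \<eta>"
      by (simp add: Comp.hyps(2) comp_def)
  qed
next
  case (Bounded_Rec k g h0 h1 t f)
  \<comment> \<open>Bridges two argument orders: \<open>POR\<close> lists the parameters, then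
    \<open>y\<close> and the previous value, whereas \<open>total_rec\<close> has the previous value
    at 0, \<open>y\<close> at 1 and the parameters from 2 on.\<close>
  let ?r = "\<lambda>i. if i < k then i + 2 else if i = k then 1 else 0"
  let ?H = "\<lambda>h e \<eta>. h (map (\<lambda>i. e (?r i)) [0..<k + 2]) \<eta>"
  let ?R = "\<lambda>u e \<eta>. f (map e [0..<k] @ [u]) \<eta>"
  let ?t = "tsubst (\<lambda>i. if i < k then Var (Suc i) else Var 0) t"
  have H: "?H h (case_nat v (case_nat u e)) \<eta> = h (map e [0..<k] @ [u, v]) \<eta>" for h v u \<eta> and e :: "nat \<Rightarrow> str"
  proof -
    have "map (\<lambda>i. case_nat v (case_nat u e) (?r i)) [0..<k + 2] = map e [0..<k] @ [u, v]"
      by (rule nth_equalityI) (auto simp: nth_append less_Suc_eq numeral_2_eq_2)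
    then show ?thesis by (rule arg_cong)
  qed
  have t: "tval (case_nat u e) ?t = tval (\<lambda>i. (map e [0..<k] @ [u]) ! i) t" for u e
  proof -
    have "tval (\<lambda>i. (map e [0..<k] @ [u]) ! i) t = tval (\<lambda>i. if i < k then e i else u) t"
      by (rule tval_cong) (use Bounded_Rec.hyps(4) in \<open>auto simp: nth_append\<close>)
    moreover have "tval (case_nat u e) ?t = tval (\<lambda>i. if i < k then e i else u) t"
      unfolding tev_std[of undefined, symmetric] tev_tsubst by (rule tev_cong) auto
    ultimately show ?thesis by simp
  qed
  have "total (\<lambda>e \<eta>. ?R (e 0) (\<lambda>i. e (Suc i)) \<eta>)"
  proof (rule total_rec[where R = ?R and t = ?t])
    show "total (\<lambda>e. g (map e [0..<k]))" by (rule Bounded_Rec.IH(1))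
    show "total (?H h0)" "total (?H h1)"
      using total_rename[OF Bounded_Rec.IH(2), of ?r] total_rename[OF Bounded_Rec.IH(3), of ?r] by blast+
    show "?R [] e \<eta> = g (map e [0..<k]) \<eta>" for e \<eta> by (simp add: Bounded_Rec.hyps(5))
    show "?R (u @ [False]) e \<eta> = take (length (tval (case_nat u e) ?t)) (?H h0 (case_nat (?R u e \<eta>) (case_nat u e)) \<eta>)"
      for u e \<eta> unfolding H t by (simp add: Bounded_Rec.hyps(6))
    show "?R (u @ [True]) e \<eta> = take (length (tval (case_nat u e) ?t)) (?H h1 (case_nat (?R u e \<eta>) (case_nat u e)) \<eta>)"
      for u e \<eta> unfolding H t by (simp add: Bounded_Rec.hyps(7))
  qed
  \<comment> \<open>Moves the recursion argument from index 0 to its place \<open>k\<close> behind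
    the parameters.\<close>
  from total_rename[OF this, of "case_nat k id"]
  show ?case by (rule total_eqI) simp
qed

lemma tvars_tsubst: "tvars (tsubst \<theta> t) = (\<Union>n\<in>tvars t. tvars (\<theta> n))"
  by (induction t) auto

lemma tvars_tlift: "tvars (tlift t) = Suc ` tvars t"
  by (auto simp: tlift_def tvars_tsubst)

lemma fvars_fsubst: "fvars (fsubst \<theta> A) \<subseteq> (\<Union>n. tvars (\<theta> n))"
proof (induction A arbitrary: \<theta>)
  case (Ex A)
  have "(\<Union>n. tvars (under_binder \<theta> n)) \<subseteq> insert 0 (Suc ` (\<Union>n. tvars (\<theta> n)))"
    by (intro UN_least) (auto simp: under_binder_def tvars_tlift split: nat.split)
  with Ex.IH have "fvars (fsubst (under_binder \<theta>) A) \<subseteq> insert 0 (Suc ` (\<Union>n. tvars (\<theta> n)))"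
    by (rule order.trans)
  then show ?case by fastforce
next
  case (All A)
  have "(\<Union>n. tvars (under_binder \<theta> n)) \<subseteq> insert 0 (Suc ` (\<Union>n. tvars (\<theta> n)))"
    by (intro UN_least) (auto simp: under_binder_def tvars_tlift split: nat.split)
  with All.IH have "fvars (fsubst (under_binder \<theta>) A) \<subseteq> insert 0 (Suc ` (\<Union>n. tvars (\<theta> n)))"
    by (rule order.trans)
  then show ?case by fastforce
next
  case (Conj A B)
  show ?case using Conj.IH[of \<theta>] by simp
next
  case (Disj A B)
  show ?case using Disj.IH[of \<theta>] by simp
next
  case (Imp A B)
  show ?case using Imp.IH[of \<theta>] by simp
next
  case (Neg A)
  show ?case using Neg.IH[of \<theta>] by simp
qed (auto simp: tvars_tsubst)

lemma tval_numeral [simp]: "tval \<xi> (numeral_tm \<sigma>) = \<sigma>"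
proof (induction \<sigma> rule: rev_induct)
  case (snoc b \<sigma>)
  then show ?case by (cases b) (simp_all add: numeral_tm_def)
qed (simp add: numeral_tm_def)

text \<open>The witness of \<open>D\<close> is now quantified within its bound. \<open>D\<close> and
  \<open>t\<close> may mention indices beyond the arguments; these are set to the empty word, in
  models by \<open>cut\<close>, which yields the required free variables.\<close>

lemma representable_of_total:
  assumes "total (\<lambda>e \<eta>. f (map e [0..<k]) \<eta>)"
  shows "sigma_b_1_representable k f"
proof -
  obtain D t where D: "graph (\<lambda>e \<eta>. f (map e [0..<k]) \<eta>) D t"
    using assms unfolding total_def by (elim exE)
  define F where "F = ExLenLe (tsubst (\<lambda>i. if i < k then Var (i + 1) else Eps) t)
    (fsubst (case_nat (Var 1) (case_nat (Var 0) (\<lambda>i. if i < k then Var (i + 2) else Eps))) D)"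
  have sigma: "sigma_b_1 F"
    unfolding F_def by (intro sigma_b_1.intros sigma_b_0_fsubst graph_sigma[OF D])
  have "tvars (tsubst (\<lambda>i. if i < k then Var (i + 1) else Eps) t) \<subseteq> {..k}"
    by (auto simp: tvars_tsubst split: if_splits)
  moreover have "fvars (fsubst (case_nat (Var 1) (case_nat (Var 0) (\<lambda>i. if i < k then Var (i + 2) else Eps))) D) \<subseteq> {..Suc k}"
    by (rule order.trans[OF fvars_fsubst]) (auto split: nat.splits if_splits)
  ultimately have fv: "fvars F \<subseteq> {..k}"
    by (auto simp: F_def ExLenLe_def LenLe_def tvars_tlift)
  define cut :: "interp \<Rightarrow> (nat \<Rightarrow> str) \<Rightarrow> nat \<Rightarrow> str"
    where "cut M e = (\<lambda>i. if i < k then e i else Eps_of M)" for M e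
  have satF: "sat M (case_nat z e) F \<longleftrightarrow>
      (\<exists>w. rs_model.le M w (tev M (cut M e) t) \<and> sat M (case_nat z (case_nat w (cut M e))) D)"
    if M: "models M RS12" for M z e
  proof -
    interpret rs_model M by (rule rs_model.intro[OF M])
    have env: "(\<lambda>n. tev M (case_nat z e) (if n < k then Var (n + 1) else Eps)) = cut M e"
      "(\<lambda>n. tev M (case_nat w (case_nat z e)) (if n < k then Var (n + 2) else Eps)) = cut M e" for w
      by (auto simp: cut_def fun_eq_iff numeral_2_eq_2)
    show ?thesis unfolding F_def sat_ExLenLe sat_fsubst tev_tsubst tev_case_nat env by simp
  qed
  have ex: "RS12 \<turnstile> all_n k (Ex F)"
  proof (rule RS12_completeness)
    show "fvars (Ex F) \<subseteq> {..<k}" using fv by auto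
    fix M e assume M: "models M RS12"
    interpret rs_model M by (rule rs_model.intro[OF M])
    obtain z w where "le w (tev M (cut M e) t)" "sat M (case_nat z (case_nat w (cut M e))) D"
      by (rule graph_exists[OF D])
    then have "sat M (case_nat z e) F" unfolding satF[OF M] by (intro exI conjI)
    then show "sat M e (Ex F)" by auto
  qed
  have uniq: "RS12 \<turnstile> all_n k (All (All (Imp
       (Conj (fsubst (case_nat (Var 1) (\<lambda>i. Var (i + 2))) F)
             (fsubst (case_nat (Var 0) (\<lambda>i. Var (i + 2))) F))
       (Eq (Var 1) (Var 0)))))" (is "RS12 \<turnstile> all_n k ?U")
  proof (rule RS12_completeness)
    have "fvars (fsubst (case_nat (Var j) (\<lambda>i. Var (i + 2))) F) \<subseteq> {..<k + 2}" if "j < 2" for j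
    proof -
      \<comment> \<open>A substitution matters on free variables only, so the infinitely many other
        indices can be sent to \<open>Eps\<close>, after which \<open>fvars_fsubst\<close> gives a
        finite bound.\<close>
      have "fsubst (case_nat (Var j) (\<lambda>i. Var (i + 2))) F =
          fsubst (case_nat (Var j) (\<lambda>i. if i < k then Var (i + 2) else Eps)) F"
        by (rule fsubst_cong) (use fv in \<open>auto split: nat.split\<close>)
      also have "fvars \<dots> \<subseteq> {..<k + 2}"
        by (rule order.trans[OF fvars_fsubst]) (use that in \<open>auto split: nat.splits if_splits\<close>)
      finally show ?thesis .
    qed
    from this[of 0] this[of 1] show "fvars ?U \<subseteq> {..<k}" by auto
    fix M e assume M: "models M RS12"
    interpret rs_model M by (rule rs_model.intro[OF M])
    have shift: "(\<lambda>n. tev M (case_nat z (case_nat y e)) (Var (n + 2))) = e" for z y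
      by (auto simp: fun_eq_iff numeral_2_eq_2)
    have "y = z" if "sat M (case_nat y e) F" "sat M (case_nat z e) F" for y z
      using that graph_unique[OF D] unfolding satF[OF M] by (elim exE conjE)
    then show "sat M e ?U"
      unfolding sat.simps sat_fsubst tev_case_nat shift by simp
  qed
  have std: "f \<sigma>s \<eta> = \<tau> \<longleftrightarrow>
      \<eta> \<in> oracles_of \<xi> (fsubst (case_nat (numeral_tm \<tau>) (\<lambda>i. numeral_tm (\<sigma>s ! i))) F)"
    if len: "length \<sigma>s = k" for \<sigma>s \<tau> \<eta> \<xi>
  proof -
    let ?e = "cut (std \<eta>) (\<lambda>i. \<sigma>s ! i)"
    have args: "map ?e [0..<k] = \<sigma>s"
      by (rule nth_equalityI) (simp_all add: cut_def len)
    have "\<eta> \<in> oracles_of \<xi> (fsubst (case_nat (numeral_tm \<tau>) (\<lambda>i. numeral_tm (\<sigma>s ! i))) F) \<longleftrightarrow>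
        sat (std \<eta>) (case_nat \<tau> (\<lambda>i. \<sigma>s ! i)) F"
      by (simp add: sat_std[symmetric])
    also have "\<dots> \<longleftrightarrow> (\<exists>w. std.le \<eta> w (tev (std \<eta>) ?e t) \<and> sat (std \<eta>) (case_nat \<tau> (case_nat w ?e)) D)"
      by (rule satF[OF models_std])
    also have "\<dots> \<longleftrightarrow> f \<sigma>s \<eta> = \<tau>"
    proof
      assume "\<exists>w. std.le \<eta> w (tev (std \<eta>) ?e t) \<and> sat (std \<eta>) (case_nat \<tau> (case_nat w ?e)) D"
      then show "f \<sigma>s \<eta> = \<tau>" using graph_std[OF D, of \<eta> \<tau> _ ?e] unfolding args by auto
    next
      assume \<tau>: "f \<sigma>s \<eta> = \<tau>"
      \<comment> \<open>Some value has a bounded witness in the standard model, and soundness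
        identifies that value with \<open>\<tau>\<close>.\<close>
      obtain z w where "std.le \<eta> w (tev (std \<eta>) ?e t)" "sat (std \<eta>) (case_nat z (case_nat w ?e)) D"
        by (rule std.graph_exists[OF D])
      moreover from graph_std[OF D this(2)] have "z = \<tau>" unfolding args \<tau> .
      ultimately show "\<exists>w. std.le \<eta> w (tev (std \<eta>) ?e t) \<and> sat (std \<eta>) (case_nat \<tau> (case_nat w ?e)) D"
        by (intro exI conjI) simp_all
    qed
    finally show ?thesis by simp
  qed
  show ?thesis
    unfolding sigma_b_1_representable_def using sigma fv ex uniq std by (intro exI conjI allI impI)
qed

theorem mainTheorem2:
  fixes f :: "str list \<Rightarrow> bit_oracle \<Rightarrow> str" and k :: nat
  assumes "POR k f"
  shows "sigma_b_1_representable k f"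
  using assms by (rule representable_of_total[OF total_of_POR])

end
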